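(* Let $D\subset\mathbb{R}^2$ be a polygonal domain, let $\Gamma=\Gamma_1\times\cdots\times\Gamma_M\subset\mathbb{R}^M$ be a bounded box, and let $p\colon\Gamma\to\mathbb{R}^+$ be a probability density on $\Gamma$. Let $\widetilde{a}\colon D\times\Gamma\to\mathbb{R}$ be measurable with $$0<\widetilde{a}_{\min}\le\widetilde{a}(\boldsymbol{x},\boldsymbol{y})\le\widetilde{a}_{\max}<\infty\quad\text{a.e. in }D\times\Gamma$$ for some constants $\widetilde{a}_{\min}\le\widetilde{a}_{\max}$, let $\widetilde{f}\in L_p^2(\Gamma;L^2(D))$, and let $\widetilde{g}$ be an obstacle function on $D\times\Gamma$ with well-defined values at the finite element nodes. Then the fully discrete problem $$\widetilde{u}^{hs}\in\widetilde{\mathcal{K}}^{hs},\qquad \widetilde{b}(\widetilde{u}^{hs},v^{hs}-\widetilde{u}^{hs})\ge\widetilde{\ell}(v^{hs}-\widetilde{u}^{hs})\quad\forall\, v^{hs}\in\widetilde{\mathcal{K}}^{hs}$$ admits a unique solution, where $\widetilde{\mathcal{K}}^{hs}$, $\widetilde{b}$, $\widetilde{\ell}$ are as defined in the context.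
   Context: $L_p^2(\Gamma;X)$ is the space of $v\colon D\times\Gamma\to\mathbb{R}$ with $\int_\Gamma p(\boldsymbol{y})\|v(\cdot,\boldsymbol{y})\|_X^2\,\mathrm{d}\boldsymbol{y}<\infty$; $W=L_p^2(\Gamma;H_0^1(D))$ with norm $\|v\|_W=(\int_\Gamma p(\boldsymbol{y})\|\nabla v(\cdot,\boldsymbol{y})\|_{L^2(D)}^2\,\mathrm{d}\boldsymbol{y})^{1/2}$, gradients being with respect to $\boldsymbol{x}$. For $u,v\in W$, $$\widetilde{b}(u,v)=\int_\Gamma p\int_D\widetilde{a}\,\nabla u\cdot\nabla v\,\mathrm{d}\boldsymbol{x}\,\mathrm{d}\boldsymbol{y},\qquad \widetilde{\ell}(v)=\int_\Gamma p\int_D\widetilde{f}\,v\,\mathrm{d}\boldsymbol{x}\,\mathrm{d}\boldsymbol{y}.$$ Discretization: $\mathcal{T}_h^D$ is a (conforming) triangulation of $D$ and $X^h\subset H_0^1(D)$ is the space of continuous piecewise linear functions on it vanishing on $\partial D$, with nodal basis $\varphi_1,\dots,\varphi_I$ associated with the interior nodes $\boldsymbol{x}_1,\dots,\boldsymbol{x}_I$. $\overline{\Gamma}$ is partitioned into finitely many boxes $B_\gamma=\prod_{k=1}^M[a_k^\gamma,b_k^\gamma]$ with disjoint interiors (forming a tensor-product grid), and $Y^s\subset L^2(\Gamma)$ is the space of continuous piecewise multilinear functions (degree at most $1$ in each $y_k$ on each box), with nodal basis $\psi_1,\dots,\psi_J$ associated with the box vertices $\boldsymbol{y}_1,\dots,\boldsymbol{y}_J$.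 Set $W^{hs}=X^h\otimes Y^s=\operatorname{span}\{\varphi_i(\boldsymbol{x})\psi_j(\boldsymbol{y})\}$. The nodes are the points $(\boldsymbol{x}_i,\boldsymbol{y}_j)$, $1\le i\le I$, $1\le j\le J$, and $$\widetilde{\mathcal{K}}^{hs}=\{v^{hs}\in W^{hs}\mid v^{hs}(\boldsymbol{x}_i,\boldsymbol{y}_j)\ge\widetilde{g}(\boldsymbol{x}_i,\boldsymbol{y}_j)\ \text{for all nodes }(\boldsymbol{x}_i,\boldsymbol{y}_j)\}.$$ *)

theory Defs
  imports "HOL-Analysis.Analysis"
begin

section \<open>Domains and data\<close>

text \<open>The condition \<open>interior (closure D) = D\<close> says that \<open>D\<close> lies on one side of its boundary
  only: slits and punctures are excluded, holes are allowed.\<close>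

definition polygonal_domain :: "(real^2) set \<Rightarrow> bool" where
  "polygonal_domain D \<longleftrightarrow>
     open D \<and> connected D \<and> bounded D \<and> D \<noteq> {} \<and> interior (closure D) = D \<and>
     (\<exists>P. finite P \<and> frontier D = (\<Union>(a, b)\<in>P. closed_segment a b))"

text \<open>The factors may be open, closed or half-open.\<close>

definition bounded_box :: "(real^'m) set \<Rightarrow> bool" where
  "bounded_box \<Gamma> \<longleftrightarrow>
     (\<exists>I :: 'm \<Rightarrow> real set. (\<forall>k. is_interval (I k) \<and> bounded (I k)) \<and> \<Gamma> = {y. \<forall>k. y $ k \<in> I k})"

definition positive_density :: "(real^'m) set \<Rightarrow> (real^'m \<Rightarrow> real) \<Rightarrow> bool" where
  "positive_density \<Gamma> p \<longleftrightarrow>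
     (\<forall>y\<in>\<Gamma>. 0 < p y) \<and> has_bochner_integral (lebesgue_on \<Gamma>) p 1"

definition L2p_L2 ::
  "(real^2) set \<Rightarrow> (real^'m) set \<Rightarrow> (real^'m \<Rightarrow> real) \<Rightarrow> ((real^2) \<times> (real^'m) \<Rightarrow> real) set" where
  "L2p_L2 D \<Gamma> p =
     {v. v \<in> borel_measurable (lebesgue_on (D \<times> \<Gamma>)) \<and>
         (\<integral>\<^sup>+y. ennreal (p y) * (\<integral>\<^sup>+x. ennreal ((v (x, y))\<^sup>2) \<partial>lebesgue_on D) \<partial>lebesgue_on \<Gamma>) < \<infinity>}"

section \<open>Weak gradients\<close>

primrec C_diff :: "nat \<Rightarrow> ('a::euclidean_space \<Rightarrow> real) \<Rightarrow> bool" where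
  "C_diff 0 f \<longleftrightarrow> continuous_on UNIV f"
| "C_diff (Suc n) f \<longleftrightarrow>
     (\<forall>x. f differentiable (at x)) \<and> (\<forall>v. C_diff n (\<lambda>x. frechet_derivative f (at x) v))"

definition test_functions :: "'a::euclidean_space set \<Rightarrow> ('a \<Rightarrow> real) set" where
  "test_functions D =
     {\<phi>. (\<forall>n. C_diff n \<phi>) \<and> (\<exists>K. compact K \<and> K \<subseteq> D \<and> (\<forall>x. x \<notin> K \<longrightarrow> \<phi> x = 0))}"

definition locally_integrable ::
  "'a::euclidean_space set \<Rightarrow> ('a \<Rightarrow> 'b::euclidean_space) \<Rightarrow> bool" where
  "locally_integrable D u \<longleftrightarrow> (\<forall>K. compact K \<and> K \<subseteq> D \<longrightarrow> integrable (lebesgue_on K) u)"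

definition has_weak_gradient ::
  "(real^'n) set \<Rightarrow> (real^'n \<Rightarrow> real) \<Rightarrow> (real^'n \<Rightarrow> real^'n) \<Rightarrow> bool" where
  "has_weak_gradient D u G \<longleftrightarrow>
     locally_integrable D u \<and> locally_integrable D G \<and>
     (\<forall>\<phi>\<in>test_functions D. \<forall>i.
        (LINT x|lebesgue_on D. u x * frechet_derivative \<phi> (at x) (axis i 1)) =
        - (LINT x|lebesgue_on D. G x $ i * \<phi> x))"

text \<open>A weak gradient is determined up to a null set of \<open>D\<close>; it is used under integrals only.\<close>

definition weak_gradient :: "(real^'n) set \<Rightarrow> (real^'n \<Rightarrow> real) \<Rightarrow> real^'n \<Rightarrow> real^'n" where
  "weak_gradient D u = (SOME G. has_weak_gradient D u G)"

section \<open>The variational forms\<close>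

definition b_form ::
  "(real^2) set \<Rightarrow> (real^'m) set \<Rightarrow> (real^'m \<Rightarrow> real) \<Rightarrow> ((real^2) \<times> (real^'m) \<Rightarrow> real) \<Rightarrow>
   ((real^2) \<times> (real^'m) \<Rightarrow> real) \<Rightarrow> ((real^2) \<times> (real^'m) \<Rightarrow> real) \<Rightarrow> real" where
  "b_form D \<Gamma> p a u v =
     (LINT y|lebesgue_on \<Gamma>. p y *
       (LINT x|lebesgue_on D. a (x, y) *
         (weak_gradient D (\<lambda>x. u (x, y)) x \<bullet> weak_gradient D (\<lambda>x. v (x, y)) x)))"

definition l_form ::
  "(real^2) set \<Rightarrow> (real^'m) set \<Rightarrow> (real^'m \<Rightarrow> real) \<Rightarrow> ((real^2) \<times> (real^'m) \<Rightarrow> real) \<Rightarrow>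
   ((real^2) \<times> (real^'m) \<Rightarrow> real) \<Rightarrow> real" where
  "l_form D \<Gamma> p f v =
     (LINT y|lebesgue_on \<Gamma>. p y * (LINT x|lebesgue_on D. f (x, y) * v (x, y)))"

section \<open>Meshes\<close>

text \<open>Conformity (two triangles meet in a common face, possibly empty) is part of the library
  notion \<^const>\<open>triangulation\<close>.\<close>

definition triangulates :: "(real^2) set set \<Rightarrow> (real^2) set \<Rightarrow> bool" where
  "triangulates \<T> D \<longleftrightarrow> triangulation \<T> \<and> (\<forall>T\<in>\<T>. 2 simplex T) \<and> \<Union>\<T> = closure D"

definition consecutive :: "real set \<Rightarrow> real \<Rightarrow> real \<Rightarrow> bool" where
  "consecutive G s t \<longleftrightarrow> s \<in> G \<and> t \<in> G \<and> s < t \<and> (\<forall>r\<in>G. \<not> (s < r \<and> r < t))"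

text \<open>\<open>G k\<close> is the set of grid points on the \<open>k\<close>-th axis.\<close>

definition tensor_grid :: "(real^'m) set set \<Rightarrow> (real^'m) set \<Rightarrow> bool" where
  "tensor_grid \<B> \<Gamma> \<longleftrightarrow>
     \<B> division_of closure \<Gamma> \<and>
     (\<exists>G :: 'm \<Rightarrow> real set. (\<forall>k. finite (G k)) \<and>
        \<B> = {cbox a b | a b. \<forall>k. consecutive (G k) (a $ k) (b $ k)})"

definition mesh_vertices :: "'a::real_vector set set \<Rightarrow> 'a set" where
  "mesh_vertices \<M> = {z. \<exists>S\<in>\<M>. z extreme_point_of S}"

section \<open>Finite element spaces\<close>

text \<open>Finite element functions are represented by total functions that are \<open>0\<close> outside
  \<open>closure D\<close> and \<open>closure \<Gamma>\<close> respectively, so that equality of functions means equality on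
  these closures. In \<open>X_h\<close> this and the boundary condition on \<open>frontier D\<close> together
  read \<open>v x = 0\<close> for \<open>x \<notin> D\<close>.\<close>

definition X_h :: "(real^2) set \<Rightarrow> (real^2) set set \<Rightarrow> (real^2 \<Rightarrow> real) set" where
  "X_h D \<T> =
     {v. continuous_on (closure D) v \<and>
         (\<forall>T\<in>\<T>. \<exists>c d. \<forall>x\<in>T. v x = c \<bullet> x + d) \<and>
         (\<forall>x. x \<notin> D \<longrightarrow> v x = 0)}"

text \<open>Polynomials of degree at most \<open>1\<close> in each variable are the combinations of the
  square-free monomials, which are indexed by the sets \<open>S\<close> of variables.\<close>

definition Y_s :: "(real^'m) set \<Rightarrow> (real^'m) set set \<Rightarrow> (real^'m \<Rightarrow> real) set" where
  "Y_s \<Gamma> \<B> =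
     {w. continuous_on (closure \<Gamma>) w \<and>
         (\<forall>B\<in>\<B>. \<exists>c :: 'm set \<Rightarrow> real. \<forall>y\<in>B. w y = (\<Sum>S\<in>UNIV. c S * (\<Prod>k\<in>S. y $ k))) \<and>
         (\<forall>y. y \<notin> closure \<Gamma> \<longrightarrow> w y = 0)}"

text \<open>The span of the products \<open>\<phi>(x) \<psi>(y)\<close>; scalar factors are absorbed into \<open>\<phi>\<close>, both
  argument spaces being linear.\<close>

definition tensor_space :: "('a \<Rightarrow> real) set \<Rightarrow> ('b \<Rightarrow> real) set \<Rightarrow> ('a \<times> 'b \<Rightarrow> real) set" where
  "tensor_space X Y =
     {(\<lambda>(x, y). \<Sum>i<n. \<phi> i x * \<psi> i y) | (n::nat) \<phi> \<psi>. \<forall>i<n. \<phi> i \<in> X \<and> \<psi> i \<in> Y}"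

definition W_hs ::
  "(real^2) set \<Rightarrow> (real^2) set set \<Rightarrow> (real^'m) set \<Rightarrow> (real^'m) set set \<Rightarrow>
   ((real^2) \<times> (real^'m) \<Rightarrow> real) set" where
  "W_hs D \<T> \<Gamma> \<B> = tensor_space (X_h D \<T>) (Y_s \<Gamma> \<B>)"

definition K_hs ::
  "(real^2) set \<Rightarrow> (real^2) set set \<Rightarrow> (real^'m) set \<Rightarrow> (real^'m) set set \<Rightarrow>
   ((real^2) \<times> (real^'m) \<Rightarrow> real) \<Rightarrow> ((real^2) \<times> (real^'m) \<Rightarrow> real) set" where
  "K_hs D \<T> \<Gamma> \<B> g =
     {v \<in> W_hs D \<T> \<Gamma> \<B>.
        \<forall>x\<in>mesh_vertices \<T> \<inter> D. \<forall>y\<in>mesh_vertices \<B>. g (x, y) \<le> v (x, y)}"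

end

theory Submission
  imports Defs
begin

text \<open>
  The space \<open>W_hs\<close> is finite-dimensional, since its elements are determined by their values at the mesh
  vertices, and \<open>b_form\<close> is an inner product on it. The problem is therefore a projection onto a convex
  set that is closed, and that is nonempty because a large multiple of the piecewise linear function with
  value \<open>1\<close> at all interior vertices lies above the obstacle at the nodes.

  A function of \<open>X_h\<close>, extended by zero, is Lipschitz continuous. Shifting difference quotients from the test
  function to it shows that its weak gradient is the piecewise constant one, and the fundamental
  lemma of the calculus of variations shows that any other weak gradient agrees with it almost
  everywhere. If \<open>b_form\<close> vanishes at \<open>(v, v)\<close>, then for almost every \<open>y\<close> the function \<open>v (\<cdot>, y)\<close>
  has gradient zero, so it is constant on the connected set \<open>closure D\<close> and zero on the boundary;
  continuity in \<open>y\<close> gives \<open>v = 0\<close>.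
\<close>

section \<open>Variational inequalities in finite-dimensional function spaces\<close>

text \<open>Three difficulties shape the proof. First, \<open>weak_gradient\<close> is an arbitrary
  choice made separately for each parameter \<open>y\<close>, so its joint measurability is unknown;
  \<open>a\<close> and \<open>f\<close> are only Lebesgue measurable, so exceptional slices may be
  bad. Integrands are therefore compared with jointly Borel functions that agree with them for
  almost every \<open>x\<close> (\<open>bounded_version\<close>, \<open>borel_version\<close>); for
  gradients such a function is read off from the tensor expansion. Second, the piecewise linear
  function with value 1 at the interior vertices must vanish on the boundary, including boundary
  points inside an edge. This requires that a face with a boundary point in its relative interior
  has no vertex in \<open>D\<close>, which rests on \<open>interior (closure D) = D\<close>. Third,
  \<open>p\<close> has no positive lower bound, so definiteness is obtained pointwise from
  \<open>0 < p y\<close>, without a coercivity constant; in finite dimension this is enough. Since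
  \<open>p\<close> integrates to 1, \<Gamma> is not a null set and has interior points, so a
  continuous function that vanishes almost everywhere on \<Gamma> is zero.\<close>

definition function_subspace :: "('a \<Rightarrow> real) set \<Rightarrow> bool" where
  "function_subspace V \<longleftrightarrow>
     (\<lambda>_. 0) \<in> V \<and> (\<forall>u\<in>V. \<forall>v\<in>V. \<forall>s t. (\<lambda>z. s * u z + t * v z) \<in> V)"

lemma function_subspaceD:
  assumes "function_subspace V"
  shows "(\<lambda>_. 0) \<in> V" and "u \<in> V \<Longrightarrow> v \<in> V \<Longrightarrow> (\<lambda>z. s * u z + t * v z) \<in> V"
  using assms by (auto simp: function_subspace_def)

lemma function_subspace_sum:
  assumes "function_subspace V" and "\<And>i. i < n \<Longrightarrow> e i \<in> V"
  shows "(\<lambda>z. \<Sum>i<(n::nat). c i * e i z) \<in> V"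
  using assms(2)
proof (induction n)
  case 0
  then show ?case using function_subspaceD(1)[OF assms(1)] by simp
next
  case (Suc n)
  then show ?case
    using function_subspaceD(2)[OF assms(1), of "\<lambda>z. \<Sum>i<n. c i * e i z" "e n" 1 "c n"] by simp
qed

text \<open>The finite element space depends on the mesh, so it is a set of functions carrying an
  inner product \<open>b\<close> rather than a type. Linearity in the second argument follows from
  symmetry.\<close>

locale function_inner_space =
  fixes V :: "('a \<Rightarrow> real) set" and b :: "('a \<Rightarrow> real) \<Rightarrow> ('a \<Rightarrow> real) \<Rightarrow> real"
  assumes subspace: "function_subspace V"
    and symmetric: "u \<in> V \<Longrightarrow> v \<in> V \<Longrightarrow> b u v = b v u"
    and linear_left: "u \<in> V \<Longrightarrow> v \<in> V \<Longrightarrow> w \<in> V \<Longrightarrow>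
      b (\<lambda>z. s * u z + t * v z) w = s * b u w + t * b v w"
    and nonneg: "u \<in> V \<Longrightarrow> 0 \<le> b u u"
    and definite: "u \<in> V \<Longrightarrow> b u u = 0 \<Longrightarrow> u = (\<lambda>_. 0)"
begin

lemmas zero_mem = function_subspaceD(1)[OF subspace]
lemmas lincomb_mem = function_subspaceD(2)[OF subspace]

lemma zero_left: "w \<in> V \<Longrightarrow> b (\<lambda>_. 0) w = 0"
  using linear_left[OF zero_mem zero_mem, of w 0 0] by simp

lemma diff_mem: "u \<in> V \<Longrightarrow> v \<in> V \<Longrightarrow> (\<lambda>z. u z - v z) \<in> V"
  using lincomb_mem[of u v 1 "-1"] by simp

lemma scale_mem: "u \<in> V \<Longrightarrow> (\<lambda>z. s * u z) \<in> V"
  using lincomb_mem[of u u s 0] by simp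

lemma diff_left: "u \<in> V \<Longrightarrow> v \<in> V \<Longrightarrow> w \<in> V \<Longrightarrow> b (\<lambda>z. u z - v z) w = b u w - b v w"
  using linear_left[of u v w 1 "-1"] by simp

lemma scale_left: "u \<in> V \<Longrightarrow> w \<in> V \<Longrightarrow> b (\<lambda>z. s * u z) w = s * b u w"
  using linear_left[of u u w s 0] by simp

lemma scale_right: "u \<in> V \<Longrightarrow> w \<in> V \<Longrightarrow> b w (\<lambda>z. s * u z) = s * b w u"
  using scale_left[of u w s] scale_mem[of u s] symmetric by simp

lemma sum_left:
  assumes "\<And>i. i < n \<Longrightarrow> e i \<in> V" and w: "w \<in> V"
  shows "b (\<lambda>z. \<Sum>i<(n::nat). c i * e i z) w = (\<Sum>i<n. c i * b (e i) w)"
  using assms(1)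
proof (induction n)
  case 0
  then show ?case using zero_left[OF w] by simp
next
  case (Suc n)
  have "(\<lambda>z. \<Sum>i<n. c i * e i z) \<in> V"
    using Suc.prems by (intro function_subspace_sum[OF subspace]) auto
  with Suc show ?case
    using linear_left[of "\<lambda>z. \<Sum>i<n. c i * e i z" "e n" w 1 "c n"] w by simp
qed

definition orthonormal :: "nat \<Rightarrow> (nat \<Rightarrow> 'a \<Rightarrow> real) \<Rightarrow> bool" where
  "orthonormal n e \<longleftrightarrow>
     (\<forall>i<n. e i \<in> V) \<and> (\<forall>i<n. \<forall>j<n. b (e i) (e j) = (if i = j then 1 else 0))"

lemma orthonormal_inner_sum:
  assumes "orthonormal n e" and "j < n"
  shows "b (\<lambda>z. \<Sum>i<n. c i * e i z) (e j) = c j"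
proof -
  have "b (\<lambda>z. \<Sum>i<n. c i * e i z) (e j) = (\<Sum>i<n. c i * b (e i) (e j))"
    using assms by (intro sum_left) (auto simp: orthonormal_def)
  also have "\<dots> = (\<Sum>i<n. if i = j then c i else 0)"
    using assms by (intro sum.cong) (auto simp: orthonormal_def)
  finally show ?thesis using assms by simp
qed

text \<open>Gram--Schmidt, adding one evaluation point of \<open>Z\<close> at a time: the functions of \<open>U\<close> that
  vanish at \<open>z\<close> are determined by the remaining points.\<close>

lemma orthonormal_basis_exists:
  assumes "finite Z" and "U \<subseteq> V" and "function_subspace U"
    and "\<And>u. u \<in> U \<Longrightarrow> (\<And>z. z \<in> Z \<Longrightarrow> u z = 0) \<Longrightarrow> u = (\<lambda>_. 0)"
  shows "\<exists>n e. orthonormal n e \<and> (\<forall>i<n. e i \<in> U) \<and>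
    (\<forall>u\<in>U. u = (\<lambda>z. \<Sum>i<n. b u (e i) * e i z))"
  using assms
proof (induction Z arbitrary: U rule: finite_induct)
  case empty
  have "u = (\<lambda>_. 0)" if "u \<in> U" for u
    using empty.prems(3)[OF that] by simp
  then show ?case
    by (intro exI[of _ 0]) (auto simp: orthonormal_def)
next
  case (insert z Z)
  note U = insert.prems(1)
  define U' where "U' = {u\<in>U. u z = 0}"
  have subU': "function_subspace U'"
    using insert.prems(2) by (auto simp: function_subspace_def U'_def)
  have "U' \<subseteq> V" using U by (auto simp: U'_def)
  moreover have "u = (\<lambda>_. 0)" if "u \<in> U'" "\<And>z. z \<in> Z \<Longrightarrow> u z = 0" for u
    using insert.prems(3)[of u] that by (auto simp: U'_def)
  ultimately obtain n e where e: "orthonormal n e" "\<And>i. i < n \<Longrightarrow> e i \<in> U'"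
    and exp: "\<And>u. u \<in> U' \<Longrightarrow> u = (\<lambda>z. \<Sum>i<n. b u (e i) * e i z)"
    using insert.IH[OF _ subU'] by blast
  have eV: "e i \<in> V" if "i < n" for i using e(1) that by (auto simp: orthonormal_def)
  show ?case
  proof (cases "U' = U")
    case True
    then show ?thesis using e exp by blast
  next
    case False
    then obtain v where v: "v \<in> U" "v z \<noteq> 0" by (auto simp: U'_def)
    define P where "P = (\<lambda>z. \<Sum>i<n. b v (e i) * e i z)"
    have PU: "P \<in> U" unfolding P_def
      using e(2) by (intro function_subspace_sum[OF insert.prems(2)]) (auto simp: U'_def)
    define r where "r = (\<lambda>z. v z - P z)"
    have rU: "r \<in> U"
      using function_subspaceD(2)[OF insert.prems(2) v(1) PU, of 1 "-1"] by (simp add: r_def)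
    \<comment> \<open>\<open>P\<close> is a combination of functions that vanish at
      \<open>z\<close>, so subtracting it leaves the nonzero value of \<open>v\<close> at
      \<open>z\<close> unchanged. This keeps the residual \<open>r\<close> nonzero, and by
      definiteness it can be normalised.\<close>
    have "P z = 0" using e(2) by (auto simp: P_def U'_def)
    then have rz: "r z \<noteq> 0" using v by (simp add: r_def)
    have rV: "r \<in> V" using rU U by blast
    have "b r r \<noteq> 0" using definite[OF rV] rz by auto
    then have brr: "b r r > 0" using nonneg[OF rV] by simp
    define q where "q = (\<lambda>z. (1 / sqrt (b r r)) * r z)"
    have qU: "q \<in> U"
      using function_subspaceD(2)[OF insert.prems(2) rU rU, of "1 / sqrt (b r r)" 0]
      by (simp add: q_def)
    then have qV: "q \<in> V" using U by blast
    have qz: "q z \<noteq> 0" using rz brr by (simp add: q_def)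
    have "b q q = 1"
      using scale_left[OF rV qV, of "1 / sqrt (b r r)"] scale_right[OF rV rV, of "1 / sqrt (b r r)"] brr
      by (simp add: q_def)
    have "b r (e j) = 0" if "j < n" for j
      using diff_left[of v P "e j"] orthonormal_inner_sum[OF e(1) that, of "\<lambda>i. b v (e i)"]
        v U PU eV[OF that]
      by (auto simp: r_def P_def)
    then have qe: "b q (e j) = 0" if "j < n" for j
      using scale_left[OF rV eV[OF that], of "1 / sqrt (b r r)"] that by (simp add: q_def)
    define e' where "e' = e(n := q)"
    have "orthonormal (Suc n) e'"
      using e(1) qV qe \<open>b q q = 1\<close> symmetric[OF qV eV]
      by (auto simp: orthonormal_def e'_def less_Suc_eq)
    moreover have "\<forall>i<Suc n. e' i \<in> U"
      using e(2) qU by (auto simp: e'_def less_Suc_eq U'_def)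
    moreover have "u = (\<lambda>z. \<Sum>i<Suc n. b u (e' i) * e' i z)" if u: "u \<in> U" for u
    proof -
      \<comment> \<open>Subtracting \<alpha> times \<open>q\<close> cancels the value at
        \<open>z\<close> and lands in \<open>U'\<close>, where the induction hypothesis gives the
        expansion. That \<alpha> is the coefficient \<open>b u q\<close> comes out afterwards, from
        orthogonality of \<open>w\<close> and \<open>q\<close>.\<close>
      define \<alpha> where "\<alpha> = u z / q z"
      define w where "w = (\<lambda>z. 1 * u z + (-\<alpha>) * q z)"
      have uV: "u \<in> V" using u U by blast
      have wU: "w \<in> U'"
        using function_subspaceD(2)[OF insert.prems(2) u qU, of 1 "-\<alpha>"] qz
        by (simp add: U'_def w_def \<alpha>_def)
      have bw: "b w (e i) = b u (e i)" if "i < n" for i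
        using linear_left[OF uV qV eV[OF that], of 1 "-\<alpha>"] qe[OF that] by (simp add: w_def)
      have w: "w y = (\<Sum>i<n. b u (e i) * e i y)" for y
        using fun_cong[OF exp[OF wU], of y] bw by simp
      have "b w q = 0"
      proof -
        have "b w q = b (\<lambda>y. \<Sum>i<n. b u (e i) * e i y) q" using w by (auto intro: arg_cong2[of _ _ _ _ b])
        also have "\<dots> = (\<Sum>i<n. b u (e i) * b (e i) q)" using eV qV by (intro sum_left) auto
        finally show ?thesis using qe symmetric[OF qV eV] by simp
      qed
      then have "b u q = \<alpha>"
        using linear_left[OF uV qV qV, of 1 "-\<alpha>"] \<open>b q q = 1\<close> by (simp add: w_def)
      then show ?thesis
        using w by (auto simp: e'_def w_def fun_eq_iff algebra_simps)
    qed
    ultimately show ?thesis by blast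
  qed
qed

text \<open>In coordinates with respect to an orthonormal basis the solution is the projection of the
  representer of \<open>l\<close> onto \<open>K\<close>; minimizing sequences are Cauchy by the parallelogram law.\<close>

theorem variational_inequality_unique_solution:
  assumes Z: "finite Z" "\<And>u. u \<in> V \<Longrightarrow> (\<And>z. z \<in> Z \<Longrightarrow> u z = 0) \<Longrightarrow> u = (\<lambda>_. 0)"
    and l: "\<And>u v s t. u \<in> V \<Longrightarrow> v \<in> V \<Longrightarrow> l (\<lambda>z. s * u z + t * v z) = s * l u + t * l v"
    and K: "K \<subseteq> V" "K \<noteq> {}"
    and convex: "\<And>u v t. u \<in> K \<Longrightarrow> v \<in> K \<Longrightarrow> 0 \<le> t \<Longrightarrow> t \<le> 1 \<Longrightarrow>
      (\<lambda>z. (1 - t) * u z + t * v z) \<in> K"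
    and closed: "\<And>v u. (\<And>k. v k \<in> K) \<Longrightarrow> u \<in> V \<Longrightarrow> (\<And>z. (\<lambda>k::nat. v k z) \<longlonglongrightarrow> u z) \<Longrightarrow> u \<in> K"
  shows "\<exists>!u. u \<in> K \<and> (\<forall>v\<in>K. l (\<lambda>z. v z - u z) \<le> b u (\<lambda>z. v z - u z))"
proof -
  obtain n e where e: "orthonormal n e"
    and exp: "\<And>u. u \<in> V \<Longrightarrow> u = (\<lambda>z. \<Sum>i<n. b u (e i) * e i z)"
    using orthonormal_basis_exists[OF Z(1) order.refl subspace Z(2)] by blast
  have eV: "e i \<in> V" if "i < n" for i using e that by (auto simp: orthonormal_def)
  have KV: "u \<in> V" if "u \<in> K" for u using that K by blast
  define c where "c = (\<lambda>u i. b u (e i))"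
  define L where "L = (\<lambda>i. l (e i))"
  \<comment> \<open>Up to the constant sum of the squares of \<open>L i\<close>, this is the energy
    \<open>b u u - 2 * l u\<close>; minimising it over \<open>K\<close> means finding the point
    nearest to the representer of \<open>l\<close>.\<close>
  define Q where "Q = (\<lambda>u. \<Sum>i<n. (c u i - L i)\<^sup>2)"
  have c_lin: "c (\<lambda>z. s * u z + t * v z) i = s * c u i + t * c v i"
    if "u \<in> V" "v \<in> V" "i < n" for u v s t i
    using linear_left[OF that(1,2) eV[OF that(3)]] by (simp add: c_def)
  have c_diff: "c (\<lambda>z. u z - v z) i = c u i - c v i" if "u \<in> V" "v \<in> V" "i < n" for u v i
    using c_lin[OF that, of 1 "-1"] by simp
  have b_eq: "b u v = (\<Sum>i<n. c u i * c v i)" if "u \<in> V" "v \<in> V" for u v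
  proof -
    have "b u v = b (\<lambda>z. \<Sum>i<n. c u i * e i z) v"
      using exp[OF that(1)] by (simp add: c_def)
    also have "\<dots> = (\<Sum>i<n. c u i * b (e i) v)" using eV that by (intro sum_left) auto
    also have "\<dots> = (\<Sum>i<n. c u i * c v i)"
      using symmetric[OF that(2) eV] by (simp add: c_def)
    finally show ?thesis .
  qed
  have l_eq: "l v = (\<Sum>i<n. L i * c v i)" if "v \<in> V" for v
  proof -
    have "l (\<lambda>z. \<Sum>i<m. a i * e i z) = (\<Sum>i<m. a i * l (e i))" if "m \<le> n" for m a
      using that
    proof (induction m)
      case 0
      then show ?case using l[OF zero_mem zero_mem, of 0 0] by simp
    next
      case (Suc m)
      have "(\<lambda>z. \<Sum>i<m. a i * e i z) \<in> V"
        using Suc.prems eV by (intro function_subspace_sum[OF subspace]) auto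
      then show ?case
        using Suc l[of "\<lambda>z. \<Sum>i<m. a i * e i z" "e m" 1 "a m"] eV by simp
    qed
    from this[of n "c v"] show ?thesis
      using exp[OF that] by (simp add: c_def L_def mult.commute)
  qed
  define d where "d = (INF u\<in>K. Q u)"
  have Q_nonneg: "Q u \<ge> 0" for u by (simp add: Q_def sum_nonneg)
  have bdd: "bdd_below (Q ` K)" using Q_nonneg by (auto intro: bdd_belowI[of _ 0])
  have d_le: "d \<le> Q u" if "u \<in> K" for u
    unfolding d_def using that bdd by (rule cINF_lower[rotated])
  have "\<exists>u\<in>K. Q u < d + 1 / real (Suc k)" for k
    using K(2) bdd cINF_less_iff[of K Q "d + 1 / real (Suc k)"] by (simp add: d_def)
  then obtain v where vK: "\<And>k. v k \<in> K" and v: "\<And>k. Q (v k) < d + 1 / real (Suc k)"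
    by metis
  have dist: "(\<Sum>i<n. (c (v k) i - c (v m) i)\<^sup>2) \<le> 2 / real (Suc k) + 2 / real (Suc m)" for k m
  proof -
    define w where "w = (\<lambda>z. (1 - 1 / 2) * v k z + 1 / 2 * v m z)"
    have "w \<in> K" unfolding w_def using vK by (intro convex) auto
    then have "d \<le> Q w" by (rule d_le)
    have cw: "c w i = (c (v k) i + c (v m) i) / 2" if "i < n" for i
      using c_lin[OF KV[OF vK] KV[OF vK] that, of "1 - 1 / 2" k "1/2" m] by (simp add: w_def field_simps)
    \<comment> \<open>Parallelogram identity for the midpoint \<open>w\<close>. Convexity puts
      \<open>w\<close> into \<open>K\<close>, so \<open>Q w\<close> is at least \<open>d\<close>,
      and the terms in \<open>d\<close> cancel.\<close>
    have "(\<Sum>i<n. (c (v k) i - c (v m) i)\<^sup>2) = 2 * Q (v k) + 2 * Q (v m) - 4 * Q w"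
      unfolding Q_def sum_distrib_left sum_subtractf[symmetric] sum.distrib[symmetric]
      by (intro sum.cong) (auto simp: cw power2_eq_square field_simps)
    then show ?thesis using v[of k] v[of m] \<open>d \<le> Q w\<close> by simp
  qed
  have "Cauchy (\<lambda>k. c (v k) i)" if "i < n" for i
  proof (rule CauchyI)
    fix \<epsilon> :: real assume \<epsilon>: "\<epsilon> > 0"
    \<comment> \<open>Beyond \<open>N\<close> the two bounds of the distance estimate are at most
      \<open>2 / N\<close> each, whence the constant 4.\<close>
    obtain N where N: "4 / \<epsilon>\<^sup>2 < real N" using reals_Archimedean2 by blast
    have "norm (c (v k) i - c (v m) i) < \<epsilon>" if "k \<ge> N" "m \<ge> N" for k m
    proof -
      have N0: "real N > 0" using N \<epsilon> by (smt (verit) divide_pos_pos zero_less_power)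
      have "(c (v k) i - c (v m) i)\<^sup>2 \<le> (\<Sum>i<n. (c (v k) i - c (v m) i)\<^sup>2)"
        using \<open>i < n\<close> by (intro member_le_sum) auto
      also have "\<dots> \<le> 2 / real (Suc k) + 2 / real (Suc m)" by (rule dist)
      also have "\<dots> \<le> 2 / real N + 2 / real N"
        using that N0 by (intro add_mono divide_left_mono) auto
      also have "\<dots> < \<epsilon>\<^sup>2" using N \<epsilon> N0 by (simp add: field_simps)
      finally have "\<bar>c (v k) i - c (v m) i\<bar>\<^sup>2 < \<epsilon>\<^sup>2" by simp
      then show ?thesis using \<epsilon> power2_less_imp_less[of "\<bar>c (v k) i - c (v m) i\<bar>" \<epsilon>] by simp
    qed
    then show "\<exists>M. \<forall>m\<ge>M. \<forall>k\<ge>M. norm (c (v m) i - c (v k) i) < \<epsilon>" by blast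
  qed
  then have "\<forall>i. \<exists>x. i < n \<longrightarrow> (\<lambda>k. c (v k) i) \<longlonglongrightarrow> x"
    by (metis Cauchy_convergent convergent_def)
  then obtain x where x: "\<And>i. i < n \<Longrightarrow> (\<lambda>k. c (v k) i) \<longlonglongrightarrow> x i" by metis
  define u where "u = (\<lambda>z. \<Sum>i<n. x i * e i z)"
  have uV: "u \<in> V" unfolding u_def using eV by (intro function_subspace_sum[OF subspace])
  have cu: "c u i = x i" if "i < n" for i
    using orthonormal_inner_sum[OF e that, of x] by (simp add: c_def u_def)
  \<comment> \<open>Only finitely many coordinates occur, so their convergence gives pointwise
    convergence, the notion of limit for which \<open>K\<close> is assumed closed.\<close>
  have "(\<lambda>k. v k z) \<longlonglongrightarrow> u z" for z
  proof -
    have "(\<lambda>k. \<Sum>i<n. c (v k) i * e i z) \<longlonglongrightarrow> u z"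
      unfolding u_def by (intro tendsto_intros x) auto
    then show ?thesis using exp[OF KV[OF vK]] by (simp add: c_def fun_eq_iff)
  qed
  then have uK: "u \<in> K" by (rule closed[of v u, OF vK uV])
  have "(\<lambda>k. Q (v k)) \<longlonglongrightarrow> Q u"
    unfolding Q_def by (intro tendsto_intros) (use x cu in auto)
  moreover have "(\<lambda>k. d + 1 / real (Suc k)) \<longlonglongrightarrow> d + 0"
    by (intro tendsto_intros LIMSEQ_Suc[OF lim_1_over_n])
  ultimately have "Q u \<le> d"
    using v by (intro LIMSEQ_le[of "\<lambda>k. Q (v k)" "Q u" "\<lambda>k. d + 1 / real (Suc k)"]) (auto intro: less_imp_le)
  then have min: "Q u \<le> Q w" if "w \<in> K" for w using d_le[OF that] by simp
  have "l (\<lambda>z. w z - u z) \<le> b u (\<lambda>z. w z - u z)" if wK: "w \<in> K" for w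
  proof -
    have wV: "w \<in> V" using wK KV by blast
    define A where "A = (\<Sum>i<n. (c u i - L i) * (c w i - c u i))"
    define B where "B = (\<Sum>i<n. (c w i - c u i)\<^sup>2)"
    \<comment> \<open>First variation: moving from \<open>u\<close> towards \<open>w\<close> by the
      fraction \<open>t\<close> cannot decrease \<open>Q\<close>. After division by
      \<open>t\<close>, letting \<open>t\<close> tend to 0 leaves \<open>0 \<le> A\<close>, which is
      the variational inequality.\<close>
    have quad: "0 \<le> 2 * A + t * B" if t: "0 < t" "t \<le> 1" for t
    proof -
      define m where "m = (\<lambda>z. (1 - t) * u z + t * w z)"
      have cm: "c m i = (1 - t) * c u i + t * c w i" if "i < n" for i
        unfolding m_def by (rule c_lin[OF uV wV that])
      have "m \<in> K" unfolding m_def using t by (intro convex uK wK) auto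
      then have "Q u \<le> Q m" by (rule min)
      also have "\<dots> = Q u + t * (2 * A + t * B)"
        unfolding Q_def A_def B_def sum_distrib_left sum.distrib[symmetric]
        by (intro sum.cong) (auto simp: cm power2_eq_square algebra_simps)
      finally show ?thesis using t by (simp add: zero_le_mult_iff)
    qed
    have "0 \<le> A"
    proof -
      have "(\<lambda>k. 2 * A + 1 / real (Suc k) * B) \<longlonglongrightarrow> 2 * A + 0 * B"
        by (intro tendsto_intros LIMSEQ_Suc[OF lim_1_over_n])
      moreover have "0 \<le> 2 * A + 1 / real (Suc k) * B" for k by (rule quad) auto
      ultimately have "0 \<le> 2 * A + 0 * B" by (blast intro: LIMSEQ_le_const)
      then show ?thesis by simp
    qed
    moreover have "b u (\<lambda>z. w z - u z) - l (\<lambda>z. w z - u z) = A"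
      unfolding b_eq[OF uV diff_mem[OF wV uV]] l_eq[OF diff_mem[OF wV uV]] A_def
        sum_subtractf[symmetric]
      by (intro sum.cong) (auto simp: c_diff[OF wV uV] algebra_simps)
    ultimately show ?thesis by simp
  qed
  moreover have "u1 = u2"
    if 1: "u1 \<in> K" "\<forall>v\<in>K. l (\<lambda>z. v z - u1 z) \<le> b u1 (\<lambda>z. v z - u1 z)"
      and 2: "u2 \<in> K" "\<forall>v\<in>K. l (\<lambda>z. v z - u2 z) \<le> b u2 (\<lambda>z. v z - u2 z)" for u1 u2
  proof -
    have V: "u1 \<in> V" "u2 \<in> V" using 1 2 KV by auto
    \<comment> \<open>Each solution is tested with the other one; adding the two inequalities
      cancels \<open>l\<close> and leaves \<open>b w w \<le> 0\<close>.\<close>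
    define w where "w = (\<lambda>z. u1 z - u2 z)"
    define w' where "w' = (\<lambda>z. u2 z - u1 z)"
    have w: "w \<in> V" using diff_mem[OF V] by (simp add: w_def)
    have w'_eq: "w' = (\<lambda>z. (-1) * w z)" by (auto simp: w'_def w_def)
    have "l w' = - l w"
      using l[OF w w, of "-1" 0] by (simp add: w'_eq)
    moreover have "b u1 w' = - b u1 w"
      using scale_right[OF w V(1), of "-1"] by (simp add: w'_eq)
    moreover have "l w' \<le> b u1 w'" "l w \<le> b u2 w"
      using 1 2 by (auto simp: w_def w'_def)
    moreover have "b w w = b u1 w - b u2 w"
      using diff_left[OF V w] by (simp add: w_def)
    ultimately have "b w w \<le> 0" by linarith
    then have "w = (\<lambda>_. 0)" using nonneg[OF w] definite[OF w] by simp
    then show ?thesis by (auto simp: w_def fun_eq_iff)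
  qed
  ultimately show ?thesis using uK by blast
qed

end

section \<open>Smooth bumps and uniqueness of weak gradients\<close>

text \<open>The classical flat function \<open>exp (- 1 / t)\<close>, divided by a power of
  \<open>t\<close>. The index \<open>n\<close> is there because differentiation only produces
  further negative powers of \<open>t\<close>, so the span of the family is closed under it.\<close>

definition bump :: "nat \<Rightarrow> real \<Rightarrow> real" where
  "bump n t = (if 0 < t then exp (- 1 / t) / t ^ n else 0)"

text \<open>With \<open>s = 1 / t\<close> this is the decay of \<open>s ^ n / exp s\<close> at
  infinity.\<close>

lemma bump_tendsto_0: "(bump n \<longlongrightarrow> 0) (at 0)"
proof -
  have "((\<lambda>s. s ^ n / exp s) \<longlongrightarrow> (0::real)) at_top"
    by (rule tendsto_power_div_exp_0)
  then have "((\<lambda>t. inverse t ^ n / exp (inverse t)) \<longlongrightarrow> (0::real)) (at_right 0)"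
    using filterlim_compose[OF _ filterlim_inverse_at_top_right] by blast
  then have "(bump n \<longlongrightarrow> 0) (at_right 0)"
  proof (rule Lim_transform_eventually)
    show "\<forall>\<^sub>F t in at_right 0. inverse t ^ n / exp (inverse t) = bump n t"
      using eventually_at_right_less[of "0::real"]
      by eventually_elim (auto simp: bump_def exp_minus field_simps)
  qed
  moreover have "(bump n \<longlongrightarrow> 0) (at_left 0)"
    by (rule tendsto_eventually) (auto simp: bump_def eventually_at_filter)
  ultimately show ?thesis by (simp add: filterlim_split_at)
qed

lemma bump_has_real_derivative:
  "(bump n has_real_derivative bump (n + 2) t - real n * bump (n + 1) t) (at t)"
proof -
  consider "t < 0" | "t = 0" | "0 < t" by linarith
  then show ?thesis
  proof cases
    case 1
    have "((\<lambda>_. 0) has_real_derivative 0) (at t)" by simp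
    then show ?thesis
      by (rule has_field_derivative_transform_within_open[where S = "{..<0}", THEN DERIV_cong])
        (use 1 in \<open>auto simp: bump_def\<close>)
  next
    case 2
    \<comment> \<open>The difference quotient at 0 is \<open>bump (Suc n) h\<close>, so
      differentiability there is the limit statement for the next index.\<close>
    have "((\<lambda>h. (bump n (0 + h) - bump n 0) / h) \<longlongrightarrow> 0) (at 0)"
      using bump_tendsto_0[of "Suc n"]
      by (rule Lim_transform_eventually) (auto simp: bump_def eventually_at_filter)
    then show ?thesis using 2 by (simp add: DERIV_def bump_def)
  next
    case 3
    have "((\<lambda>t. exp (- 1 / t) / t ^ n) has_real_derivative bump (n + 2) t - real n * bump (n + 1) t) (at t)"
      using 3
      by (cases n) ((auto intro!: derivative_eq_intros simp: bump_def field_simps power2_eq_square), metis One_nat_def power_eq_if)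
    then show ?thesis
      by (rule has_field_derivative_transform_within_open[where S = "{0<..}"])
        (use 3 in \<open>auto simp: bump_def\<close>)
  qed
qed

lemma bump_0_bounds: "0 \<le> bump 0 t" "bump 0 t \<le> 1"
  by (auto simp: bump_def)

lemma bump_0_scaled_tendsto: "(\<lambda>k. bump 0 (real k * t)) \<longlonglongrightarrow> (if 0 < t then 1 else 0)"
proof (cases "0 < t")
  case True
  have "(\<lambda>k. exp (- ((1 / t) * (1 / real k)))) \<longlonglongrightarrow> exp (- ((1 / t) * 0))"
    by (intro tendsto_intros lim_1_over_n)
  moreover have "\<forall>\<^sub>F k in sequentially. exp (- ((1 / t) * (1 / real k))) = bump 0 (real k * t)"
    using eventually_gt_at_top[of 0]
    by eventually_elim (use True in \<open>auto simp: bump_def field_simps\<close>)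
  ultimately show ?thesis using True by (auto intro: Lim_transform_eventually)
next
  case False
  then have "bump 0 (real k * t) = 0" for k
    by (auto simp: bump_def zero_less_mult_iff)
  then show ?thesis using False by simp
qed

text \<open>This algebra is closed under directional derivatives, so its members are smooth.\<close>

inductive_set bump_algebra :: "('a::euclidean_space \<Rightarrow> real) set" where
  const: "(\<lambda>_. c) \<in> bump_algebra"
| atom: "(\<lambda>x. bump n (c \<bullet> x + d)) \<in> bump_algebra"
| add: "f \<in> bump_algebra \<Longrightarrow> g \<in> bump_algebra \<Longrightarrow> (\<lambda>x. f x + g x) \<in> bump_algebra"
| mult: "f \<in> bump_algebra \<Longrightarrow> g \<in> bump_algebra \<Longrightarrow> (\<lambda>x. f x * g x) \<in> bump_algebra"

text \<open>Chain rule for the atoms, sum and product rule for the rest. Membership of the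
  directional derivatives is part of the claim so that \<open>C_diff\<close> can be
  iterated.\<close>

lemma bump_algebra_derivative:
  assumes "f \<in> bump_algebra"
  shows "\<exists>f'. (\<forall>x. (f has_derivative f' x) (at x)) \<and> (\<forall>v. (\<lambda>x. f' x v) \<in> bump_algebra)"
  using assms
proof induction
  case (const c)
  then show ?case
    by (intro exI[of _ "\<lambda>_ _. 0"]) (auto intro: bump_algebra.const)
next
  case (atom n c d)
  have "((\<lambda>x. bump n (c \<bullet> x + d)) has_derivative
      (\<lambda>v. (bump (n + 2) (c \<bullet> x + d) - real n * bump (n + 1) (c \<bullet> x + d)) * (c \<bullet> v))) (at x)" for x
  proof -
    have "((\<lambda>x. c \<bullet> x + d) has_derivative (\<lambda>v. c \<bullet> v)) (at x)"
      by (auto intro!: derivative_eq_intros)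
    from has_derivative_compose[OF this bump_has_real_derivative[unfolded has_field_derivative_def]]
    show ?thesis by simp
  qed
  moreover have "(\<lambda>x. (bump (n + 2) (c \<bullet> x + d) - real n * bump (n + 1) (c \<bullet> x + d)) * (c \<bullet> v))
      \<in> bump_algebra" for v
    using bump_algebra.mult[OF bump_algebra.add[OF bump_algebra.atom[of "n + 2" c d]
      bump_algebra.mult[OF bump_algebra.const[of "- real n"] bump_algebra.atom[of "n + 1" c d]]]
      bump_algebra.const[of "c \<bullet> v"]]
    by simp
  ultimately show ?case
    by (intro exI[of _ "\<lambda>x v. (bump (n + 2) (c \<bullet> x + d) - real n * bump (n + 1) (c \<bullet> x + d)) * (c \<bullet> v)"]
        conjI allI)
next
  case (add f g)
  then obtain f' g' where "\<forall>x. (f has_derivative f' x) (at x)" "\<forall>v. (\<lambda>x. f' x v) \<in> bump_algebra"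
    "\<forall>x. (g has_derivative g' x) (at x)" "\<forall>v. (\<lambda>x. g' x v) \<in> bump_algebra" by blast
  then show ?case
    by (intro exI[of _ "\<lambda>x v. f' x v + g' x v"])
      (auto intro: bump_algebra.add has_derivative_add)
next
  case (mult f g)
  then obtain f' g' where "\<forall>x. (f has_derivative f' x) (at x)" "\<forall>v. (\<lambda>x. f' x v) \<in> bump_algebra"
    "\<forall>x. (g has_derivative g' x) (at x)" "\<forall>v. (\<lambda>x. g' x v) \<in> bump_algebra" by blast
  then show ?case using mult.hyps
    by (intro exI[of _ "\<lambda>x v. f x * g' x v + f' x v * g x"])
      (auto intro!: bump_algebra.add bump_algebra.mult has_derivative_mult)
qed

lemma bump_algebra_C_diff: "f \<in> bump_algebra \<Longrightarrow> C_diff n f"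
proof (induction n arbitrary: f)
  case 0
  then have "isCont f x" for x
    using bump_algebra_derivative[OF 0] has_derivative_continuous by blast
  then show ?case by (simp add: continuous_at_imp_continuous_on)
next
  case (Suc n)
  obtain f' where f': "\<And>x. (f has_derivative f' x) (at x)" "\<And>v. (\<lambda>x. f' x v) \<in> bump_algebra"
    using bump_algebra_derivative[OF Suc.prems] by blast
  have "frechet_derivative f (at x) = f' x" for x
    using frechet_derivative_at[OF f'(1)] by simp
  then show ?case
    using f' Suc.IH by (auto simp: differentiable_def)
qed

text \<open>Since \<open>bump 0 (k t) = exp (- 1 / (k t))\<close> tends to \<open>1\<close> for \<open>t > 0\<close>, these test functions converge to
  the indicator function of the box.\<close>

definition box_bump :: "'a::euclidean_space \<Rightarrow> 'a \<Rightarrow> nat \<Rightarrow> 'a \<Rightarrow> real" where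
  "box_bump l u k x =
     (\<Prod>b\<in>Basis. bump 0 (real k * (x \<bullet> b - l \<bullet> b)) * bump 0 (real k * (u \<bullet> b - x \<bullet> b)))"

lemma box_bump_bounds: "0 \<le> box_bump l u k x" "box_bump l u k x \<le> 1"
  unfolding box_bump_def
  by (intro prod_nonneg prod_le_1 ballI mult_nonneg_nonneg mult_le_one bump_0_bounds conjI)+

lemma box_bump_eq_0: "x \<notin> box l u \<Longrightarrow> box_bump l u k x = 0"
  unfolding box_bump_def
  by (force simp: mem_box bump_def zero_less_mult_iff intro!: prod_zero)

lemma box_bump_in_bump_algebra: "box_bump l u k \<in> bump_algebra"
proof -
  have "(\<lambda>x. \<Prod>b\<in>B. bump 0 (real k * (x \<bullet> b - l \<bullet> b)) * bump 0 (real k * (u \<bullet> b - x \<bullet> b)))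
      \<in> bump_algebra" if "finite B" for B :: "'a set"
    using that
  proof induction
    case empty
    then show ?case by (simp add: bump_algebra.const)
  next
    case (insert b B)
    have "(\<lambda>x. bump 0 (real k * (x \<bullet> b - l \<bullet> b))) \<in> bump_algebra"
      using bump_algebra.atom[of 0 "real k *\<^sub>R b" "- (real k * (l \<bullet> b))"]
      by (simp add: right_diff_distrib inner_commute)
    moreover have "(\<lambda>x. bump 0 (real k * (u \<bullet> b - x \<bullet> b))) \<in> bump_algebra"
      using bump_algebra.atom[of 0 "- (real k *\<^sub>R b)" "real k * (u \<bullet> b)"]
      by (simp add: right_diff_distrib inner_commute)
    ultimately have "(\<lambda>x. bump 0 (real k * (x \<bullet> b - l \<bullet> b)) * bump 0 (real k * (u \<bullet> b - x \<bullet> b)))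
        \<in> bump_algebra"
      by (rule bump_algebra.mult)
    from bump_algebra.mult[OF this insert.IH] insert.hyps show ?case by simp
  qed
  from this[OF finite_Basis] show ?thesis by (simp add: box_bump_def[abs_def])
qed

text \<open>The compact set required of a test function is \<open>cbox l u\<close>, which is why the
  closed box has to lie in \<open>D\<close>.\<close>

lemma box_bump_test_function:
  assumes "cbox l u \<subseteq> D"
  shows "box_bump l u k \<in> test_functions D"
  using assms box_bump_eq_0 box_subset_cbox bump_algebra_C_diff[OF box_bump_in_bump_algebra]
  unfolding test_functions_def by (blast intro: compact_cbox)

lemma box_bump_tendsto: "(\<lambda>k. box_bump l u k x) \<longlonglongrightarrow> indicator (box l u) x"
proof -
  have "(\<lambda>k. box_bump l u k x) \<longlonglongrightarrow>
      (\<Prod>b\<in>Basis. (if 0 < x \<bullet> b - l \<bullet> b then 1 else 0) * (if 0 < u \<bullet> b - x \<bullet> b then 1 else 0))"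
    unfolding box_bump_def by (intro tendsto_prod tendsto_mult bump_0_scaled_tendsto)
  also have "(\<Prod>b\<in>Basis. (if 0 < x \<bullet> b - l \<bullet> b then 1 else 0) * (if 0 < u \<bullet> b - x \<bullet> b then 1 else 0))
      = (indicator (box l u) x :: real)"
    by (force simp: indicator_def mem_box intro!: prod.neutral prod_zero)
  finally show ?thesis .
qed

section \<open>The fundamental lemma of the calculus of variations\<close>

text \<open>Open boxes are stable under intersection and generate the Borel sets, so the vanishing
  of integrals spreads to all Borel sets by Dynkin's argument; a density is determined by such
  integrals. The integral over the whole space is a separate hypothesis for the complement step, as
  the whole space is not a bounded box.\<close>

lemma AE_zero_of_box_integrals_zero:
  fixes g :: "'a::euclidean_space \<Rightarrow> real"
  assumes g: "integrable lborel g" and g0: "(LINT x|lborel. g x) = 0"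
    and box: "\<And>l u. (LINT x:box l u|lborel. g x) = 0"
  shows "AE x in lborel. g x = 0"
proof (rule density_unique_real[OF g integrable_zero])
  fix A :: "'a set" assume "A \<in> sets lborel"
  then have A: "A \<in> sigma_sets UNIV (range (\<lambda>(a, b). box a b))"
    by (simp add: borel_eq_box)
  have meas: "B \<in> sets lborel" if "B \<in> sigma_sets UNIV (range (\<lambda>(a, b). box a b))" for B :: "'a set"
    using that by (simp add: borel_eq_box)
  have int: "set_integrable lborel B g" if "B \<in> sets lborel" for B
    using g that unfolding set_integrable_def by (rule integrable_mult_indicator[rotated])
  have "Int_stable (range (\<lambda>(a, b). box a b :: 'a set))"
    by (auto simp: Int_stable_def box_Int_box)
  moreover have "range (\<lambda>(a, b). box a b :: 'a set) \<subseteq> Pow UNIV" by simp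
  ultimately have "(LINT x:A|lborel. g x) = 0"
    using A
  proof (induction rule: sigma_sets_induct_disjoint)
    case (basic B)
    then show ?case using box by auto
  next
    case empty
    then show ?case by (simp add: set_lebesgue_integral_def)
  next
    case (compl B)
    have "(LINT x:UNIV - B|lborel. g x) = (LINT x|lborel. g x - indicator B x *\<^sub>R g x)"
      unfolding set_lebesgue_integral_def
      by (intro Bochner_Integration.integral_cong) (auto simp: indicator_def)
    also have "\<dots> = (LINT x|lborel. g x) - (LINT x:B|lborel. g x)"
      unfolding set_lebesgue_integral_def
      using g int[OF meas[OF compl.hyps]]
      by (intro Bochner_Integration.integral_diff) (auto simp: set_integrable_def)
    finally show ?case using g0 compl by simp
  next
    case (union B)
    have B: "B i \<in> sets lborel" for i using union.hyps meas by blast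
    have "(LINT x:(\<Union>i. B i)|lborel. g x) = (\<Sum>i. LINT x:B i|lborel. g x)"
      using union.hyps(1) B
      by (intro lebesgue_integral_countable_add int sets.countable_UN)
        (auto simp: disjoint_family_on_def)
    with union show ?case by simp
  qed
  then show "(LINT x:A|lborel. g x) = (LINT x:A|lborel. 0)"
    by (simp add: set_lebesgue_integral_def)
qed

text \<open>Test functions converging to the indicator of a box turn the hypothesis into vanishing
  box integrals. This works for closed boxes inside \<open>D\<close> only, so the conclusion is
  first obtained box by box and then on a countable cover.\<close>

lemma locally_integrable_zero_of_tests:
  fixes w :: "'a::euclidean_space \<Rightarrow> real"
  assumes D: "open D" and w: "locally_integrable D w"
    and tests: "\<And>\<eta>. \<eta> \<in> test_functions D \<Longrightarrow> (LINT x|lebesgue_on D. w x * \<eta> x) = 0"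
  shows "AE x in lebesgue_on D. w x = 0"
proof -
  have Dm: "D \<in> sets lebesgue" using D by simp
  have int: "integrable lebesgue (\<lambda>x. indicator (cbox l u) x * w x)" if "cbox l u \<subseteq> D" for l u
    using w that integrable_restrict_space[of "cbox l u" lebesgue w]
    unfolding locally_integrable_def by auto
  have zero: "(LINT x|lebesgue. indicator (box l u) x * w x) = 0" if lu: "cbox l u \<subseteq> D" for l u
  proof -
    \<comment> \<open>The extra indicator of the closed box changes no value of the integrand but
      supplies the majorant, \<open>w\<close> being integrable only on compact sets.\<close>
    have "(\<lambda>k. LINT x|lebesgue. indicator (cbox l u) x * w x * box_bump l u k x) \<longlonglongrightarrow>
        (LINT x|lebesgue. indicator (cbox l u) x * w x * indicator (box l u) x)"
    proof (rule integral_dominated_convergence)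
      show "integrable lebesgue (\<lambda>x. norm (indicator (cbox l u) x * w x))"
        using int[OF lu] by (rule integrable_norm)
      show "(\<lambda>x. indicator (cbox l u) x * w x * indicator (box l u) x) \<in> borel_measurable lebesgue"
        by (intro borel_measurable_times[OF borel_measurable_integrable[OF int[OF lu]]]
            borel_measurable_indicator) auto
      show "(\<lambda>x. indicator (cbox l u) x * w x * box_bump l u k x) \<in> borel_measurable lebesgue" for k
      proof -
        have "continuous_on UNIV (box_bump l u k)"
          using bump_algebra_C_diff[OF box_bump_in_bump_algebra, of 0] by simp
        then have "box_bump l u k \<in> borel_measurable lebesgue"
          by (intro measurable_completion) (simp add: borel_measurable_continuous_onI)
        then show ?thesis using borel_measurable_integrable[OF int[OF lu]] by measurable
      qed
      show "AE x in lebesgue. (\<lambda>k. indicator (cbox l u) x * w x * box_bump l u k x) \<longlonglongrightarrow>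
          indicator (cbox l u) x * w x * indicator (box l u) x"
        by (intro AE_I2 tendsto_intros box_bump_tendsto)
      show "AE x in lebesgue. norm (indicator (cbox l u) x * w x * box_bump l u k x) \<le>
          norm (indicator (cbox l u) x * w x)" for k
        using box_bump_bounds[of l u k] by (intro AE_I2) (simp add: abs_mult mult_left_le)
    qed
    moreover have "(LINT x|lebesgue. indicator (cbox l u) x * w x * box_bump l u k x) = 0" for k
    proof -
      have "(LINT x|lebesgue. indicator (cbox l u) x * w x * box_bump l u k x)
          = (LINT x|lebesgue. indicator D x *\<^sub>R (w x * box_bump l u k x))"
        using lu box_bump_eq_0[of _ l u k] box_subset_cbox[of l u]
        by (intro Bochner_Integration.integral_cong) (auto simp: indicator_def)
      also have "\<dots> = (LINT x|lebesgue_on D. w x * box_bump l u k x)"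
        using Dm by (subst integral_restrict_space) auto
      finally show ?thesis using tests[OF box_bump_test_function[OF lu]] by simp
    qed
    ultimately have "(LINT x|lebesgue. indicator (cbox l u) x * w x * indicator (box l u) x) = 0"
      by (simp add: LIMSEQ_const_iff)
    moreover have "(LINT x|lebesgue. indicator (cbox l u) x * w x * indicator (box l u) x)
        = (LINT x|lebesgue. indicator (box l u) x * w x)"
      using box_subset_cbox[of l u]
      by (intro Bochner_Integration.integral_cong) (auto simp: indicator_def)
    ultimately show ?thesis by simp
  qed
  have ae: "AE x in lebesgue. x \<in> box l u \<longrightarrow> w x = 0" if lu: "cbox l u \<subseteq> D" for l u
  proof -
    define g where "g = (\<lambda>x. indicator (box l u) x * w x)"
    have g_eq: "g = (\<lambda>x. indicator (box l u) x *\<^sub>R (indicator (cbox l u) x * w x))"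
      using box_subset_cbox[of l u] by (auto simp: g_def indicator_def fun_eq_iff)
    have g: "integrable lebesgue g"
      unfolding g_eq using int[OF lu] by (intro integrable_mult_indicator) auto
    \<comment> \<open>The argument by box integrals runs over Borel sets and \<open>lborel\<close>,
      hence the passage to a Borel representative of \<open>g\<close>.\<close>
    obtain g' where g': "g' \<in> borel_measurable lborel" and eq: "AE x in lborel. g x = g' x"
      using completion_ex_borel_measurable_real[OF borel_measurable_integrable[OF g]] by blast
    have eq': "AE x in lebesgue. g x = g' x" using eq by (rule AE_completion)
    have g'_leb: "g' \<in> borel_measurable lebesgue" using g' by (rule measurable_completion)
    have "integrable lebesgue g'"
      using g eq' g'_leb integrable_cong_AE[of g lebesgue g'] by auto
    then have g'_int: "integrable lborel g'" using g' integrable_completion by blast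
    have box0: "(LINT x:box a c|lborel. g' x) = 0" for a c
    proof -
      have "(LINT x:box a c|lborel. g' x) = (LINT x|lebesgue. indicator (box a c) x *\<^sub>R g' x)"
        unfolding set_lebesgue_integral_def using g' by (subst integral_completion) auto
      also have "\<dots> = (LINT x|lebesgue. indicator (box a c) x *\<^sub>R g x)"
        using eq' g'_leb borel_measurable_integrable[OF g]
        by (intro integral_cong_AE borel_measurable_scaleR borel_measurable_indicator)
          (auto elim: eventually_mono)
      also have "\<dots> = (LINT x|lebesgue. indicator (box a c \<inter> box l u) x * w x)"
        by (intro Bochner_Integration.integral_cong) (auto simp: g_def indicator_def)
      also have "\<dots> = 0"
      proof (cases "box a c \<inter> box l u = {}")
        case False
        \<comment> \<open>The intersection is again a box, and its closure stays inside
          \<open>cbox l u\<close>, hence inside \<open>D\<close>, so the box integrals computed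
          above apply to it.\<close>
        obtain a' c' where ac: "box a c \<inter> box l u = box a' c'"
          unfolding box_Int_box by blast
        have "box a' c' \<noteq> {}" using False ac by simp
        then have "cbox a' c' = closure (box a' c')" by simp
        also have "\<dots> \<subseteq> cbox l u"
          using ac box_subset_cbox[of l u] by (intro closure_minimal) auto
        finally show ?thesis using zero[of a' c'] lu ac by auto
      qed simp
      finally show ?thesis .
    qed
    have "(LINT x|lborel. g' x) = (LINT x|lebesgue. g' x)"
      using g' by (subst integral_completion) auto
    also have "\<dots> = (LINT x|lebesgue. g x)"
      using eq' g'_leb borel_measurable_integrable[OF g]
      by (intro integral_cong_AE) (auto elim: eventually_mono)
    also have "\<dots> = 0" using zero[OF lu] by (simp add: g_def)
    finally have "AE x in lborel. g' x = 0"
      using AE_zero_of_box_integrals_zero[OF g'_int _ box0] by simp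
    then have "AE x in lebesgue. g' x = 0" by (rule AE_completion)
    then show ?thesis using eq' by eventually_elim (auto simp: g_def)
  qed
  \<comment> \<open>Countably many closed boxes cover \<open>D\<close>, and their frontiers are null
    sets, so the results on the open boxes can be glued together.\<close>
  obtain \<D> where \<D>: "countable \<D>" "\<D> \<subseteq> Pow D" "\<And>X. X \<in> \<D> \<Longrightarrow> \<exists>a b. X = cbox a b" "\<Union>\<D> = D"
    using open_countable_Union_open_cbox[OF D] by blast
  have "AE x in lebesgue. x \<in> X \<longrightarrow> w x = 0" if "X \<in> \<D>" for X
  proof -
    obtain l u where X: "X = cbox l u" using \<D>(3)[OF \<open>X \<in> \<D>\<close>] by blast
    have "AE x in lebesgue. x \<notin> cbox l u - box l u"
      by (rule AE_not_in) (use negligible_frontier_interval negligible_iff_null_sets in blast)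
    moreover have "AE x in lebesgue. x \<in> box l u \<longrightarrow> w x = 0"
      using ae X \<D>(2) \<open>X \<in> \<D>\<close> by blast
    ultimately show ?thesis unfolding X by eventually_elim auto
  qed
  then have "AE x in lebesgue. \<forall>X\<in>\<D>. x \<in> X \<longrightarrow> w x = 0"
    using \<D>(1) by (subst AE_ball_countable) auto
  then have "AE x in lebesgue. x \<in> D \<longrightarrow> w x = 0"
    using \<D>(4) by (elim eventually_mono) auto
  then show ?thesis using Dm by (subst AE_restrict_space_iff) auto
qed

section \<open>Linearity and uniqueness of weak gradients\<close>

lemma integrable_times_test_function:
  fixes w :: "'a::euclidean_space \<Rightarrow> real"
  assumes D: "open D" and w: "locally_integrable D w" and \<eta>: "\<eta> \<in> test_functions D"
  shows "integrable (lebesgue_on D) (\<lambda>x. w x * \<eta> x)"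
proof -
  obtain K where K: "compact K" "K \<subseteq> D" and \<eta>0: "\<And>x. x \<notin> K \<Longrightarrow> \<eta> x = 0"
    using \<eta> unfolding test_functions_def by blast
  have "C_diff 0 \<eta>" using \<eta> unfolding test_functions_def by blast
  then have cont: "continuous_on UNIV \<eta>" by simp
  have Km: "K \<in> sets lebesgue" using K by (simp add: compact_imp_closed)
  have "bounded (\<eta> ` K)"
    using K(1) cont by (intro compact_imp_bounded compact_continuous_image) (auto intro: continuous_on_subset)
  then obtain B where B: "\<And>x. x \<in> K \<Longrightarrow> norm (\<eta> x) \<le> B" by (auto simp: bounded_iff)
  have "integrable (lebesgue_on K) w" using w K by (simp add: locally_integrable_def)
  then have w': "integrable lebesgue (\<lambda>x. indicator K x *\<^sub>R w x)"
    using integrable_restrict_space[of K lebesgue "\<lambda>x. w x"] Km by auto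
  have "integrable lebesgue (\<lambda>x. indicator K x *\<^sub>R w x * \<eta> x)"
  proof (rule Bochner_Integration.integrable_bound[OF integrable_mult_left[OF w', of "B"]])
    have "\<eta> \<in> borel_measurable lebesgue"
      using cont by (intro measurable_completion) (simp add: borel_measurable_continuous_onI)
    then show "(\<lambda>x. indicator K x *\<^sub>R w x * \<eta> x) \<in> borel_measurable lebesgue"
      using borel_measurable_integrable[OF w'] by measurable
    show "AE x in lebesgue. norm (indicator K x *\<^sub>R w x * \<eta> x) \<le> norm (indicator K x *\<^sub>R w x * B)"
      using B by (intro AE_I2) (force simp: indicator_def abs_mult intro: mult_left_mono order_trans[OF _ abs_ge_self])
  qed
  also have "(\<lambda>x. indicator K x *\<^sub>R w x * \<eta> x) = (\<lambda>x. indicator D x *\<^sub>R (w x * \<eta> x))"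
    using K(2) \<eta>0 by (auto simp: indicator_def fun_eq_iff)
  finally show ?thesis
    using D integrable_restrict_space[of D lebesgue "\<lambda>x. w x * \<eta> x"] by auto
qed

text \<open>The same compact set serves for the derivative: its complement is open, so the function
  vanishes in a whole neighbourhood of each point there.\<close>

lemma test_function_derivative:
  assumes \<eta>: "\<eta> \<in> test_functions D"
  shows "(\<lambda>x. frechet_derivative \<eta> (at x) e) \<in> test_functions D"
proof -
  obtain K where K: "compact K" "K \<subseteq> D" and \<eta>0: "\<And>x. x \<notin> K \<Longrightarrow> \<eta> x = 0"
    using \<eta> unfolding test_functions_def by blast
  have C: "C_diff (Suc n) \<eta>" for n using \<eta> unfolding test_functions_def by blast
  have "frechet_derivative \<eta> (at x) e = 0" if "x \<notin> K" for x
  proof -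
    have "((\<lambda>_. 0) has_derivative (\<lambda>_. 0)) (at x)" by simp
    then have "(\<eta> has_derivative (\<lambda>_. 0)) (at x)"
      by (rule has_derivative_transform_within_open[OF _ open_Compl[OF compact_imp_closed[OF K(1)]]])
        (use that \<eta>0 in auto)
    then have "frechet_derivative \<eta> (at x) = (\<lambda>_. 0)"
      using frechet_derivative_at by metis
    then show ?thesis by simp
  qed
  moreover have "C_diff n (\<lambda>x. frechet_derivative \<eta> (at x) e)" for n using C[of n] by simp
  ultimately show ?thesis using K unfolding test_functions_def by blast
qed

lemma locally_integrable_component:
  fixes F :: "real^'n \<Rightarrow> real^'n"
  shows "locally_integrable D F \<Longrightarrow> locally_integrable D (\<lambda>x. F x $ i)"
  using integrable_inner_left[where c = "axis i 1"]
  by (auto simp: cart_eq_inner_axis locally_integrable_def)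

lemma has_weak_gradient_lincomb:
  fixes D :: "(real^'n) set"
  assumes D: "open D" and G: "has_weak_gradient D u G" and H: "has_weak_gradient D v H"
  shows "has_weak_gradient D (\<lambda>x. s * u x + t * v x) (\<lambda>x. s *\<^sub>R G x + t *\<^sub>R H x)"
proof -
  have loc: "locally_integrable D u" "locally_integrable D v" "locally_integrable D G" "locally_integrable D H"
    using G H unfolding has_weak_gradient_def by blast+
  have "locally_integrable D (\<lambda>x. s * u x + t * v x)" "locally_integrable D (\<lambda>x. s *\<^sub>R G x + t *\<^sub>R H x)"
    using loc by (auto simp: locally_integrable_def)
  moreover have "(LINT x|lebesgue_on D. (s * u x + t * v x) * frechet_derivative \<eta> (at x) (axis i 1)) =
      - (LINT x|lebesgue_on D. (s *\<^sub>R G x + t *\<^sub>R H x) $ i * \<eta> x)" if \<eta>: "\<eta> \<in> test_functions D" for \<eta> i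
  proof -
    have eq: "(LINT x|lebesgue_on D. w x * frechet_derivative \<eta> (at x) (axis i 1))
        = - (LINT x|lebesgue_on D. F x $ i * \<eta> x)" if "has_weak_gradient D w F" for w F
      using that \<eta> unfolding has_weak_gradient_def by blast
    note int = integrable_times_test_function[OF D _ test_function_derivative[OF \<eta>]]
      integrable_times_test_function[OF D locally_integrable_component \<eta>]
    have "(LINT x|lebesgue_on D. (s * u x + t * v x) * frechet_derivative \<eta> (at x) (axis i 1))
        = s * (LINT x|lebesgue_on D. u x * frechet_derivative \<eta> (at x) (axis i 1))
        + t * (LINT x|lebesgue_on D. v x * frechet_derivative \<eta> (at x) (axis i 1))"
      using int(1)[OF loc(1)] int(1)[OF loc(2)] by (simp add: distrib_right mult.assoc)
    also have "\<dots> = - (s * (LINT x|lebesgue_on D. G x $ i * \<eta> x) + t * (LINT x|lebesgue_on D. H x $ i * \<eta> x))"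
      unfolding eq[OF G] eq[OF H] by simp
    also have "\<dots> = - (LINT x|lebesgue_on D. (s *\<^sub>R G x + t *\<^sub>R H x) $ i * \<eta> x)"
      using int(2)[OF loc(3), of i] int(2)[OF loc(4), of i] by (simp add: distrib_right mult.assoc)
    finally show ?thesis .
  qed
  ultimately show ?thesis unfolding has_weak_gradient_def by blast
qed

text \<open>Both candidates have the same integrals against every test function, so the fundamental
  lemma applies to each component of their difference.\<close>

lemma weak_gradient_unique:
  fixes D :: "(real^'n) set"
  assumes D: "open D" and G: "has_weak_gradient D u G" and H: "has_weak_gradient D u H"
  shows "AE x in lebesgue_on D. G x = H x"
proof -
  have loc: "locally_integrable D (\<lambda>x. G x $ i - H x $ i)" for i
    using G H integrable_inner_left[where c = "axis i 1"]
    unfolding has_weak_gradient_def locally_integrable_def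
    by (intro allI impI Bochner_Integration.integrable_diff) (auto simp: cart_eq_inner_axis)
  have "AE x in lebesgue_on D. G x $ i - H x $ i = 0" for i
  proof (rule locally_integrable_zero_of_tests[OF D loc])
    fix \<eta> :: "real^'n \<Rightarrow> real" assume \<eta>: "\<eta> \<in> test_functions D"
    have "(LINT x|lebesgue_on D. (G x $ i - H x $ i) * \<eta> x)
        = (LINT x|lebesgue_on D. G x $ i * \<eta> x) - (LINT x|lebesgue_on D. H x $ i * \<eta> x)"
      using G H \<eta> unfolding has_weak_gradient_def left_diff_distrib
      by (intro Bochner_Integration.integral_diff integrable_times_test_function[OF D] locally_integrable_component) auto
    also have "\<dots> = 0"
    proof -
      have "(LINT x|lebesgue_on D. u x * frechet_derivative \<eta> (at x) (axis i 1))
          = - (LINT x|lebesgue_on D. F x $ i * \<eta> x)" if "has_weak_gradient D u F" for F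
        using that \<eta> unfolding has_weak_gradient_def by blast
      from this[OF G] this[OF H] show ?thesis by simp
    qed
    finally show "(LINT x|lebesgue_on D. (G x $ i - H x $ i) * \<eta> x) = 0" .
  qed
  then have "AE x in lebesgue_on D. \<forall>i\<in>UNIV. G x $ i - H x $ i = 0"
    by (subst AE_ball_countable) auto
  then show ?thesis by (elim eventually_mono) (simp add: vec_eq_iff)
qed

section \<open>Piecewise linear functions on a triangulated domain\<close>

text \<open>Translating one point to the origin turns affine into linear independence, and
  prescribed values on independent vectors extend to a linear functional.\<close>

lemma affine_independent_interpolation:
  fixes C :: "'a::euclidean_space set"
  assumes "\<not> affine_dependent C"
  shows "\<exists>c d. \<forall>v\<in>C. c \<bullet> v + d = (\<beta> v :: real)"
proof (cases "C = {}")
  case False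
  then obtain a where a: "a \<in> C" by blast
  have "\<not> affine_dependent (insert a (C - {a}))" using assms a by (simp add: insert_absorb)
  then have "independent ((\<lambda>x. - a + x) ` (C - {a}))"
    using affine_dependent_iff_dependent[of a "C - {a}"] by auto
  then obtain g where g: "linear g"
    and gv: "\<forall>y\<in>(\<lambda>x. - a + x) ` (C - {a}). g y = \<beta> (y + a) - \<beta> a"
    using linear_independent_extend[of _ "\<lambda>y. \<beta> (y + a) - \<beta> a"] by blast
  \<comment> \<open>The adjoint applied to 1 is the Riesz vector of the functional
    \<open>g\<close>.\<close>
  define c where "c = adjoint g 1"
  have c: "c \<bullet> x = g x" for x
    using adjoint_works[OF g, of x 1] by (simp add: c_def inner_commute)
  have "c \<bullet> v + (\<beta> a - c \<bullet> a) = \<beta> v" if "v \<in> C" for v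
  proof (cases "v = a")
    case False
    then have "g (- a + v) = \<beta> v - \<beta> a" using gv that by auto
    then show ?thesis by (simp add: c linear_diff[OF g])
  qed simp
  then show ?thesis by blast
qed simp

text \<open>The points where two affine functions agree form a convex set.\<close>

lemma affine_eq_on_convex_hull:
  fixes c c' :: "'a::euclidean_space"
  assumes "\<And>v. v \<in> C \<Longrightarrow> c \<bullet> v + d = c' \<bullet> v + d'" and "x \<in> convex hull C"
  shows "c \<bullet> x + d = c' \<bullet> x + d'"
proof -
  have "C \<subseteq> {x. (c - c') \<bullet> x = d' - d}"
    using assms(1) by (force simp: inner_diff_left algebra_simps)
  then have "convex hull C \<subseteq> {x. (c - c') \<bullet> x = d' - d}"
    by (rule hull_minimal) (rule convex_hyperplane)
  with assms(2) show ?thesis by (auto simp: inner_diff_left algebra_simps)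
qed

section \<open>Geometry of the triangulation, and the space \<open>X_h\<close>\<close>

locale triangulated_domain =
  fixes D :: "(real^2) set" and \<T> :: "(real^2) set set"
  assumes polygonal: "polygonal_domain D" and triangulates: "triangulates \<T> D"
begin

lemma open_D: "open D" and bounded_D: "bounded D" and connected_D: "connected D"
  and D_nonempty: "D \<noteq> {}" and interior_closure_D: "interior (closure D) = D"
  using polygonal by (auto simp: polygonal_domain_def)

lemma finite_\<T>: "finite \<T>" and Union_\<T>: "\<Union>\<T> = closure D"
  and face: "T \<in> \<T> \<Longrightarrow> T' \<in> \<T> \<Longrightarrow> (T \<inter> T') face_of T"
  and simplex: "T \<in> \<T> \<Longrightarrow> 2 simplex T"
  using triangulates by (auto simp: triangulates_def triangulation_def)

lemma closed_T: "T \<in> \<T> \<Longrightarrow> closed T" and convex_T: "T \<in> \<T> \<Longrightarrow> convex T"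
  using simplex closed_simplex convex_simplex by blast+

lemma interior_T_nonempty:
  assumes "T \<in> \<T>"
  shows "interior T \<noteq> {}"
proof -
  have "aff_dim T = int DIM(real^2)" using aff_dim_simplex[OF simplex[OF assms]] by simp
  then have "affine hull T = UNIV" using aff_dim_eq_full by blast
  then have "rel_interior T = interior T" by (rule rel_interior_interior)
  moreover have "T \<noteq> {}" using simplex[OF assms] by auto
  ultimately show ?thesis using rel_interior_eq_empty[OF convex_T[OF assms]] by auto
qed

lemma interior_T_subset: "T \<in> \<T> \<Longrightarrow> interior T \<subseteq> D"
  using Union_\<T> interior_closure_D interior_mono[of T "closure D"] by blast

text \<open>By conformity the intersection is a face of each triangle, and a face that meets the
  relative interior of a convex set is the whole set.\<close>

lemma interior_T_disjoint:
  assumes "T \<in> \<T>" "T' \<in> \<T>" "x \<in> interior T" "x \<in> interior T'"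
  shows "T = T'"
proof -
  have "S \<subseteq> S'" if "S \<in> \<T>" "S' \<in> \<T>" "x \<in> interior S" "x \<in> interior S'" for S S'
  proof -
    have "x \<in> S \<inter> S' \<inter> rel_interior S"
      using that(3,4) interior_subset interior_subset_rel_interior by blast
    then show ?thesis using subset_of_face_of[OF face[OF that(1,2)], of S] by blast
  qed
  with assms show ?thesis by blast
qed

text \<open>\<open>T \<inter> T'\<close> is a face of \<open>T\<close> that meets the relative
  interior of \<open>F\<close>, so it contains all of \<open>F\<close>.\<close>

lemma face_subset_of_mem:
  assumes "T \<in> \<T>" "F face_of T" "x \<in> rel_interior F" "T' \<in> \<T>" "x \<in> T'"
  shows "F \<subseteq> T'"
  using subset_of_face_of[OF face[OF assms(1,4)] face_of_imp_subset[OF assms(2)]] assms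
    rel_interior_subset face_of_imp_subset[OF assms(2)] by blast

text \<open>The triangles around a point in the relative interior of \<open>F\<close> all contain \<open>F\<close>, so the union of
  the triangles looks the same, up to scaling, near any two such points.\<close>

lemma face_disjoint_domain:
  assumes T: "T \<in> \<T>" and F: "F face_of T" and x: "x \<in> rel_interior F" "x \<notin> D"
  shows "F \<inter> D = {}"
proof (rule ccontr)
  assume "F \<inter> D \<noteq> {}"
  then obtain v where v: "v \<in> F" "v \<in> D" by blast
  have convF: "convex F" using F by (rule face_of_imp_convex)
  obtain r where r: "r > 0" "ball v r \<subseteq> D" using open_D v(2) openE by blast
  have "v \<noteq> x" using v x by auto
  \<comment> \<open>A step from \<open>v\<close> towards \<open>x\<close>, short enough to stay in
    the ball inside \<open>D\<close>; any positive length already reaches the relative interior of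
    \<open>F\<close>.\<close>
  define s where "s = min 1 (r / (2 * norm (v - x)))"
  have s: "0 < s" "s \<le> 1" using r \<open>v \<noteq> x\<close> by (auto simp: s_def)
  define w where "w = v - s *\<^sub>R (v - x)"
  have "norm (v - w) = s * norm (v - x)" using s by (simp add: w_def)
  also have "\<dots> \<le> r / (2 * norm (v - x)) * norm (v - x)"
    by (intro mult_right_mono) (auto simp: s_def)
  also have "\<dots> < r" using r \<open>v \<noteq> x\<close> by simp
  finally have wD: "w \<in> D" using r(2) by (auto simp: dist_norm)
  have w: "w \<in> rel_interior F"
    unfolding w_def using rel_interior_convex_shrink[OF convF x(1) v(1) s] .
  \<comment> \<open>Removing the triangles that miss \<open>w\<close> leaves a neighbourhood of
    \<open>w\<close> covered by triangles that contain \<open>w\<close>, hence all of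
    \<open>F\<close>.\<close>
  define S where "S = \<Union>{T\<in>\<T>. w \<notin> T}"
  have "closed S" unfolding S_def using finite_\<T> closed_T by (intro closed_Union) auto
  then have "open (D - S)" using open_D by (rule open_Diff[rotated])
  moreover have "w \<in> D - S" using wD by (auto simp: S_def)
  ultimately obtain \<delta> where \<delta>: "\<delta> > 0" "ball w \<delta> \<subseteq> D - S" using openE by blast
  have FsubT: "F \<subseteq> T'" if "T' \<in> \<T>" "w \<in> T'" for T'
    using face_subset_of_mem[OF T F w that] .
  have "w \<in> F" using w rel_interior_subset by blast
  \<comment> \<open>As \<open>x\<close> is in the relative interior, the segment from
    \<open>w\<close> to \<open>x\<close> can be prolonged inside \<open>F\<close> to a point
    \<open>z\<close> beyond \<open>x\<close>. The contraction with centre \<open>z\<close> and ratio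
    \<tau> then maps \<open>w\<close> to \<open>x\<close>.\<close>
  then obtain e where e: "e > 1" "(1 - e) *\<^sub>R w + e *\<^sub>R x \<in> F"
    using convex_rel_interior_iff[OF convF, of x] x(1) by auto
  define z where "z = (1 - e) *\<^sub>R w + e *\<^sub>R x"
  define \<tau> where "\<tau> = 1 - 1 / e"
  have \<tau>: "0 < \<tau>" "\<tau> < 1" using e(1) by (auto simp: \<tau>_def)
  have x_eq: "x = \<tau> *\<^sub>R w + (1 - \<tau>) *\<^sub>R z"
  proof -
    have "(1 - \<tau>) *\<^sub>R z = (1 / e * (1 - e)) *\<^sub>R w + x"
      using e(1) by (simp add: z_def \<tau>_def scaleR_add_right)
    also have "1 / e * (1 - e) = - \<tau>" using e(1) by (simp add: \<tau>_def field_simps)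
    finally show ?thesis by simp
  qed
  have "ball x (\<tau> * \<delta>) \<subseteq> closure D"
  proof
    fix y assume y: "y \<in> ball x (\<tau> * \<delta>)"
    \<comment> \<open>The preimage of \<open>y\<close> under this contraction. It lies in a triangle
      containing both \<open>w\<close> and \<open>z\<close>, and convexity keeps \<open>y\<close> in
      that triangle; so a whole ball around \<open>x\<close> is covered by
      \<open>closure D\<close>.\<close>
    define w' where "w' = w + (1 / \<tau>) *\<^sub>R (y - x)"
    have "norm (w - w') = norm (y - x) / \<tau>" using \<tau> by (simp add: w'_def)
    also have "\<dots> < \<delta>" using y \<tau> by (simp add: dist_norm norm_minus_commute field_simps)
    finally have "w' \<in> D - S" using \<delta>(2) by (auto simp: dist_norm)
    then obtain T' where T': "T' \<in> \<T>" "w' \<in> T'" "w \<in> T'"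
      using Union_\<T> closure_subset[of D] unfolding S_def by blast
    have "\<tau> *\<^sub>R w' + (1 - \<tau>) *\<^sub>R z \<in> T'"
      using T' FsubT[OF T'(1,3)] e(2) \<tau> by (intro convexD[OF convex_T]) (auto simp: z_def)
    also have "\<tau> *\<^sub>R w' + (1 - \<tau>) *\<^sub>R z = y"
      using \<tau> x_eq by (simp add: w'_def scaleR_add_right algebra_simps)
    finally show "y \<in> closure D" using T' Union_\<T> by blast
  qed
  moreover have "\<tau> * \<delta> > 0" using \<tau> \<delta> by simp
  ultimately have "x \<in> interior (closure D)" by (meson centre_in_ball interior_maximal open_ball subsetD)
  then show False using x interior_closure_D by simp
qed

lemma simplex_vertices:
  assumes "T \<in> \<T>"
  obtains C where "finite C" "\<not> affine_dependent C" "T = convex hull C" "\<forall>v. v \<in> C \<longleftrightarrow> v extreme_point_of T"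
proof -
  obtain C where C: "\<not> affine_dependent C" "T = convex hull C"
    using simplex[OF assms] by (auto simp: simplex_def)
  have "\<forall>v. v \<in> C \<longleftrightarrow> v extreme_point_of T"
    unfolding C(2) using extreme_point_of_convex_hull_affine_independent[OF C(1)] by blast
  from that[OF aff_independent_finite[OF C(1)] C this] show ?thesis .
qed

lemma finite_mesh_vertices: "finite (mesh_vertices \<T>)"
proof -
  have "finite {v. v extreme_point_of T}" if "T \<in> \<T>" for T
  proof -
    obtain C where C: "finite C" "\<not> affine_dependent C" "T = convex hull C" "\<forall>v. v \<in> C \<longleftrightarrow> v extreme_point_of T"
      using simplex_vertices[OF \<open>T \<in> \<T>\<close>] .
    from C(1,4) show ?thesis by (auto intro: finite_subset[of _ C])
  qed
  then have "finite (\<Union>T\<in>\<T>. {v. v extreme_point_of T})" using finite_\<T> by blast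
  moreover have "mesh_vertices \<T> = (\<Union>T\<in>\<T>. {v. v extreme_point_of T})"
    by (auto simp: mesh_vertices_def)
  ultimately show ?thesis by simp
qed

text \<open>The sum of the nodal basis functions, built from affine interpolants on the triangles.
  What has to be checked is that the interpolants agree on intersections and vanish at points
  outside \<open>D\<close>.\<close>

lemma X_h_interior_nodes_one:
  "\<exists>\<phi>\<in>X_h D \<T>. \<forall>x\<in>mesh_vertices \<T> \<inter> D. \<phi> x = 1"
proof -
  define \<beta> :: "real^2 \<Rightarrow> real" where "\<beta> v = (if v \<in> D then 1 else 0)" for v
  have "\<exists>c d. \<forall>v. v extreme_point_of T \<longrightarrow> c \<bullet> v + d = \<beta> v" if "T \<in> \<T>" for T
  proof -
    obtain C where C: "finite C" "\<not> affine_dependent C" "T = convex hull C" "\<forall>v. v \<in> C \<longleftrightarrow> v extreme_point_of T"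
      using simplex_vertices[OF \<open>T \<in> \<T>\<close>] .
    from affine_independent_interpolation[OF C(2), of \<beta>] C(4) show ?thesis by blast
  qed
  then obtain c d where cd: "\<And>T v. T \<in> \<T> \<Longrightarrow> v extreme_point_of T \<Longrightarrow> c T \<bullet> v + d T = \<beta> v"
    by metis
  \<comment> \<open>The intersection is a face of both triangles, so it is spanned by vertices of
    each. Both vertex sets are its extreme points and therefore coincide, and both interpolants
    carry the same values there.\<close>
  have agree: "c T \<bullet> x + d T = c T' \<bullet> x + d T'" if T: "T \<in> \<T>" "T' \<in> \<T>" "x \<in> T" "x \<in> T'" for T T' x
  proof -
    obtain C where C: "finite C" "\<not> affine_dependent C" "T = convex hull C" "\<forall>v. v \<in> C \<longleftrightarrow> v extreme_point_of T"
      using simplex_vertices[OF T(1)] .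
    obtain C' where C': "finite C'" "\<not> affine_dependent C'" "T' = convex hull C'" "\<forall>v. v \<in> C' \<longleftrightarrow> v extreme_point_of T'"
      using simplex_vertices[OF T(2)] .
    obtain S where S: "S \<subseteq> C" "T \<inter> T' = convex hull S"
      using face[OF T(1,2)] face_of_convex_hull_affine_independent[OF C(2)] C(3) by auto
    obtain S' where S': "S' \<subseteq> C'" "T \<inter> T' = convex hull S'"
      using face[OF T(2,1)] face_of_convex_hull_affine_independent[OF C'(2)] C'(3)
      by (auto simp: Int_commute)
    have "\<not> affine_dependent S" "\<not> affine_dependent S'"
      using S S' C C' affine_independent_subset by blast+
    then have "v \<in> S \<longleftrightarrow> v extreme_point_of (T \<inter> T')" "v \<in> S' \<longleftrightarrow> v extreme_point_of (T \<inter> T')" for v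
      using extreme_point_of_convex_hull_affine_independent[of S v]
        extreme_point_of_convex_hull_affine_independent[of S' v] unfolding S(2)[symmetric] S'(2)[symmetric]
      by simp_all
    then have "S = S'" by blast
    have "c T \<bullet> v + d T = c T' \<bullet> v + d T'" if "v \<in> S" for v
    proof -
      have "v extreme_point_of T" "v extreme_point_of T'"
        using that S(1) S'(1) C(4) C'(4) \<open>S = S'\<close> by blast+
      then show ?thesis using cd[OF T(1), of v] cd[OF T(2), of v] by simp
    qed
    moreover have "x \<in> convex hull S" using T(3,4) S(2) by blast
    ultimately show ?thesis by (rule affine_eq_on_convex_hull)
  qed
  \<comment> \<open>The vertices with positive barycentric coordinate span the face that has
    \<open>x\<close> in its relative interior. That face misses \<open>D\<close>, so all the vertex
    values entering at \<open>x\<close> are 0.\<close>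
  have vanish: "c T \<bullet> x + d T = 0" if T: "T \<in> \<T>" "x \<in> T" "x \<notin> D" for T x
  proof -
    obtain C where C: "finite C" "\<not> affine_dependent C" "T = convex hull C" "\<forall>v. v \<in> C \<longleftrightarrow> v extreme_point_of T"
      using simplex_vertices[OF T(1)] .
    have "x \<in> convex hull C" using T(2) C(3) by simp
    then obtain u where u: "\<And>v. v \<in> C \<Longrightarrow> 0 \<le> u v" "sum u C = 1" "(\<Sum>v\<in>C. u v *\<^sub>R v) = x"
      unfolding convex_hull_finite[OF C(1)] by blast
    define S where "S = {v\<in>C. u v > 0}"
    have S: "S \<subseteq> C" by (auto simp: S_def)
    have indS: "\<not> affine_dependent S" using C(2) S by (rule affine_independent_subset)
    have 0: "u v = 0" if "v \<in> C - S" for v using that u(1)[of v] by (auto simp: S_def)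
    have "sum u S = 1" using u(2) sum.mono_neutral_right[OF C(1) S, of u] 0 by simp
    moreover have "(\<Sum>v\<in>S. u v *\<^sub>R v) = x"
      using u(3) sum.mono_neutral_right[OF C(1) S, of "\<lambda>v. u v *\<^sub>R v"] 0 by simp
    ultimately have xS: "x \<in> rel_interior (convex hull S)"
      unfolding rel_interior_convex_hull_explicit[OF indS]
      by (auto simp: S_def intro!: exI[of _ u])
    have "(convex hull S) face_of T"
      using face_of_convex_hull_affine_independent[OF C(2)] C(3) S by blast
    then have "convex hull S \<inter> D = {}" using face_disjoint_domain[OF T(1) _ xS T(3)] by blast
    then have "\<beta> v = 0" if "v \<in> S" for v using that hull_inc[OF that, of convex] by (auto simp: \<beta>_def)
    then have "c T \<bullet> v + d T = 0 \<bullet> v + 0" if "v \<in> S" for v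
    proof -
      have "v extreme_point_of T" using that S C(4) by blast
      then show ?thesis using cd[OF T(1), of v] \<open>\<And>v. v \<in> S \<Longrightarrow> \<beta> v = 0\<close>[OF that] by simp
    qed
    moreover have "x \<in> convex hull S" using xS rel_interior_subset by blast
    ultimately have "c T \<bullet> x + d T = 0 \<bullet> x + 0" by (rule affine_eq_on_convex_hull)
    then show ?thesis by simp
  qed
  define \<phi> where "\<phi> x = (if x \<in> D then (let T = (SOME T. T \<in> \<T> \<and> x \<in> T) in c T \<bullet> x + d T) else 0)" for x
  have \<phi>: "\<phi> x = c T \<bullet> x + d T" if T: "T \<in> \<T>" "x \<in> T" for T x
  proof (cases "x \<in> D")
    case True
    define T' where "T' = (SOME T. T \<in> \<T> \<and> x \<in> T)"
    have "\<exists>T. T \<in> \<T> \<and> x \<in> T" using T by blast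
    then have "T' \<in> \<T> \<and> x \<in> T'" unfolding T'_def by (rule someI_ex)
    then have "c T' \<bullet> x + d T' = c T \<bullet> x + d T" using agree T by blast
    then show ?thesis using True by (simp add: \<phi>_def Let_def T'_def)
  next
    case False
    then show ?thesis using vanish[OF T False] by (simp add: \<phi>_def)
  qed
  have "continuous_on (\<Union>T\<in>\<T>. T) \<phi>"
  proof (rule continuous_on_closed_Union)
    fix T assume "T \<in> \<T>"
    then have "continuous_on T \<phi> \<longleftrightarrow> continuous_on T (\<lambda>x. c T \<bullet> x + d T)"
      using \<phi> by (intro continuous_on_cong) auto
    then show "continuous_on T \<phi>" by (auto intro!: continuous_intros)
  qed (use finite_\<T> closed_T in auto)
  then have "\<phi> \<in> X_h D \<T>"
    using \<phi> Union_\<T> by (auto simp: X_h_def \<phi>_def[of "_ :: real^2"] intro: exI)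
  moreover have "\<phi> x = 1" if "x \<in> mesh_vertices \<T> \<inter> D" for x
    using that \<phi> cd by (force simp: mesh_vertices_def \<beta>_def extreme_point_of_def)
  ultimately show ?thesis by blast
qed

lemma X_h_eq_0_of_vertices:
  assumes v: "v \<in> X_h D \<T>" and 0: "\<And>x. x \<in> mesh_vertices \<T> \<Longrightarrow> v x = 0"
  shows "v = (\<lambda>_. 0)"
proof
  fix x
  show "v x = 0"
  proof (cases "x \<in> D")
    case True
    then obtain T where T: "T \<in> \<T>" "x \<in> T" using Union_\<T> closure_subset by blast
    obtain c d where cd: "\<And>x. x \<in> T \<Longrightarrow> v x = c \<bullet> x + d" using v T by (auto simp: X_h_def)
    obtain C where C: "finite C" "\<not> affine_dependent C" "T = convex hull C" "\<forall>v. v \<in> C \<longleftrightarrow> v extreme_point_of T"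
      using simplex_vertices[OF T(1)] .
    have "c \<bullet> y + d = 0 \<bullet> y + 0" if "y \<in> C" for y
    proof -
      have "y \<in> T" unfolding C(3) using that by (rule hull_inc)
      moreover have "v y = 0" using that C(4) T(1) by (intro 0) (auto simp: mesh_vertices_def)
      ultimately show ?thesis using cd[of y] by simp
    qed
    moreover have "x \<in> convex hull C" using T(2) C(3) by simp
    ultimately have "c \<bullet> x + d = 0 \<bullet> x + 0" by (rule affine_eq_on_convex_hull)
    then show ?thesis using cd[OF T(2)] by simp
  next
    case False
    then show ?thesis using v by (simp add: X_h_def)
  qed
qed

lemma X_h_lincomb:
  assumes u: "u \<in> X_h D \<T>" and v: "v \<in> X_h D \<T>"
  shows "(\<lambda>x. s * u x + t * v x) \<in> X_h D \<T>"
proof -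
  have "\<exists>c d. \<forall>x\<in>T. s * u x + t * v x = c \<bullet> x + d" if "T \<in> \<T>" for T
  proof -
    have "\<exists>c d. \<forall>x\<in>T. u x = c \<bullet> x + d" "\<exists>c d. \<forall>x\<in>T. v x = c \<bullet> x + d"
      using u v that by (simp_all add: X_h_def)
    then obtain c d c' d' where "\<forall>x\<in>T. u x = c \<bullet> x + d" "\<forall>x\<in>T. v x = c' \<bullet> x + d'" by metis
    then have "\<forall>x\<in>T. s * u x + t * v x = (s *\<^sub>R c + t *\<^sub>R c') \<bullet> x + (s * d + t * d')"
      by (auto simp: algebra_simps)
    then show ?thesis by blast
  qed
  then show ?thesis using u v by (auto simp: X_h_def intro!: continuous_intros)
qed

text \<open>\<open>D\<close> need not be convex, so a segment between two points may leave it; for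
  the extension by zero this does no harm. Along the segment the function has finitely many closed
  pieces, each with the same Lipschitz constant, and on an interval such pieces can be
  glued.\<close>

lemma X_h_lipschitz:
  assumes v: "v \<in> X_h D \<T>"
  shows "\<exists>L. L-lipschitz_on UNIV v"
proof -
  have "\<forall>T\<in>\<T>. \<exists>c d. \<forall>x\<in>T. v x = c \<bullet> x + d" using v by (auto simp: X_h_def)
  then obtain c d where cd: "\<And>T x. T \<in> \<T> \<Longrightarrow> x \<in> T \<Longrightarrow> v x = c T \<bullet> x + d T" by metis
  define L where "L = (\<Sum>T\<in>\<T>. norm (c T))"
  have L0: "0 \<le> L" by (simp add: L_def sum_nonneg)
  have L: "norm (c T) \<le> L" if "T \<in> \<T>" for T
    unfolding L_def using that finite_\<T> by (intro member_le_sum) auto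
  have "dist (v x) (v y) \<le> L * dist x y" for x y
  proof -
    define \<gamma> where "\<gamma> t = x + t *\<^sub>R (y - x)" for t
    have cont: "continuous_on UNIV \<gamma>" unfolding \<gamma>_def by (intro continuous_intros)
    have "(L * dist x y)-lipschitz_on {0..1} (v \<circ> \<gamma>)"
    proof (rule lipschitz_on_closed_Union[where I = "insert (- D) \<T>" and U = "\<lambda>T. \<gamma> -` T"])
      show "finite (insert (- D) \<T>)" using finite_\<T> by simp
      show "0 \<le> L * dist x y" using L0 by simp
      show "{0..1} \<subseteq> (\<Union>T\<in>insert (- D) \<T>. \<gamma> -` T)"
      proof
        fix t
        have "\<gamma> t \<in> - D \<union> \<Union>\<T>" using Union_\<T> closure_subset[of D] by auto
        then show "t \<in> (\<Union>T\<in>insert (- D) \<T>. \<gamma> -` T)" by auto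
      qed
      fix T assume T: "T \<in> insert (- D) \<T>"
      then show "closed (\<gamma> -` T)"
        using closed_T open_D cont by (auto intro!: closed_vimage)
      show "(L * dist x y)-lipschitz_on (\<gamma> -` T) (v \<circ> \<gamma>)"
      proof (cases "T \<in> \<T>")
        case True
        show ?thesis
        proof (rule lipschitz_onI)
          fix s t assume "s \<in> \<gamma> -` T" "t \<in> \<gamma> -` T"
          then have "dist ((v \<circ> \<gamma>) s) ((v \<circ> \<gamma>) t) = \<bar>c T \<bullet> (\<gamma> s - \<gamma> t)\<bar>"
            using cd[OF True] by (simp add: dist_norm inner_diff_right)
          also have "\<dots> \<le> norm (c T) * norm (\<gamma> s - \<gamma> t)" by (rule Cauchy_Schwarz_ineq2)
          also have "\<dots> \<le> L * norm (\<gamma> s - \<gamma> t)" using L[OF True] by (intro mult_right_mono) auto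
          also have "\<gamma> s - \<gamma> t = (s - t) *\<^sub>R (y - x)" by (simp add: \<gamma>_def algebra_simps)
          finally show "dist ((v \<circ> \<gamma>) s) ((v \<circ> \<gamma>) t) \<le> L * dist x y * dist s t"
            by (simp add: dist_norm norm_minus_commute mult_ac)
        qed (use L0 in simp)
      next
        case False
        then have "v (\<gamma> s) = 0" if "s \<in> \<gamma> -` T" for s using T that v by (auto simp: X_h_def)
        then show ?thesis using L0 by (intro lipschitz_onI) auto
      qed
    qed
    then have "dist ((v \<circ> \<gamma>) 0) ((v \<circ> \<gamma>) 1) \<le> L * dist x y * dist (0::real) 1"
      by (rule lipschitz_onD) auto
    then show ?thesis by (simp add: \<gamma>_def)
  qed
  then show ?thesis using L0 by (intro exI[of _ L] lipschitz_onI) auto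
qed

end

section \<open>Integration by parts for Lipschitz functions\<close>

lemma integrable_continuous_bounded_support:
  fixes f :: "'a::euclidean_space \<Rightarrow> real"
  assumes f: "continuous_on UNIV f" and S: "bounded S" "\<And>x. x \<notin> S \<Longrightarrow> f x = 0"
  shows "integrable lborel f"
proof -
  obtain R where R: "S \<subseteq> cball 0 R" using S(1) unfolding bounded_iff by (metis mem_cball_0 subsetI)
  have "integrable lborel (\<lambda>x. indicator (cball 0 R) x *\<^sub>R f x)"
    using f by (intro borel_integrable_compact continuous_on_subset[OF f]) auto
  also have "(\<lambda>x. indicator (cball 0 R) x *\<^sub>R f x) = f"
    using R S(2) by (fastforce simp: indicator_def fun_eq_iff)
  finally show ?thesis .
qed

lemma lborel_integral_translate:
  fixes f :: "'a::euclidean_space \<Rightarrow> real"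
  assumes "f \<in> borel_measurable borel"
  shows "(LINT x|lborel. f (h + x)) = (LINT x|lborel. f x)"
  using integral_distr[of "(+) h" lborel borel f] assms lborel_distr_plus[of h] by simp

text \<open>Translation invariance moves a forward difference quotient of the test function \<eta>
  to a backward one of \<open>v\<close>, whose almost everywhere limit is \<open>- g x\<close>.
  Dominated convergence on both sides gives the formula; the Lipschitz constant provides the
  majorant for the quotients of \<open>v\<close>.\<close>

lemma lipschitz_integration_by_parts:
  fixes v \<eta> g :: "'a::euclidean_space \<Rightarrow> real"
  assumes v: "L-lipschitz_on UNIV v" and S: "bounded S" "\<And>x. x \<notin> S \<Longrightarrow> v x = 0"
    and \<eta>: "\<And>x. (\<eta> has_derivative \<eta>' x) (at x)" "continuous_on UNIV (\<lambda>x. \<eta>' x e)"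
    and K: "bounded K" "\<And>x. x \<notin> K \<Longrightarrow> \<eta> x = 0"
    and g: "g \<in> borel_measurable borel"
      "AE x in lborel. (\<lambda>k. (v (x - (1 / real (Suc k)) *\<^sub>R e) - v x) * real (Suc k)) \<longlonglongrightarrow> - g x"
  shows "(LINT x|lborel. v x * \<eta>' x e) = - (LINT x|lborel. g x * \<eta> x)"
proof -
  define h where "h k = (1 / real (Suc k)) *\<^sub>R e" for k
  have hS: "h k = (1 / real (Suc k)) *\<^sub>R e" for k by (simp add: h_def)
  have cv: "continuous_on A v" for A
    using lipschitz_on_continuous_on[OF v] continuous_on_subset by blast
  have c\<eta>: "continuous_on A \<eta>" for A
    by (intro continuous_at_imp_continuous_on ballI has_derivative_continuous[OF \<eta>(1)])
  have mv[measurable]: "v \<in> borel_measurable borel" using cv by (rule borel_measurable_continuous_onI)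
  have m\<eta>[measurable]: "\<eta> \<in> borel_measurable borel" using c\<eta> by (rule borel_measurable_continuous_onI)
  have m\<eta>'[measurable]: "(\<lambda>x. \<eta>' x e) \<in> borel_measurable borel"
    using \<eta>(2) by (rule borel_measurable_continuous_onI)
  note g(1)[measurable]
  \<comment> \<open>The mean value theorem evaluates the derivative of \<eta> at points
    \<open>x + z *\<^sub>R e\<close> with \<open>x\<close> in \<open>S\<close> and \<open>z\<close>
    at most 1. They all lie in the ball of radius \<open>R + norm e\<close>, where \<open>M\<close>
    bounds the derivative.\<close>
  obtain R where R: "S \<subseteq> cball 0 R" using S(1) unfolding bounded_iff by (metis mem_cball_0 subsetI)
  have "bounded ((\<lambda>x. \<eta>' x e) ` cball 0 (R + norm e))"
    using \<eta>(2) by (intro compact_imp_bounded compact_continuous_image) (auto intro: continuous_on_subset)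
  then obtain M where "\<forall>y\<in>(\<lambda>x. \<eta>' x e) ` cball 0 (R + norm e). norm y \<le> M"
    unfolding bounded_iff by blast
  then have M: "\<bar>\<eta>' x e\<bar> \<le> M" if "x \<in> cball 0 (R + norm e)" for x
    using that by (simp add: image_iff)
  have line: "((\<lambda>t. \<eta> (x + t *\<^sub>R e)) has_real_derivative \<eta>' (x + t *\<^sub>R e) e) (at t)" for x t
  proof -
    have "((\<lambda>t. x + t *\<^sub>R e) has_derivative (\<lambda>s. s *\<^sub>R e)) (at t)"
      by (auto intro!: derivative_eq_intros)
    from has_derivative_compose[OF this \<eta>(1)]
    have "((\<lambda>t. \<eta> (x + t *\<^sub>R e)) has_derivative (\<lambda>s. \<eta>' (x + t *\<^sub>R e) (s *\<^sub>R e))) (at t)" .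
    moreover have "(\<lambda>s. \<eta>' (x + t *\<^sub>R e) (s *\<^sub>R e)) = (\<lambda>s. \<eta>' (x + t *\<^sub>R e) e * s)"
      using linear_scale[OF has_derivative_linear[OF \<eta>(1)]] by (auto simp: fun_eq_iff)
    ultimately show ?thesis by (simp add: has_field_derivative_def)
  qed
  have "(\<lambda>k. LINT x|lborel. v x * ((\<eta> (x + h k) - \<eta> x) * real (Suc k)))
      \<longlonglongrightarrow> (LINT x|lborel. v x * \<eta>' x e)"
  proof (rule integral_dominated_convergence[where w = "\<lambda>x. \<bar>v x\<bar> * M"])
    show "integrable lborel (\<lambda>x. \<bar>v x\<bar> * M)"
      using S by (intro integrable_continuous_bounded_support[of _ S] continuous_intros cv) auto
    show "AE x in lborel. (\<lambda>k. v x * ((\<eta> (x + h k) - \<eta> x) * real (Suc k))) \<longlonglongrightarrow> v x * \<eta>' x e"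
    proof (intro AE_I2 tendsto_mult tendsto_const)
      fix x
      have "((\<lambda>t. (\<eta> (x + t *\<^sub>R e) - \<eta> x) / t) \<longlongrightarrow> \<eta>' x e) (at 0)"
        using line[of x 0] by (simp add: DERIV_def)
      moreover have "filterlim (\<lambda>k. 1 / real (Suc k)) (at 0) sequentially"
        using LIMSEQ_Suc[OF lim_1_over_n] by (auto simp: filterlim_at)
      ultimately have "(\<lambda>k. (\<eta> (x + (1 / real (Suc k)) *\<^sub>R e) - \<eta> x) / (1 / real (Suc k))) \<longlonglongrightarrow> \<eta>' x e"
        by (rule filterlim_compose)
      then show "(\<lambda>k. (\<eta> (x + h k) - \<eta> x) * real (Suc k)) \<longlonglongrightarrow> \<eta>' x e"
        by (simp add: hS)
    qed
    show "AE x in lborel. norm (v x * ((\<eta> (x + h k) - \<eta> x) * real (Suc k))) \<le> \<bar>v x\<bar> * M" for k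
    proof (intro AE_I2)
      fix x
      show "norm (v x * ((\<eta> (x + h k) - \<eta> x) * real (Suc k))) \<le> \<bar>v x\<bar> * M"
      proof (cases "x \<in> S")
        case True
        obtain z where z: "0 < z" "z < 1 / real (Suc k)"
          "\<eta> (x + (1 / real (Suc k)) *\<^sub>R e) - \<eta> (x + 0 *\<^sub>R e) = (1 / real (Suc k) - 0) * \<eta>' (x + z *\<^sub>R e) e"
          using MVT2[of 0 "1 / real (Suc k)" "\<lambda>t. \<eta> (x + t *\<^sub>R e)" "\<lambda>t. \<eta>' (x + t *\<^sub>R e) e"] line
          by auto
        have "z \<le> 1" using z(2) by (rule order_trans[OF less_imp_le]) simp
        have "norm (x + z *\<^sub>R e) \<le> norm x + norm (z *\<^sub>R e)" by (rule norm_triangle_ineq)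
        also have "\<dots> \<le> R + norm e"
          using True R z(1) \<open>z \<le> 1\<close> by (intro add_mono) (auto simp: mult_left_le_one_le)
        finally have "\<bar>\<eta>' (x + z *\<^sub>R e) e\<bar> \<le> M" by (intro M) simp
        moreover have "(\<eta> (x + h k) - \<eta> x) * real (Suc k) = \<eta>' (x + z *\<^sub>R e) e"
          using z(3) by (simp add: hS)
        ultimately show ?thesis by (simp add: abs_mult mult_left_mono)
      qed (simp add: S(2))
    qed
  qed measurable
  moreover have "(\<lambda>k. LINT x|lborel. ((v (x - h k) - v x) * real (Suc k)) * \<eta> x)
      \<longlonglongrightarrow> (LINT x|lborel. - g x * \<eta> x)"
  proof (rule integral_dominated_convergence[where w = "\<lambda>x. L * norm e * \<bar>\<eta> x\<bar>"])
    show "integrable lborel (\<lambda>x. L * norm e * \<bar>\<eta> x\<bar>)"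
      using K by (intro integrable_continuous_bounded_support[of _ K] continuous_intros c\<eta>) auto
    show "AE x in lborel. (\<lambda>k. (v (x - h k) - v x) * real (Suc k) * \<eta> x) \<longlonglongrightarrow> - g x * \<eta> x"
      using g(2) unfolding hS by eventually_elim (intro tendsto_mult tendsto_const)
    show "AE x in lborel. norm ((v (x - h k) - v x) * real (Suc k) * \<eta> x) \<le> L * norm e * \<bar>\<eta> x\<bar>" for k
    proof (intro AE_I2)
      fix x
      have "\<bar>v (x - h k) - v x\<bar> \<le> L * norm (h k)"
        using lipschitz_onD[OF v, of "x - h k" x] by (simp add: dist_norm)
      also have "\<dots> = L * norm e / real (Suc k)" by (simp add: hS)
      finally have "\<bar>v (x - h k) - v x\<bar> * real (Suc k) \<le> L * norm e" by (simp add: pos_le_divide_eq)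
      then have "\<bar>v (x - h k) - v x\<bar> * real (Suc k) * \<bar>\<eta> x\<bar> \<le> L * norm e * \<bar>\<eta> x\<bar>"
        by (rule mult_right_mono) simp
      then show "norm ((v (x - h k) - v x) * real (Suc k) * \<eta> x) \<le> L * norm e * \<bar>\<eta> x\<bar>"
        by (simp add: abs_mult)
    qed
  qed measurable
  moreover have "(LINT x|lborel. v x * ((\<eta> (x + h k) - \<eta> x) * real (Suc k)))
      = (LINT x|lborel. ((v (x - h k) - v x) * real (Suc k)) * \<eta> x)" for k
  proof -
    have shift: "continuous_on UNIV (\<lambda>x. x + h k)" "continuous_on UNIV (\<lambda>x. x - h k)"
      by (intro continuous_intros)+
    have "continuous_on UNIV (\<lambda>x. \<eta> (x + h k))" "continuous_on UNIV (\<lambda>x. v (x - h k))"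
      using continuous_on_compose2[OF c\<eta> shift(1)] continuous_on_compose2[OF cv shift(2)] by auto
    note cont = this cv c\<eta>
    have int: "integrable lborel (\<lambda>x. v x * \<eta> (x + h k))" "integrable lborel (\<lambda>x. v x * \<eta> x)"
      using S by (auto intro!: integrable_continuous_bounded_support[of _ S] continuous_intros cont)
    have int': "integrable lborel (\<lambda>x. v (x - h k) * \<eta> x)"
      using K by (auto intro!: integrable_continuous_bounded_support[of _ K] continuous_intros cont)
    have "(LINT x|lborel. v (x - h k) * \<eta> x) = (LINT x|lborel. v (h k + x - h k) * \<eta> (h k + x))"
      by (rule lborel_integral_translate[symmetric]) measurable
    then have eq: "(LINT x|lborel. v (x - h k) * \<eta> x) = (LINT x|lborel. v x * \<eta> (x + h k))"
      by (simp add: add.commute)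
    have "(LINT x|lborel. v x * ((\<eta> (x + h k) - \<eta> x) * real (Suc k)))
        = (LINT x|lborel. (v x * \<eta> (x + h k) - v x * \<eta> x) * real (Suc k))"
      by (simp only: right_diff_distrib left_diff_distrib mult.assoc)
    also have "\<dots> = ((LINT x|lborel. v (x - h k) * \<eta> x) - (LINT x|lborel. v x * \<eta> x)) * real (Suc k)"
      unfolding integral_mult_left_zero Bochner_Integration.integral_diff[OF int] eq ..
    also have "\<dots> = (LINT x|lborel. (v (x - h k) * \<eta> x - v x * \<eta> x) * real (Suc k))"
      unfolding integral_mult_left_zero Bochner_Integration.integral_diff[OF int' int(2)] ..
    finally show ?thesis by (simp add: algebra_simps)
  qed
  ultimately have "(LINT x|lborel. v x * \<eta>' x e) = (LINT x|lborel. - g x * \<eta> x)"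
    using LIMSEQ_unique by simp
  then show ?thesis by simp
qed

lemma lebesgue_on_integral_eq_lborel:
  fixes h :: "'a::euclidean_space \<Rightarrow> real"
  assumes "D \<in> sets borel" "h \<in> borel_measurable borel" "\<And>x. x \<notin> D \<Longrightarrow> h x = 0"
  shows "(LINT x|lebesgue_on D. h x) = (LINT x|lborel. h x)"
proof -
  have "(LINT x|lebesgue_on D. h x) = (LINT x|lebesgue. indicator D x *\<^sub>R h x)"
    using assms(1) by (subst integral_restrict_space) auto
  also have "(\<lambda>x. indicator D x *\<^sub>R h x) = h" using assms(3) by (auto simp: indicator_def fun_eq_iff)
  also have "(LINT x|lebesgue. h x) = (LINT x|lborel. h x)"
    using assms(2) by (intro integral_completion) simp
  finally show ?thesis .
qed

lemma integrable_bounded_lebesgue_on: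
  fixes f :: "'a::euclidean_space \<Rightarrow> 'b::euclidean_space"
  assumes S: "S \<in> lmeasurable" and f: "f \<in> borel_measurable (lebesgue_on S)"
    and B: "AE x in lebesgue_on S. norm (f x) \<le> B"
  shows "integrable (lebesgue_on S) f"
proof -
  interpret finite_measure "lebesgue_on S" using S by (rule finite_measure_lebesgue_on)
  show ?thesis using B f by (rule integrable_const_bound)
qed

context triangulated_domain
begin

lemma X_h_weak_gradient:
  assumes v: "v \<in> X_h D \<T>"
  shows "\<exists>G. G \<in> borel_measurable borel \<and> bounded (range G) \<and> has_weak_gradient D v G \<and>
    ((AE x in lebesgue_on D. G x = 0) \<longrightarrow> v = (\<lambda>_. 0))"
proof -
  have "\<forall>T\<in>\<T>. \<exists>c d. \<forall>x\<in>T. v x = c \<bullet> x + d" using v by (auto simp: X_h_def)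
  then obtain c d where cd: "\<And>T x. T \<in> \<T> \<Longrightarrow> x \<in> T \<Longrightarrow> v x = c T \<bullet> x + d T" by metis
  have v0: "v x = 0" if "x \<notin> D" for x using v that by (simp add: X_h_def)
  \<comment> \<open>Interiors of distinct triangles are disjoint, so at most one summand is nonzero
    at a point.\<close>
  define G where "G x = (\<Sum>T\<in>\<T>. indicator (interior T) x *\<^sub>R c T)" for x
  have mG[measurable]: "G \<in> borel_measurable borel"
    unfolding G_def by (intro borel_measurable_sum borel_measurable_scaleR borel_measurable_indicator) auto
  have boundG: "norm (G x) \<le> (\<Sum>T\<in>\<T>. norm (c T))" for x
    unfolding G_def by (intro order_trans[OF norm_sum] sum_mono) (auto simp: indicator_def)
  have G: "G x = c T" if "T \<in> \<T>" "x \<in> interior T" for T x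
  proof -
    have "indicator (interior T') x *\<^sub>R c T' = (if T' = T then c T else 0)" if "T' \<in> \<T>" for T'
      using interior_T_disjoint[of T' T x] that \<open>T \<in> \<T>\<close> \<open>x \<in> interior T\<close>
      by (cases "x \<in> interior T'") auto
    then have "G x = (\<Sum>T'\<in>\<T>. if T' = T then c T else 0)"
      unfolding G_def by (rule sum.cong[OF refl])
    then show ?thesis using that finite_\<T> by simp
  qed
  have G0: "G x = 0" if "x \<notin> closure D" for x
  proof -
    have "x \<notin> interior T" if "T \<in> \<T>" for T
      using interior_T_subset[OF that] closure_subset[of D] \<open>x \<notin> closure D\<close> by auto
    then show ?thesis by (simp add: G_def)
  qed
  obtain L where L: "L-lipschitz_on UNIV v" using X_h_lipschitz[OF v] by blast
  have cv: "continuous_on A v" for A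
    using lipschitz_on_continuous_on[OF L] continuous_on_subset by blast
  have mv[measurable]: "v \<in> borel_measurable borel" using cv by (rule borel_measurable_continuous_onI)
  have "bounded (v ` closure D)"
    using cv bounded_D by (intro compact_imp_bounded compact_continuous_image) auto
  then obtain B where B: "\<And>x. x \<in> closure D \<Longrightarrow> norm (v x) \<le> B" by (auto simp: bounded_iff)
  have Bv: "norm (v x) \<le> max B 0" for x
    using B[of x] v0[of x] closure_subset[of D] by (cases "x \<in> D") auto
  have "locally_integrable D v"
    unfolding locally_integrable_def
  proof (intro allI impI integrable_bounded_lebesgue_on[where B = "max B 0"])
    show "v \<in> borel_measurable (lebesgue_on K)" for K
      using mv by (intro measurable_restrict_space1 measurable_completion) simp
  qed (use Bv lmeasurable_compact in auto)
  moreover have "locally_integrable D G"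
    unfolding locally_integrable_def
  proof (intro allI impI integrable_bounded_lebesgue_on[where B = "\<Sum>T\<in>\<T>. norm (c T)"])
    show "G \<in> borel_measurable (lebesgue_on K)" for K
      using mG by (intro measurable_restrict_space1 measurable_completion) simp
  qed (use boundG lmeasurable_compact in auto)
  moreover have "(LINT x|lebesgue_on D. v x * frechet_derivative \<eta> (at x) (axis i 1)) =
      - (LINT x|lebesgue_on D. G x $ i * \<eta> x)" if \<eta>: "\<eta> \<in> test_functions D" for \<eta> i
  proof -
    define e :: "real^2" where "e = axis i 1"
    obtain K where K: "compact K" "K \<subseteq> D" "\<And>x. x \<notin> K \<Longrightarrow> \<eta> x = 0"
      using \<eta> unfolding test_functions_def by blast
    have C: "C_diff (Suc 0) \<eta>" using \<eta> unfolding test_functions_def by blast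
    then have diff: "\<And>x. (\<eta> has_derivative frechet_derivative \<eta> (at x)) (at x)"
      and cont: "continuous_on UNIV (\<lambda>x. frechet_derivative \<eta> (at x) e)"
      using frechet_derivative_works by (auto simp: e_def)
    have c\<eta>: "continuous_on UNIV \<eta>"
      by (intro continuous_at_imp_continuous_on ballI has_derivative_continuous[OF diff])
    have [measurable]: "\<eta> \<in> borel_measurable borel"
      "(\<lambda>x. frechet_derivative \<eta> (at x) e) \<in> borel_measurable borel"
      using c\<eta> cont by (auto intro: borel_measurable_continuous_onI)
    have ae: "AE x in lborel. x \<notin> frontier T" if "T \<in> \<T>" for T
    proof -
      have "frontier T \<in> null_sets lebesgue"
        using negligible_convex_frontier[OF convex_T[OF that]] negligible_iff_null_sets by blast
      then have "AE x in lebesgue. x \<notin> frontier T" by (rule AE_not_in)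
      then show ?thesis by (simp add: AE_completion_iff)
    qed
    \<comment> \<open>Frontiers of convex sets are negligible. Off them a point is interior to a
      triangle or lies outside \<open>closure D\<close>, and the difference quotients are eventually
      constant.\<close>
    have "AE x in lborel. \<forall>T\<in>\<T>. x \<notin> frontier T"
      using ae finite_\<T> by (subst AE_ball_countable) (auto intro: countable_finite)
    then have lim: "AE x in lborel. (\<lambda>k. (v (x - (1 / real (Suc k)) *\<^sub>R e) - v x) * real (Suc k)) \<longlonglongrightarrow> - (G x \<bullet> e)"
    proof eventually_elim
      case (elim x)
      have conv: "(\<lambda>k. x - (1 / real (Suc k)) *\<^sub>R e) \<longlonglongrightarrow> x - 0 *\<^sub>R e"
        by (intro tendsto_intros LIMSEQ_Suc[OF lim_1_over_n])
      show ?case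
      proof (cases "x \<in> closure D")
        case True
        then obtain T where T: "T \<in> \<T>" "x \<in> T" using Union_\<T> by blast
        then have x: "x \<in> interior T"
          using elim closed_T by (auto simp: frontier_def)
        have "\<forall>\<^sub>F k in sequentially. x - (1 / real (Suc k)) *\<^sub>R e \<in> interior T"
          using topological_tendstoD[OF conv open_interior, of T] x by simp
        then have "\<forall>\<^sub>F k in sequentially.
            - (G x \<bullet> e) = (v (x - (1 / real (Suc k)) *\<^sub>R e) - v x) * real (Suc k)"
        proof eventually_elim
          case (elim k)
          then have "x - (1 / real (Suc k)) *\<^sub>R e \<in> T" using interior_subset by blast
          then show ?case
            unfolding cd[OF T(1) \<open>x - _ \<in> T\<close>] cd[OF T] G[OF T(1) x]
            by (simp add: inner_diff_right)
        qed
        then show ?thesis by (rule Lim_transform_eventually[OF tendsto_const])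
      next
        case False
        have "\<forall>\<^sub>F k in sequentially. x - (1 / real (Suc k)) *\<^sub>R e \<in> - closure D"
          using topological_tendstoD[OF conv, of "- closure D"] False by (simp add: open_Compl)
        then have "\<forall>\<^sub>F k in sequentially.
            0 = (v (x - (1 / real (Suc k)) *\<^sub>R e) - v x) * real (Suc k)"
        proof eventually_elim
          case (elim k)
          then have "x - (1 / real (Suc k)) *\<^sub>R e \<notin> D" "x \<notin> D"
            using closure_subset False by blast+
          then show ?case by (simp add: v0)
        qed
        then have "(\<lambda>k. (v (x - (1 / real (Suc k)) *\<^sub>R e) - v x) * real (Suc k)) \<longlonglongrightarrow> 0"
          by (rule Lim_transform_eventually[OF tendsto_const])
        then show ?thesis using G0[OF False] by simp
      qed
    qed
    have "(LINT x|lebesgue_on D. v x * frechet_derivative \<eta> (at x) e)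
        = (LINT x|lborel. v x * frechet_derivative \<eta> (at x) e)"
      using open_D v0 by (intro lebesgue_on_integral_eq_lborel) auto
    also have "\<dots> = - (LINT x|lborel. G x \<bullet> e * \<eta> x)"
      using compact_imp_bounded[OF K(1)] K(3) v0 bounded_D lim
      by (intro lipschitz_integration_by_parts[OF L _ _ diff cont, of D K]) auto
    also have "(LINT x|lborel. G x \<bullet> e * \<eta> x) = (LINT x|lebesgue_on D. G x \<bullet> e * \<eta> x)"
      using open_D K by (intro lebesgue_on_integral_eq_lborel[symmetric]) auto
    finally show ?thesis by (simp add: e_def cart_eq_inner_axis)
  qed
  ultimately have weak: "has_weak_gradient D v G" by (simp add: has_weak_gradient_def)
  have "v = (\<lambda>_. 0)" if ae: "AE x in lebesgue_on D. G x = 0"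
  proof -
    have "AE x in lebesgue. x \<in> D \<longrightarrow> G x = 0"
      using ae open_D by (subst (asm) AE_restrict_space_iff) auto
    have c0: "c T = 0" if T: "T \<in> \<T>" for T
    proof (rule ccontr)
      assume "c T \<noteq> 0"
      \<comment> \<open>The interior of \<open>T\<close> lies in \<open>D\<close> and is a nonempty
        open set, so it cannot be null; hence the constant gradient on \<open>T\<close> is
        zero.\<close>
      have "AE x in lebesgue. x \<notin> interior T"
        using \<open>AE x in lebesgue. x \<in> D \<longrightarrow> G x = 0\<close>
        by eventually_elim (use G[OF T] \<open>c T \<noteq> 0\<close> interior_T_subset[OF T] in auto)
      then have "interior T \<in> null_sets lebesgue"
        by (subst (asm) AE_iff_null_sets[symmetric]) auto
      then show False
        using interior_T_nonempty[OF T] open_not_negligible[OF open_interior]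
          negligible_iff_null_sets by blast
    qed
    \<comment> \<open>With all slopes zero only the constants \<open>d T\<close> remain as values. A
      continuous function with finitely many values on a connected set is constant, and a frontier
      point fixes the constant as 0.\<close>
    have "v x \<in> d ` \<T>" if "x \<in> closure D" for x
      using that Union_\<T> cd c0 by force
    then have "finite (v ` closure D)" using finite_\<T> by (meson finite_imageI finite_subset image_subsetI)
    then have "v constant_on closure D"
      using connected_D cv by (intro continuous_finite_range_constant) (auto intro: connected_imp_connected_closure)
    then obtain k where k: "\<And>x. x \<in> closure D \<Longrightarrow> v x = k" by (auto simp: constant_on_def)
    have "D \<noteq> UNIV" using bounded_D not_bounded_UNIV by metis
    then have "frontier D \<noteq> {}" using D_nonempty by (simp add: frontier_eq_empty)
    then obtain y where y: "y \<in> closure D" "y \<notin> D"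
      using open_D by (auto simp: frontier_def interior_open)
    then have "k = 0" using k v0 by metis
    then show ?thesis using k v0 closure_subset[of D] by (auto simp: fun_eq_iff)
  qed
  moreover have "bounded (range G)" using boundG by (auto simp: bounded_iff)
  ultimately show ?thesis using weak mG by blast
qed

end

section \<open>Weighted iterated integrals\<close>

text \<open>Completeness of Lebesgue measure transfers measurability from \<open>g\<close> to
  \<open>f\<close>. This allows integrands about which nothing is known but an almost everywhere
  equality.\<close>

lemma lebesgue_on_cong_AE:
  fixes f g :: "'a::euclidean_space \<Rightarrow> real"
  assumes S: "S \<in> sets lebesgue" and g: "g \<in> borel_measurable (lebesgue_on S)"
    and ae: "AE x in lebesgue_on S. f x = g x"
  shows borel_measurable_lebesgue_on_cong_AE: "f \<in> borel_measurable (lebesgue_on S)"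
    and integral_lebesgue_on_cong_AE: "(LINT x|lebesgue_on S. f x) = (LINT x|lebesgue_on S. g x)"
proof -
  have "AE x in lebesgue. (if x \<in> S then g x else 0) = (if x \<in> S then f x else 0)"
    using ae S by (subst (asm) AE_restrict_space_iff) (auto elim: eventually_mono)
  then have "(\<lambda>x. if x \<in> S then f x else 0) \<in> borel_measurable lebesgue"
    by (rule borel_measurable_AE[OF borel_measurable_if_I[OF g S]])
  then show f: "f \<in> borel_measurable (lebesgue_on S)"
    by (rule borel_measurable_if_D)
  show "(LINT x|lebesgue_on S. f x) = (LINT x|lebesgue_on S. g x)"
    using f g ae by (rule integral_cong_AE)
qed

text \<open>Suited to functions chosen slice by slice: \<open>q\<close> itself may fail to be
  jointly measurable, while \<open>q'\<close> is Borel, so that its inner integrals depend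
  measurably on \<open>y\<close>. Agreement is required for every \<open>y\<close>, with an
  exceptional null set in \<open>x\<close> that may vary with \<open>y\<close>.\<close>

definition bounded_version ::
  "'a::euclidean_space set \<Rightarrow> ('a \<times> 'b::euclidean_space \<Rightarrow> 'c::euclidean_space) \<Rightarrow> ('a \<times> 'b \<Rightarrow> 'c) \<Rightarrow> bool" where
  "bounded_version D q q' \<longleftrightarrow>
     q' \<in> borel_measurable borel \<and> bounded (range q') \<and>
     (\<forall>y. AE x in lebesgue_on D. q (x, y) = q' (x, y))"

locale product_domain =
  fixes D :: "'a::euclidean_space set" and \<Gamma> :: "'b::euclidean_space set"
  assumes D: "D \<in> sets borel" and \<Gamma>: "\<Gamma> \<in> sets borel"
begin

lemma D_lebesgue: "D \<in> sets lebesgue" and \<Gamma>_lebesgue: "\<Gamma> \<in> sets lebesgue"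
  using D \<Gamma> by auto

lemma D_Times_\<Gamma>: "D \<times> \<Gamma> \<in> sets borel"
  using D \<Gamma> by (rule borel_Times)

text \<open>Fubini for null sets, carried out on a Borel null set that contains all
  exceptions.\<close>

lemma AE_slices:
  assumes "AE z in lebesgue_on (D \<times> \<Gamma>). P z"
  shows "AE y in lebesgue_on \<Gamma>. AE x in lebesgue_on D. P (x, y)"
proof -
  have "AE z in lebesgue. z \<in> D \<times> \<Gamma> \<longrightarrow> P z"
    using assms D_Times_\<Gamma> by (subst (asm) AE_restrict_space_iff) auto
  then have "AE z in lborel. z \<in> D \<times> \<Gamma> \<longrightarrow> P z" by (simp add: AE_completion_iff)
  then obtain N where N: "N \<in> null_sets lborel" and sub: "{z. \<not> (z \<in> D \<times> \<Gamma> \<longrightarrow> P z)} \<subseteq> N"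
    by (auto simp: eventually_ae_filter)
  have "AE z in lborel. z \<notin> N" using N by (rule AE_not_in)
  then have "AE z in lborel \<Otimes>\<^sub>M lborel. z \<notin> N" by (subst lborel_prod)
  then have "AE x in lborel. AE y in lborel. (x, y) \<notin> N" by (rule lborel_pair.AE_pair)
  \<comment> \<open>The product theorem slices along the first variable; exchanging the order of the
    two variables requires this measurability.\<close>
  moreover have "{z \<in> space (lborel \<Otimes>\<^sub>M lborel). (fst z, snd z) \<notin> N} \<in> sets (lborel \<Otimes>\<^sub>M lborel)"
  proof -
    have "- N \<in> sets lborel" using N by auto
    moreover have "{z \<in> space (lborel \<Otimes>\<^sub>M lborel). (fst z, snd z) \<notin> N} = - N"
      by (auto simp: space_pair_measure)
    ultimately show ?thesis by (metis lborel_prod)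
  qed
  ultimately have "AE y in lborel. AE x in lborel. (x, y) \<notin> N"
    using lborel_pair.AE_commute[of "\<lambda>x y. (x, y) \<notin> N"] by blast
  then have "AE y in lborel. y \<in> \<Gamma> \<longrightarrow> (AE x in lebesgue_on D. P (x, y))"
  proof eventually_elim
    case (elim y)
    show ?case
    proof
      assume y: "y \<in> \<Gamma>"
      have "AE x in lborel. x \<in> D \<longrightarrow> P (x, y)"
        using elim by eventually_elim (use sub y in auto)
      then show "AE x in lebesgue_on D. P (x, y)"
        using D_lebesgue by (subst AE_restrict_space_iff) (auto simp: AE_completion_iff)
    qed
  qed
  then show ?thesis
    using \<Gamma>_lebesgue by (subst AE_restrict_space_iff) (auto simp: AE_completion_iff)
qed

lemma borel_version:
  fixes w :: "'a \<times> 'b \<Rightarrow> real"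
  assumes w: "w \<in> borel_measurable (lebesgue_on (D \<times> \<Gamma>))"
  shows "\<exists>w'. w' \<in> borel_measurable borel \<and>
     (AE y in lebesgue_on \<Gamma>. AE x in lebesgue_on D. w (x, y) = w' (x, y))"
proof -
  have "(\<lambda>z. if z \<in> D \<times> \<Gamma> then w z else 0) \<in> borel_measurable lebesgue"
    using w D_Times_\<Gamma> by (subst borel_measurable_if) auto
  then obtain w' where w': "w' \<in> borel_measurable lborel"
    and ae: "AE z in lborel. (if z \<in> D \<times> \<Gamma> then w z else 0) = w' z"
    using completion_ex_borel_measurable_real by blast
  have "AE z in lebesgue. z \<in> D \<times> \<Gamma> \<longrightarrow> w z = w' z"
    using AE_completion[OF ae] by (elim eventually_mono) auto
  then have "AE z in lebesgue_on (D \<times> \<Gamma>). w z = w' z"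
    using D_Times_\<Gamma> by (subst AE_restrict_space_iff) auto
  from AE_slices[OF this] w' show ?thesis by auto
qed

lemma lebesgue_on_D_integral:
  assumes "h \<in> borel_measurable borel"
  shows "(LINT x|lebesgue_on D. h x) = (LINT x|lborel. indicator D x * (h x :: real))"
    and "(\<integral>\<^sup>+x. ennreal (h x) \<partial>lebesgue_on D) = (\<integral>\<^sup>+x. ennreal (h x) * indicator D x \<partial>lborel)"
proof -
  have "(LINT x|lebesgue_on D. h x) = (LINT x|lebesgue. indicator D x *\<^sub>R h x)"
    using D_lebesgue by (subst integral_restrict_space) auto
  also have "\<dots> = (LINT x|lborel. indicator D x * h x)"
    using D assms by (subst integral_completion) auto
  finally show "(LINT x|lebesgue_on D. h x) = (LINT x|lborel. indicator D x * h x)" .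
  show "(\<integral>\<^sup>+x. ennreal (h x) \<partial>lebesgue_on D) = (\<integral>\<^sup>+x. ennreal (h x) * indicator D x \<partial>lborel)"
    using D_lebesgue by (subst nn_integral_restrict_space) (auto simp: nn_integral_completion)
qed

end

text \<open>Both forms are instances: \<open>w\<close> is the coefficient \<open>a\<close> with
  \<open>q\<close> a product of gradients, or \<open>w\<close> is the load \<open>f\<close> with
  \<open>q\<close> a finite element function.\<close>

locale weighted_integral = product_domain D \<Gamma>
  for D :: "'a::euclidean_space set" and \<Gamma> :: "'b::euclidean_space set" +
  fixes p :: "'b \<Rightarrow> real" and w :: "'a \<times> 'b \<Rightarrow> real"
  assumes p_pos: "\<And>y. y \<in> \<Gamma> \<Longrightarrow> 0 < p y" and p_measurable: "p \<in> borel_measurable (lebesgue_on \<Gamma>)"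
    and w: "w \<in> borel_measurable (lebesgue_on (D \<times> \<Gamma>))"
    and w_finite:
      "(\<integral>\<^sup>+y. ennreal (p y) * (\<integral>\<^sup>+x. ennreal \<bar>w (x, y)\<bar> \<partial>lebesgue_on D) \<partial>lebesgue_on \<Gamma>) < \<infinity>"
begin

definition weighted :: "('a \<times> 'b \<Rightarrow> real) \<Rightarrow> real" where
  "weighted q = (LINT y|lebesgue_on \<Gamma>. p y * (LINT x|lebesgue_on D. w (x, y) * q (x, y)))"

text \<open>After passing to Borel versions, the inner integral is at most the bound of
  \<open>q'\<close> times that of the absolute value of \<open>w\<close>, whose
  \<open>p\<close>-weighted integral is finite.\<close>

lemma weighted_slices:
  assumes "bounded_version D q q'"
  shows "AE y in lebesgue_on \<Gamma>. integrable (lebesgue_on D) (\<lambda>x. w (x, y) * q (x, y))"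
    and "integrable (lebesgue_on \<Gamma>) (\<lambda>y. p y * (LINT x|lebesgue_on D. w (x, y) * q (x, y)))"
proof -
  obtain w' where mw[measurable]: "w' \<in> borel_measurable borel"
    and ae: "AE y in lebesgue_on \<Gamma>. AE x in lebesgue_on D. w (x, y) = w' (x, y)"
    using borel_version[OF w] by blast
  have mq[measurable]: "q' \<in> borel_measurable borel" and "bounded (range q')"
    and q': "\<And>y. AE x in lebesgue_on D. q (x, y) = q' (x, y)"
    using assms by (auto simp: bounded_version_def)
  then obtain B where B: "\<And>z. \<bar>q' z\<bar> \<le> B" by (auto simp: bounded_iff)
  have B0: "0 \<le> B" using B[of undefined] by linarith
  note D[measurable]
  define W where "W y = (\<integral>\<^sup>+x. ennreal \<bar>w' (x, y)\<bar> \<partial>lebesgue_on D)" for y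
  have slice[measurable]: "(\<lambda>x. w' (x, y)) \<in> borel_measurable borel"
    "(\<lambda>x. q' (x, y)) \<in> borel_measurable borel" for y
    by measurable
  have leb: "h \<in> borel_measurable (lebesgue_on D)" if "h \<in> borel_measurable borel" for h :: "'a \<Rightarrow> real"
    using that by (intro measurable_restrict_space1 measurable_completion) simp
  have mW: "W \<in> borel_measurable (lebesgue_on \<Gamma>)"
  proof -
    have "W = (\<lambda>y. \<integral>\<^sup>+x. ennreal \<bar>w' (x, y)\<bar> * indicator D x \<partial>lborel)"
      unfolding W_def by (intro ext lebesgue_on_D_integral) simp
    also have "\<dots> \<in> borel_measurable borel"
      by measurable
    finally show ?thesis
      by (intro measurable_restrict_space1 measurable_completion) simp
  qed
  have W_eq: "AE y in lebesgue_on \<Gamma>. (\<integral>\<^sup>+x. ennreal \<bar>w (x, y)\<bar> \<partial>lebesgue_on D) = W y"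
    using ae unfolding W_def
    by eventually_elim (auto intro!: nn_integral_cong_AE elim: eventually_mono)
  have "(\<integral>\<^sup>+y. ennreal (p y) * W y \<partial>lebesgue_on \<Gamma>)
      = (\<integral>\<^sup>+y. ennreal (p y) * (\<integral>\<^sup>+x. ennreal \<bar>w (x, y)\<bar> \<partial>lebesgue_on D) \<partial>lebesgue_on \<Gamma>)"
    using W_eq by (intro nn_integral_cong_AE) (auto elim: eventually_mono)
  then have fin: "(\<integral>\<^sup>+y. ennreal (p y) * W y \<partial>lebesgue_on \<Gamma>) < \<infinity>" using w_finite by simp
  \<comment> \<open>Finiteness of the weighted integral controls \<open>p y * W y\<close> only;
    positivity of \<open>p\<close> turns this into finiteness of \<open>W y\<close>.\<close>
  have "AE y in lebesgue_on \<Gamma>. ennreal (p y) * W y \<noteq> \<infinity>"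
    using fin mW p_measurable by (intro nn_integral_PInf_AE) auto
  moreover have "AE y in lebesgue_on \<Gamma>. y \<in> \<Gamma>" by (rule AE_I2) simp
  ultimately have "AE y in lebesgue_on \<Gamma>. W y < \<infinity>"
    by eventually_elim (use p_pos in \<open>force simp: ennreal_mult_eq_top_iff less_top\<close>)
  then have int': "AE y in lebesgue_on \<Gamma>. integrable (lebesgue_on D) (\<lambda>x. w' (x, y) * q' (x, y))"
  proof eventually_elim
    case (elim y)
    have "integrable (lebesgue_on D) (\<lambda>x. w' (x, y))"
      using elim leb[OF slice(1)] by (intro integrableI_bounded) (auto simp: W_def)
    then have "integrable (lebesgue_on D) (\<lambda>x. w' (x, y) * B)" by simp
    then show ?case
    proof (rule Bochner_Integration.integrable_bound)
      show "(\<lambda>x. w' (x, y) * q' (x, y)) \<in> borel_measurable (lebesgue_on D)" by (intro leb) measurable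
      show "AE x in lebesgue_on D. norm (w' (x, y) * q' (x, y)) \<le> norm (w' (x, y) * B)"
        using B B0 by (intro AE_I2) (simp add: abs_mult mult_left_mono)
    qed
  qed
  have prod_ae: "AE y in lebesgue_on \<Gamma>. AE x in lebesgue_on D. w (x, y) * q (x, y) = w' (x, y) * q' (x, y)"
    using ae
  proof eventually_elim
    case (elim y)
    show ?case using elim q'[of y] by eventually_elim simp
  qed
  have prod_meas: "(\<lambda>x. w' (x, y) * q' (x, y)) \<in> borel_measurable (lebesgue_on D)" for y
    by (intro leb) measurable
  show "AE y in lebesgue_on \<Gamma>. integrable (lebesgue_on D) (\<lambda>x. w (x, y) * q (x, y))"
    using int' prod_ae
  proof eventually_elim
    case (elim y)
    then show ?case
      using borel_measurable_lebesgue_on_cong_AE[OF D_lebesgue prod_meas elim(2)] prod_meas[of y]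
      by (subst integrable_cong_AE) auto
  qed
  define I where "I y = (LINT x|lebesgue_on D. w' (x, y) * q' (x, y))" for y
  have mI: "I \<in> borel_measurable (lebesgue_on \<Gamma>)"
  proof -
    have "I = (\<lambda>y. LINT x|lborel. indicator D x * (w' (x, y) * q' (x, y)))"
      unfolding I_def by (intro ext lebesgue_on_D_integral) simp
    also have "\<dots> \<in> borel_measurable borel"
      by measurable
    finally show ?thesis
      by (intro measurable_restrict_space1 measurable_completion) simp
  qed
  have "integrable (lebesgue_on \<Gamma>) (\<lambda>y. p y * I y)"
  proof (rule integrableI_bounded)
    show "(\<lambda>y. p y * I y) \<in> borel_measurable (lebesgue_on \<Gamma>)" using p_measurable mI by simp
    have "(\<integral>\<^sup>+y. ennreal (norm (p y * I y)) \<partial>lebesgue_on \<Gamma>)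
        \<le> (\<integral>\<^sup>+y. ennreal B * (ennreal (p y) * W y) \<partial>lebesgue_on \<Gamma>)"
    proof (rule nn_integral_mono_AE)
      show "AE y in lebesgue_on \<Gamma>. ennreal (norm (p y * I y)) \<le> ennreal B * (ennreal (p y) * W y)"
        using int' \<open>AE y in lebesgue_on \<Gamma>. y \<in> \<Gamma>\<close>
      proof eventually_elim
        case (elim y)
        have "ennreal (norm (I y)) \<le> (\<integral>\<^sup>+x. ennreal (norm (w' (x, y) * q' (x, y))) \<partial>lebesgue_on D)"
          unfolding I_def using elim(1) by (rule integral_norm_bound_ennreal)
        also have "\<dots> \<le> (\<integral>\<^sup>+x. ennreal B * ennreal \<bar>w' (x, y)\<bar> \<partial>lebesgue_on D)"
          using B B0 by (intro nn_integral_mono)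
            (auto simp: abs_mult mult.commute[of B] intro!: mult_left_mono simp flip: ennreal_mult)
        also have "\<dots> = ennreal B * W y"
          unfolding W_def using leb[OF slice(1), of y] by (subst nn_integral_cmult) auto
        finally have "ennreal (norm (I y)) \<le> ennreal B * W y" .
        then have "ennreal (p y) * ennreal (norm (I y)) \<le> ennreal (p y) * (ennreal B * W y)"
          by (rule mult_left_mono) simp
        moreover have "ennreal (norm (p y * I y)) = ennreal (p y) * ennreal (norm (I y))"
          using p_pos[OF elim(2)] by (simp add: abs_mult ennreal_mult)
        ultimately show ?case by (simp add: mult.left_commute)
      qed
    qed
    also have "\<dots> = ennreal B * (\<integral>\<^sup>+y. ennreal (p y) * W y \<partial>lebesgue_on \<Gamma>)"
      using mW p_measurable by (intro nn_integral_cmult) auto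
    also have "\<dots> < \<infinity>" using fin by (simp add: ennreal_mult_less_top)
    finally show "(\<integral>\<^sup>+y. ennreal (norm (p y * I y)) \<partial>lebesgue_on \<Gamma>) < \<infinity>" .
  qed
  moreover have "AE y in lebesgue_on \<Gamma>.
      p y * (LINT x|lebesgue_on D. w (x, y) * q (x, y)) = p y * I y"
    using prod_ae
  proof eventually_elim
    case (elim y)
    then show ?case
      using integral_lebesgue_on_cong_AE[OF D_lebesgue prod_meas elim] by (simp add: I_def)
  qed
  moreover have "(\<lambda>y. p y * I y) \<in> borel_measurable (lebesgue_on \<Gamma>)" using p_measurable mI by simp
  ultimately show "integrable (lebesgue_on \<Gamma>) (\<lambda>y. p y * (LINT x|lebesgue_on D. w (x, y) * q (x, y)))"
    using borel_measurable_lebesgue_on_cong_AE[OF \<Gamma>_lebesgue]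
    by (subst integrable_cong_AE) auto
qed

text \<open>The hypothesis on \<open>q\<close> is stated through versions because for gradients the
  linear relation holds only almost everywhere in \<open>x\<close>.\<close>

lemma weighted_lincomb:
  assumes q1: "bounded_version D q1 q1'" and q2: "bounded_version D q2 q2'"
    and q: "bounded_version D q (\<lambda>z. s * q1' z + t * q2' z)"
  shows "weighted q = s * weighted q1 + t * weighted q2"
proof -
  note int = weighted_slices[OF q1] weighted_slices[OF q2] weighted_slices[OF q]
  have qq: "AE x in lebesgue_on D. q (x, y) = s * q1 (x, y) + t * q2 (x, y)" for y
  proof -
    have "AE x in lebesgue_on D. q1 (x, y) = q1' (x, y)" "AE x in lebesgue_on D. q2 (x, y) = q2' (x, y)"
      "AE x in lebesgue_on D. q (x, y) = s * q1' (x, y) + t * q2' (x, y)"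
      using q1 q2 q by (auto simp: bounded_version_def)
    then show ?thesis by eventually_elim simp
  qed
  have "AE y in lebesgue_on \<Gamma>. (LINT x|lebesgue_on D. w (x, y) * q (x, y)) =
      s * (LINT x|lebesgue_on D. w (x, y) * q1 (x, y)) + t * (LINT x|lebesgue_on D. w (x, y) * q2 (x, y))"
    using int(1,3,5)
  proof eventually_elim
    case (elim y)
    have "(LINT x|lebesgue_on D. w (x, y) * q (x, y)) =
        (LINT x|lebesgue_on D. s * (w (x, y) * q1 (x, y)) + t * (w (x, y) * q2 (x, y)))"
      using elim qq[of y]
      by (intro integral_cong_AE) (auto elim!: eventually_mono simp: algebra_simps)
    also have "\<dots> = s * (LINT x|lebesgue_on D. w (x, y) * q1 (x, y)) + t * (LINT x|lebesgue_on D. w (x, y) * q2 (x, y))"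
      using elim by simp
    finally show ?case .
  qed
  then have "weighted q = (LINT y|lebesgue_on \<Gamma>. s * (p y * (LINT x|lebesgue_on D. w (x, y) * q1 (x, y)))
      + t * (p y * (LINT x|lebesgue_on D. w (x, y) * q2 (x, y))))"
    unfolding weighted_def using int(2,4,6)
    by (intro integral_cong_AE) (auto elim!: eventually_mono simp: algebra_simps)
  also have "\<dots> = s * weighted q1 + t * weighted q2"
    unfolding weighted_def using int(2,4) by simp
  finally show ?thesis .
qed

text \<open>A nonnegative function with zero integral vanishes almost everywhere. This is applied to
  the outer integral, where \<open>p\<close> is positive, and then to the inner one, where
  \<open>w\<close> is positive.\<close>

lemma weighted_nonneg:
  assumes q: "bounded_version D q q'" and q0: "\<And>z. 0 \<le> q z"
    and w_pos: "AE z in lebesgue_on (D \<times> \<Gamma>). 0 < w z"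
  shows "0 \<le> weighted q"
    and "weighted q = 0 \<Longrightarrow> AE y in lebesgue_on \<Gamma>. AE x in lebesgue_on D. q (x, y) = 0"
proof -
  note int = weighted_slices[OF q]
  have pos: "AE y in lebesgue_on \<Gamma>. AE x in lebesgue_on D. 0 < w (x, y)"
    using w_pos by (rule AE_slices)
  have in_\<Gamma>: "AE y in lebesgue_on \<Gamma>. y \<in> \<Gamma>" by (rule AE_I2) simp
  have nonneg: "AE y in lebesgue_on \<Gamma>. 0 \<le> p y * (LINT x|lebesgue_on D. w (x, y) * q (x, y))"
    using pos in_\<Gamma>
  proof eventually_elim
    case (elim y)
    have "AE x in lebesgue_on D. 0 \<le> w (x, y) * q (x, y)"
      using elim(1) by eventually_elim (simp add: q0)
    then show ?case using p_pos[OF elim(2)] by (simp add: integral_nonneg_AE)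
  qed
  then show "0 \<le> weighted q" unfolding weighted_def by (rule integral_nonneg_AE)
  assume "weighted q = 0"
  then have "AE y in lebesgue_on \<Gamma>. p y * (LINT x|lebesgue_on D. w (x, y) * q (x, y)) = 0"
    unfolding weighted_def using integral_nonneg_eq_0_iff_AE[OF int(2) nonneg] by simp
  then show "AE y in lebesgue_on \<Gamma>. AE x in lebesgue_on D. q (x, y) = 0"
    using int(1) pos in_\<Gamma>
  proof eventually_elim
    case (elim y)
    have "(LINT x|lebesgue_on D. w (x, y) * q (x, y)) = 0" using elim(1) p_pos[OF elim(4)] by simp
    moreover have "AE x in lebesgue_on D. 0 \<le> w (x, y) * q (x, y)"
      using elim(3) by eventually_elim (simp add: q0)
    ultimately have "AE x in lebesgue_on D. w (x, y) * q (x, y) = 0"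
      using integral_nonneg_eq_0_iff_AE[OF elim(2)] by simp
    with elim(3) show ?case by eventually_elim simp
  qed
qed

end

section \<open>The tensor product finite element space\<close>

lemma bounded_box_convex:
  assumes "bounded_box \<Gamma>"
  shows "convex \<Gamma>"
proof -
  obtain I where "\<forall>k. is_interval (I k) \<and> bounded (I k)" and \<Gamma>: "\<Gamma> = {y. \<forall>k. y $ k \<in> I k}"
    using assms unfolding bounded_box_def by blast
  then have I: "is_interval (I k)" for k by blast
  show ?thesis
  proof (rule convexI)
    fix x y :: "real^'a" and s t :: real
    assume "x \<in> \<Gamma>" "y \<in> \<Gamma>" and st: "0 \<le> s" "0 \<le> t" "s + t = 1"
    then have "s * x $ k + t * y $ k \<in> I k" for k
      using convexD[OF is_interval_convex[OF I[of k]], of "x $ k" "y $ k" s t] by (simp add: \<Gamma>)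
    then show "s *\<^sub>R x + t *\<^sub>R y \<in> \<Gamma>" by (simp add: \<Gamma>)
  qed
qed

lemma bounded_box_bounded:
  assumes "bounded_box \<Gamma>"
  shows "bounded \<Gamma>"
proof -
  obtain I where "\<forall>k. is_interval (I k) \<and> bounded (I k)" and \<Gamma>: "\<Gamma> = {y. \<forall>k. y $ k \<in> I k}"
    using assms unfolding bounded_box_def by blast
  then have I: "bounded (I k)" for k by blast
  have "\<exists>B. \<forall>t\<in>I k. \<bar>t\<bar> \<le> B" for k using I[of k] by (simp add: bounded_iff)
  then obtain B where B: "\<And>k t. t \<in> I k \<Longrightarrow> \<bar>t\<bar> \<le> B k" by metis
  have "norm y \<le> (\<Sum>k\<in>UNIV. B k)" if "y \<in> \<Gamma>" for y
    using that B by (intro order_trans[OF norm_le_l1_cart] sum_mono) (auto simp: \<Gamma>)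
  then show ?thesis by (auto simp: bounded_iff)
qed

lemma bounded_box_borel:
  assumes "bounded_box \<Gamma>"
  shows "\<Gamma> \<in> sets borel"
proof -
  obtain I where "\<forall>k. is_interval (I k) \<and> bounded (I k)" and \<Gamma>: "\<Gamma> = {y. \<forall>k. y $ k \<in> I k}"
    using assms unfolding bounded_box_def by blast
  then have I: "is_interval (I k)" for k by blast
  have "(\<lambda>y. y $ k) -` I k \<in> sets borel" for k
  proof -
    have "(\<lambda>y :: real^'a. y $ k) \<in> borel_measurable borel"
      by (intro borel_measurable_continuous_onI continuous_intros)
    from measurable_sets[OF this real_interval_borel_measurable[OF I]] show ?thesis by simp
  qed
  then have "(\<Inter>k\<in>UNIV. (\<lambda>y. y $ k) -` I k) \<in> sets borel"
    by (intro sets.finite_INT) auto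
  also have "(\<Inter>k\<in>UNIV. (\<lambda>y. y $ k) -` I k) = \<Gamma>" by (auto simp: \<Gamma>)
  finally show ?thesis .
qed

text \<open>An affine function of one variable with two zeros vanishes. The induction frees one
  coordinate at a time, the set \<open>F\<close> holding those no longer tied to the
  endpoints.\<close>

lemma multilinear_eq_0:
  fixes a b y :: "real^'m" and c :: "'m set \<Rightarrow> real"
  assumes ab: "\<And>k. a $ k < b $ k"
    and corners: "\<And>y. (\<And>k. y $ k \<in> {a $ k, b $ k}) \<Longrightarrow> (\<Sum>S\<in>UNIV. c S * (\<Prod>k\<in>S. y $ k)) = 0"
  shows "(\<Sum>S\<in>UNIV. c S * (\<Prod>k\<in>S. y $ k)) = 0"
proof -
  define q where "q y = (\<Sum>S\<in>UNIV. c S * (\<Prod>k\<in>S. y $ k))" for y :: "real^'m"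
  have "q y = 0" if "finite F" "\<And>k. k \<notin> F \<Longrightarrow> y $ k \<in> {a $ k, b $ k}" for F y
    using that
  proof (induction F arbitrary: y rule: finite_induct)
    case empty
    then show ?case using corners[of y] by (simp add: q_def)
  next
    case (insert j F)
    define r where "r t = (\<chi> k. if k = j then t else y $ k)" for t
    \<comment> \<open>The monomials are sorted by whether they contain the variable
      \<open>j\<close>; this gives the constant and the slope in that variable.\<close>
    define \<alpha> where "\<alpha> = (\<Sum>S\<in>UNIV. if j \<in> S then 0 else c S * (\<Prod>k\<in>S. y $ k))"
    define \<beta> where "\<beta> = (\<Sum>S\<in>UNIV. if j \<in> S then c S * (\<Prod>k\<in>S - {j}. y $ k) else 0)"
    have q_r: "q (r t) = \<alpha> + \<beta> * t" for t
    proof -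
      have "c S * (\<Prod>k\<in>S. r t $ k) =
          (if j \<in> S then 0 else c S * (\<Prod>k\<in>S. y $ k)) +
          (if j \<in> S then c S * (\<Prod>k\<in>S - {j}. y $ k) else 0) * t" for S
      proof (cases "j \<in> S")
        case True
        have "(\<Prod>k\<in>S. r t $ k) = r t $ j * (\<Prod>k\<in>S - {j}. r t $ k)"
          using True by (intro prod.remove) auto
        also have "(\<Prod>k\<in>S - {j}. r t $ k) = (\<Prod>k\<in>S - {j}. y $ k)"
          by (intro prod.cong) (auto simp: r_def)
        finally show ?thesis using True by (simp add: r_def)
      next
        case False
        then have "(\<Prod>k\<in>S. r t $ k) = (\<Prod>k\<in>S. y $ k)"
          by (intro prod.cong) (auto simp: r_def)
        with False show ?thesis by simp
      qed
      then show ?thesis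
        by (simp add: q_def \<alpha>_def \<beta>_def sum.distrib sum_distrib_right)
    qed
    have "q (r t) = 0" if "t \<in> {a $ j, b $ j}" for t
      using that insert.prems by (intro insert.IH) (auto simp: r_def)
    then have "\<alpha> + \<beta> * a $ j = 0" "\<alpha> + \<beta> * b $ j = 0" by (simp_all flip: q_r)
    then have "\<beta> * b $ j = \<beta> * a $ j" by linarith
    then have "\<beta> = 0" using ab[of j] by auto
    then have "\<alpha> = 0" using \<open>\<alpha> + \<beta> * a $ j = 0\<close> by simp
    have "r (y $ j) = y" by (simp add: r_def vec_eq_iff)
    then show ?case using q_r[of "y $ j"] \<open>\<alpha> = 0\<close> \<open>\<beta> = 0\<close> by simp
  qed
  from this[of UNIV y] show ?thesis by (simp add: q_def)
qed

locale parameter_grid =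
  fixes \<Gamma> :: "(real^'m) set" and \<B> :: "(real^'m) set set"
  assumes box: "bounded_box \<Gamma>" and grid: "tensor_grid \<B> \<Gamma>"
begin

lemma division: "\<B> division_of closure \<Gamma>"
  using grid by (simp add: tensor_grid_def)

lemmas finite_\<B> = division_ofD(1)[OF division] and Union_\<B> = division_ofD(6)[OF division]

lemma finite_grid_vertices: "finite (mesh_vertices \<B>)"
proof -
  have "finite {v. v extreme_point_of B}" if "B \<in> \<B>" for B
  proof -
    obtain a b where "B = cbox a b" using division_ofD(4)[OF division \<open>B \<in> \<B>\<close>] by blast
    then show ?thesis by (simp add: finite_polyhedron_extreme_points)
  qed
  then have "finite (\<Union>B\<in>\<B>. {v. v extreme_point_of B})" using finite_\<B> by blast
  moreover have "mesh_vertices \<B> = (\<Union>B\<in>\<B>. {v. v extreme_point_of B})"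
    by (auto simp: mesh_vertices_def)
  ultimately show ?thesis by simp
qed

lemma Y_s_lincomb:
  assumes u: "u \<in> Y_s \<Gamma> \<B>" and v: "v \<in> Y_s \<Gamma> \<B>"
  shows "(\<lambda>y. s * u y + t * v y) \<in> Y_s \<Gamma> \<B>"
proof -
  have "\<exists>c :: 'm set \<Rightarrow> real. \<forall>y\<in>B. s * u y + t * v y = (\<Sum>S\<in>UNIV. c S * (\<Prod>k\<in>S. y $ k))"
    if "B \<in> \<B>" for B
  proof -
    have "\<exists>c. \<forall>y\<in>B. u y = (\<Sum>S\<in>UNIV. c S * (\<Prod>k\<in>S. y $ k))"
      "\<exists>c. \<forall>y\<in>B. v y = (\<Sum>S\<in>UNIV. c S * (\<Prod>k\<in>S. y $ k))"
      using u v that by (simp_all add: Y_s_def)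
    then obtain c d where c: "\<forall>y\<in>B. u y = (\<Sum>S\<in>UNIV. c S * (\<Prod>k\<in>S. y $ k))"
      and d: "\<forall>y\<in>B. v y = (\<Sum>S\<in>UNIV. d S * (\<Prod>k\<in>S. y $ k))" by blast
    have "\<forall>y\<in>B. s * u y + t * v y = (\<Sum>S\<in>UNIV. (s * c S + t * d S) * (\<Prod>k\<in>S. y $ k))"
    proof
      fix y assume y: "y \<in> B"
      show "s * u y + t * v y = (\<Sum>S\<in>UNIV. (s * c S + t * d S) * (\<Prod>k\<in>S. y $ k))"
        unfolding c[rule_format, OF y] d[rule_format, OF y]
        by (simp add: sum_distrib_left sum.distrib[symmetric] distrib_right mult.assoc)
    qed
    then show ?thesis by (rule exI[of _ "\<lambda>S. s * c S + t * d S"])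
  qed
  then show ?thesis using u v by (auto simp: Y_s_def intro!: continuous_intros)
qed

lemma function_subspace_Y_s: "function_subspace (Y_s \<Gamma> \<B>)"
proof -
  have "(\<lambda>_. 0) \<in> Y_s \<Gamma> \<B>"
    by (auto simp: Y_s_def intro!: exI[of _ "\<lambda>_. 0"])
  then show ?thesis using Y_s_lincomb by (simp add: function_subspace_def)
qed

lemma Y_s_one: "indicator (closure \<Gamma>) \<in> Y_s \<Gamma> \<B>"
proof -
  have one: "(\<Sum>S\<in>UNIV. (if S = {} then 1 else 0) * (\<Prod>k\<in>S. y $ k)) = (1 :: real)" for y :: "real^'m"
  proof -
    have "(\<Sum>S\<in>UNIV. (if S = {} then 1 else 0) * (\<Prod>k\<in>S. y $ k)) = (\<Sum>S\<in>(UNIV :: 'm set set). if S = {} then 1 else (0 :: real))"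
      by (intro sum.cong) auto
    then show ?thesis by simp
  qed
  have "indicator (closure \<Gamma>) y = (1 :: real)" if "B \<in> \<B>" "y \<in> B" for B y
    using that Union_\<B> by (auto simp: indicator_def)
  moreover have "continuous_on (closure \<Gamma>) (indicator (closure \<Gamma>) :: real^'m \<Rightarrow> real)"
    by (rule continuous_on_eq[OF continuous_on_const[of _ 1]]) simp
  ultimately show ?thesis
    unfolding Y_s_def using one[symmetric]
    by (intro CollectI conjI ballI exI[of _ "\<lambda>S. if S = {} then 1 else 0"]) auto
qed

lemma Y_s_bounded_borel:
  assumes "w \<in> Y_s \<Gamma> \<B>"
  shows "w \<in> borel_measurable borel" and "bounded (range w)"
proof -
  have cont: "continuous_on (closure \<Gamma>) w" and w0: "\<And>y. y \<notin> closure \<Gamma> \<Longrightarrow> w y = 0"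
    using assms by (auto simp: Y_s_def)
  have "(\<lambda>y. indicator (closure \<Gamma>) y *\<^sub>R w y) \<in> borel_measurable borel"
    using cont by (intro borel_measurable_continuous_on_indicator) auto
  also have "(\<lambda>y. indicator (closure \<Gamma>) y *\<^sub>R w y) = w"
    using w0 by (auto simp: indicator_def fun_eq_iff)
  finally show "w \<in> borel_measurable borel" .
  have "compact (closure \<Gamma>)" using bounded_box_bounded[OF box] by simp
  then have "bounded (insert 0 (w ` closure \<Gamma>))"
    using cont by (simp add: compact_imp_bounded compact_continuous_image)
  then show "bounded (range w)"
    by (rule bounded_subset) (use w0 in auto)
qed

lemma Y_s_determined:
  "\<exists>Z. finite Z \<and> (\<forall>w\<in>Y_s \<Gamma> \<B>. (\<forall>y\<in>Z. w y = 0) \<longrightarrow> w = (\<lambda>_. 0))"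
proof -
  obtain G :: "'m \<Rightarrow> real set" where fG: "\<And>k. finite (G k)"
    and \<B>: "\<B> = {cbox a b | a b. \<forall>k. consecutive (G k) (a $ k) (b $ k)}"
    using grid by (auto simp: tensor_grid_def)
  \<comment> \<open>All points of the product grid; they include every corner of every box, which is
    all that \<open>multilinear_eq_0\<close> asks for.\<close>
  define Z where "Z = {y :: real^'m. \<forall>k. y $ k \<in> G k}"
  have "finite Z"
  proof -
    have "Z \<subseteq> vec_lambda ` (Pi\<^sub>E UNIV G)"
      by (force simp: Z_def PiE_def extensional_def image_iff intro!: exI[of _ "vec_nth _"])
    then show ?thesis by (rule finite_subset) (intro finite_imageI finite_PiE fG finite)
  qed
  moreover have "w = (\<lambda>_. 0)" if w: "w \<in> Y_s \<Gamma> \<B>" and 0: "\<And>y. y \<in> Z \<Longrightarrow> w y = 0" for w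
  proof
    fix y
    show "w y = 0"
    proof (cases "y \<in> closure \<Gamma>")
      case True
      then obtain B where B: "B \<in> \<B>" "y \<in> B" using Union_\<B> by blast
      then obtain a b where ab: "B = cbox a b" "\<And>k. consecutive (G k) (a $ k) (b $ k)"
        unfolding \<B> by blast
      have "\<exists>c. \<forall>y\<in>B. w y = (\<Sum>S\<in>UNIV. c S * (\<Prod>k\<in>S. y $ k))"
        using w B(1) by (simp add: Y_s_def)
      then obtain c where c: "\<And>y. y \<in> B \<Longrightarrow> w y = (\<Sum>S\<in>UNIV. c S * (\<Prod>k\<in>S. y $ k))" by blast
      have less: "a $ k < b $ k" for k using ab(2)[of k] by (simp add: consecutive_def)
      have "(\<Sum>S\<in>UNIV. c S * (\<Prod>k\<in>S. z $ k)) = 0" if z: "\<And>k. z $ k \<in> {a $ k, b $ k}" for z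
      proof -
        have "a $ k \<le> z $ k \<and> z $ k \<le> b $ k" "z $ k \<in> G k" for k
          using z[of k] less[of k] ab(2)[of k] by (auto simp: consecutive_def)
        then have "z \<in> B" "z \<in> Z" by (auto simp: ab(1) mem_box_cart Z_def)
        then show ?thesis using c[of z] 0[of z] by simp
      qed
      then have "(\<Sum>S\<in>UNIV. c S * (\<Prod>k\<in>S. y $ k)) = 0" by (rule multilinear_eq_0[OF less])
      then show ?thesis using c[OF B(2)] by simp
    next
      case False
      then show ?thesis using w by (simp add: Y_s_def)
    qed
  qed
  ultimately show ?thesis by blast
qed

text \<open>The set where \<open>w\<close> is nonzero is relatively open in
  \<open>closure \<Gamma>\<close>. For a convex set with interior points, the closure is that of the
  interior, so a nonempty such set contains a nonempty open part of \<Gamma>, which has positive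
  measure.\<close>

lemma Y_s_eq_0_of_AE:
  assumes w: "w \<in> Y_s \<Gamma> \<B>" and int: "interior \<Gamma> \<noteq> {}" and ae: "AE y in lebesgue_on \<Gamma>. w y = 0"
  shows "w = (\<lambda>_. 0)"
proof (rule ccontr)
  assume "w \<noteq> (\<lambda>_. 0)"
  then obtain y where y: "w y \<noteq> 0" by auto
  have cont: "continuous_on (closure \<Gamma>) w" and "\<And>y. y \<notin> closure \<Gamma> \<Longrightarrow> w y = 0"
    using w by (auto simp: Y_s_def)
  then have ycl: "y \<in> closure \<Gamma>" using y by blast
  have "openin (top_of_set (closure \<Gamma>)) (closure \<Gamma> \<inter> w -` (- {0}))"
    using cont by (rule continuous_openin_preimage_gen) auto
  then obtain U where U: "open U" "closure \<Gamma> \<inter> w -` (- {0}) = closure \<Gamma> \<inter> U"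
    by (auto simp: openin_open)
  have "closure \<Gamma> = closure (interior \<Gamma>)"
    using convex_closure_interior[OF bounded_box_convex[OF box] int] by simp
  moreover have "y \<in> U" using U y ycl by auto
  ultimately have "U \<inter> interior \<Gamma> \<noteq> {}"
    using ycl U(1) open_Int_closure_eq_empty[of U "interior \<Gamma>"] by auto
  moreover have "open (U \<inter> interior \<Gamma>)" using U(1) by auto
  ultimately have "\<not> negligible (U \<inter> interior \<Gamma>)" by (rule open_not_negligible[rotated])
  moreover have "AE y in lebesgue. y \<notin> U \<inter> interior \<Gamma>"
  proof -
    have "AE y in lebesgue. y \<in> \<Gamma> \<longrightarrow> w y = 0"
      using ae bounded_box_borel[OF box] by (subst (asm) AE_restrict_space_iff) auto
    then show ?thesis
    proof eventually_elim
      case (elim z)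
      then show ?case
        using U(2) interior_subset[of \<Gamma>] closure_subset[of \<Gamma>] by auto
    qed
  qed
  then have "U \<inter> interior \<Gamma> \<in> null_sets lebesgue"
    using \<open>open (U \<inter> interior \<Gamma>)\<close> by (subst (asm) AE_iff_null_sets[symmetric]) auto
  ultimately show False by (simp add: negligible_iff_null_sets)
qed

end

text \<open>A convex set without interior points is null, and no density on it can integrate to
  1.\<close>

lemma positive_density_interior:
  assumes "bounded_box \<Gamma>" and p: "positive_density \<Gamma> p"
  shows "interior \<Gamma> \<noteq> {}"
proof
  assume "interior \<Gamma> = {}"
  then have "negligible \<Gamma>"
    using negligible_convex_interior[OF bounded_box_convex[OF assms(1)]] by simp
  then have "AE y in lebesgue. y \<notin> \<Gamma>"
    by (intro AE_not_in) (simp add: negligible_iff_null_sets)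
  then have "AE y in lebesgue_on \<Gamma>. p y = 0"
    using bounded_box_borel[OF assms(1)]
    by (subst AE_restrict_space_iff) (auto elim: eventually_mono)
  then have "(LINT y|lebesgue_on \<Gamma>. p y) = 0" by (rule integral_eq_zero_AE)
  moreover have "(LINT y|lebesgue_on \<Gamma>. p y) = 1"
    using p unfolding positive_density_def by (metis has_bochner_integral_integral_eq)
  ultimately show False by simp
qed

section \<open>The tensor product space, its slices and its gradients\<close>

lemma mem_tensor_space_iff:
  "u \<in> tensor_space X Y \<longleftrightarrow>
     (\<exists>(n::nat) \<phi> \<psi>. (\<forall>i<n. \<phi> i \<in> X \<and> \<psi> i \<in> Y) \<and> u = (\<lambda>z. \<Sum>i<n. \<phi> i (fst z) * \<psi> i (snd z)))"
  by (auto simp: tensor_space_def case_prod_beta')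

lemma function_subspace_tensor_space:
  assumes X: "function_subspace X"
  shows "function_subspace (tensor_space X Y)"
proof -
  have zero: "(\<lambda>_. 0) \<in> tensor_space X Y"
    unfolding mem_tensor_space_iff by (rule exI[of _ 0]) simp
  have add1: "(\<lambda>z. u z + \<phi> (fst z) * \<psi> (snd z)) \<in> tensor_space X Y"
    if u: "u \<in> tensor_space X Y" and \<phi>: "\<phi> \<in> X" "\<psi> \<in> Y" for u \<phi> \<psi>
  proof -
    obtain n a c where n: "\<forall>i<(n::nat). a i \<in> X \<and> c i \<in> Y" "u = (\<lambda>z. \<Sum>i<n. a i (fst z) * c i (snd z))"
      using u unfolding mem_tensor_space_iff by blast
    have "(\<lambda>z. u z + \<phi> (fst z) * \<psi> (snd z)) =
        (\<lambda>z. \<Sum>i<Suc n. (a(n := \<phi>)) i (fst z) * (c(n := \<psi>)) i (snd z))"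
      by (auto simp: n(2) fun_eq_iff)
    moreover have "\<forall>i<Suc n. (a(n := \<phi>)) i \<in> X \<and> (c(n := \<psi>)) i \<in> Y"
      using n(1) \<phi> by (auto simp: less_Suc_eq)
    ultimately show ?thesis
      unfolding mem_tensor_space_iff
      by (intro exI[of _ "Suc n"] exI[of _ "a(n := \<phi>)"] exI[of _ "c(n := \<psi>)"] conjI)
  qed
  have add: "(\<lambda>z. u z + (\<Sum>i<n. s * a i (fst z) * c i (snd z))) \<in> tensor_space X Y"
    if u: "u \<in> tensor_space X Y" and ac: "\<And>i. i < n \<Longrightarrow> a i \<in> X \<and> c i \<in> Y" for u and n :: nat and a c and s :: real
    using ac
  proof (induction n)
    case 0
    then show ?case using u by simp
  next
    case (Suc n)
    have "(\<lambda>x. s * a n x) \<in> X"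
      using function_subspaceD(2)[OF X, of "a n" "a n" s 0] Suc.prems by simp
    then show ?case
      using add1[OF Suc.IH, of "\<lambda>x. s * a n x" "c n"] Suc.prems by (simp add: add.assoc)
  qed
  have "(\<lambda>z. s * u z + t * v z) \<in> tensor_space X Y"
    if uv: "u \<in> tensor_space X Y" "v \<in> tensor_space X Y" for u v s t
  proof -
    obtain n a c where n: "\<forall>i<(n::nat). a i \<in> X \<and> c i \<in> Y" "u = (\<lambda>z. \<Sum>i<n. a i (fst z) * c i (snd z))"
      using uv(1) unfolding mem_tensor_space_iff by blast
    obtain m a' c' where m: "\<forall>i<(m::nat). a' i \<in> X \<and> c' i \<in> Y" "v = (\<lambda>z. \<Sum>i<m. a' i (fst z) * c' i (snd z))"
      using uv(2) unfolding mem_tensor_space_iff by blast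
    have "(\<lambda>z. (0 + (\<Sum>i<n. s * a i (fst z) * c i (snd z))) + (\<Sum>i<m. t * a' i (fst z) * c' i (snd z)))
        \<in> tensor_space X Y"
      using n(1) m(1) by (intro add zero) auto
    also have "(\<lambda>z. (0 + (\<Sum>i<n. s * a i (fst z) * c i (snd z))) + (\<Sum>i<m. t * a' i (fst z) * c' i (snd z)))
        = (\<lambda>z. s * u z + t * v z)"
      by (auto simp: n(2) m(2) fun_eq_iff sum_distrib_left mult.assoc)
    finally show ?thesis .
  qed
  with zero show ?thesis by (simp add: function_subspace_def)
qed

locale fe_space = triangulated_domain D \<T> + parameter_grid \<Gamma> \<B>
  for D \<T> and \<Gamma> :: "(real^'m) set" and \<B>
begin

lemma function_subspace_X_h: "function_subspace (X_h D \<T>)"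
proof -
  have "(\<lambda>_. 0) \<in> X_h D \<T>" by (auto simp: X_h_def intro!: exI[of _ 0])
  then show ?thesis using X_h_lincomb by (simp add: function_subspace_def)
qed

lemma function_subspace_W: "function_subspace (W_hs D \<T> \<Gamma> \<B>)"
  unfolding W_hs_def by (rule function_subspace_tensor_space[OF function_subspace_X_h])

lemma W_expansion:
  assumes "u \<in> W_hs D \<T> \<Gamma> \<B>"
  obtains n \<phi> \<psi> where "\<forall>x y. u (x, y) = (\<Sum>i<(n::nat). \<phi> i x * \<psi> i y)"
    "\<forall>i<n. \<phi> i \<in> X_h D \<T>" "\<forall>i<n. \<psi> i \<in> Y_s \<Gamma> \<B>"
proof -
  obtain n \<phi> \<psi> where "\<forall>i<(n::nat). \<phi> i \<in> X_h D \<T> \<and> \<psi> i \<in> Y_s \<Gamma> \<B>"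
    "u = (\<lambda>z. \<Sum>i<n. \<phi> i (fst z) * \<psi> i (snd z))"
    using assms unfolding W_hs_def mem_tensor_space_iff by blast
  then show ?thesis by (intro that[where n = n and \<phi> = \<phi> and \<psi> = \<psi>]) auto
qed

lemma W_section_x:
  assumes "u \<in> W_hs D \<T> \<Gamma> \<B>"
  shows "(\<lambda>x. u (x, y)) \<in> X_h D \<T>"
proof -
  obtain n \<phi> \<psi> where u: "\<forall>x y. u (x, y) = (\<Sum>i<(n::nat). \<phi> i x * \<psi> i y)"
    "\<forall>i<n. \<phi> i \<in> X_h D \<T>" "\<forall>i<n. \<psi> i \<in> Y_s \<Gamma> \<B>"
    using W_expansion[OF assms] .
  have "(\<lambda>x. \<Sum>i<n. \<psi> i y * \<phi> i x) \<in> X_h D \<T>"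
    by (rule function_subspace_sum[OF function_subspace_X_h]) (use u(2) in simp)
  then show ?thesis by (simp add: u(1) mult.commute)
qed

lemma W_section_y:
  assumes "u \<in> W_hs D \<T> \<Gamma> \<B>"
  shows "(\<lambda>y. u (x, y)) \<in> Y_s \<Gamma> \<B>"
proof -
  obtain n \<phi> \<psi> where u: "\<forall>x y. u (x, y) = (\<Sum>i<(n::nat). \<phi> i x * \<psi> i y)"
    "\<forall>i<n. \<phi> i \<in> X_h D \<T>" "\<forall>i<n. \<psi> i \<in> Y_s \<Gamma> \<B>"
    using W_expansion[OF assms] .
  have "(\<lambda>y. \<Sum>i<n. \<phi> i x * \<psi> i y) \<in> Y_s \<Gamma> \<B>"
    by (rule function_subspace_sum[OF function_subspace_Y_s]) (use u(3) in simp)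
  then show ?thesis by (simp add: u(1))
qed

text \<open>Zeros on a product of determining sets propagate one factor at a time: first to all
  \<open>x\<close> for the finitely many \<open>y\<close>, then to all \<open>y\<close> for each
  \<open>x\<close>.\<close>

lemma W_determined:
  "\<exists>Z. finite Z \<and> (\<forall>u\<in>W_hs D \<T> \<Gamma> \<B>. (\<forall>z\<in>Z. u z = 0) \<longrightarrow> u = (\<lambda>_. 0))"
proof -
  obtain Z where Z: "finite Z" "\<And>w. w \<in> Y_s \<Gamma> \<B> \<Longrightarrow> \<forall>y\<in>Z. w y = 0 \<Longrightarrow> w = (\<lambda>_. 0)"
    using Y_s_determined by blast
  have "u = (\<lambda>_. 0)" if u: "u \<in> W_hs D \<T> \<Gamma> \<B>" and 0: "\<forall>z\<in>mesh_vertices \<T> \<times> Z. u z = 0" for u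
  proof -
    have "(\<lambda>x. u (x, y)) = (\<lambda>_. 0)" if "y \<in> Z" for y
      using W_section_x[OF u] by (rule X_h_eq_0_of_vertices) (use 0 that in auto)
    then have "u (x, y) = 0" if "y \<in> Z" for x y using that by (meson fun_cong)
    then have "(\<lambda>y. u (x, y)) = (\<lambda>_. 0)" for x
      using Z(2)[OF W_section_y[OF u]] by simp
    then have "u (x, y) = 0" for x y by (meson fun_cong)
    then show ?thesis by auto
  qed
  then show ?thesis using Z(1) finite_mesh_vertices by (intro exI[of _ "mesh_vertices \<T> \<times> Z"]) auto
qed

lemma weak_gradient_spec: "v \<in> X_h D \<T> \<Longrightarrow> has_weak_gradient D v (weak_gradient D v)"
  unfolding weak_gradient_def using X_h_weak_gradient by (metis someI_ex)

lemma weak_gradient_eq: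
  "v \<in> X_h D \<T> \<Longrightarrow> has_weak_gradient D v G \<Longrightarrow> AE x in lebesgue_on D. weak_gradient D v x = G x"
  using weak_gradient_unique[OF open_D weak_gradient_spec] .

lemma X_h_eq_0_of_weak_gradient:
  assumes v: "v \<in> X_h D \<T>" and ae: "AE x in lebesgue_on D. weak_gradient D v x = 0"
  shows "v = (\<lambda>_. 0)"
proof -
  obtain G where G: "has_weak_gradient D v G" "(AE x in lebesgue_on D. G x = 0) \<longrightarrow> v = (\<lambda>_. 0)"
    using X_h_weak_gradient[OF v] by blast
  have "AE x in lebesgue_on D. G x = 0"
    using weak_gradient_eq[OF v G(1)] ae by eventually_elim simp
  with G(2) show ?thesis by blast
qed

definition x_gradient :: "((real^2) \<times> (real^'m) \<Rightarrow> real) \<Rightarrow> (real^2) \<times> (real^'m) \<Rightarrow> real^2" where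
  "x_gradient u = (\<lambda>(x, y). weak_gradient D (\<lambda>x. u (x, y)) x)"

text \<open>With \<open>G i\<close> the concrete gradient of the \<open>i\<close>-th spatial factor,
  the sum of \<open>\<psi> i y *\<^sub>R G i x\<close> is jointly Borel and bounded. It is a weak
  gradient of every slice, so by uniqueness it agrees with the chosen one almost everywhere in
  \<open>x\<close>.\<close>

lemma W_bounded_version:
  assumes "u \<in> W_hs D \<T> \<Gamma> \<B>"
  shows "bounded_version D u u" and "\<exists>H. bounded_version D (x_gradient u) H"
proof -
  obtain n \<phi> \<psi> where exp: "\<forall>x y. u (x, y) = (\<Sum>i<(n::nat). \<phi> i x * \<psi> i y)"
    "\<forall>i<n. \<phi> i \<in> X_h D \<T>" "\<forall>i<n. \<psi> i \<in> Y_s \<Gamma> \<B>"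
    using W_expansion[OF assms] .
  note u = exp(1)[rule_format] and \<phi> = exp(2)[rule_format] and \<psi> = exp(3)[rule_format]
  note \<psi>_meas = Y_s_bounded_borel(1)[OF \<psi>]
  have "\<exists>B. \<forall>y. \<bar>\<psi> i y\<bar> \<le> B" if "i < n" for i
    using Y_s_bounded_borel(2)[OF \<psi>[OF that]] by (auto simp: bounded_iff)
  then obtain B where B: "\<And>i y. i < n \<Longrightarrow> \<bar>\<psi> i y\<bar> \<le> B i" by metis
  \<comment> \<open>Stated for a general family \<open>F\<close> because it is used for the
    functions themselves and for their vector-valued gradients.\<close>
  have sum_version: "(\<lambda>z. \<Sum>i<n. \<psi> i (snd z) *\<^sub>R F i (fst z)) \<in> borel_measurable borel
      \<and> bounded (range (\<lambda>z. \<Sum>i<n. \<psi> i (snd z) *\<^sub>R F i (fst z)))"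
    if F: "\<And>i. i < n \<Longrightarrow> F i \<in> borel_measurable borel" "\<And>i. i < n \<Longrightarrow> bounded (range (F i))"
    for F :: "nat \<Rightarrow> real^2 \<Rightarrow> 'c::euclidean_space"
  proof
    have "(\<lambda>z. \<psi> i (snd z) *\<^sub>R F i (fst z)) \<in> borel_measurable borel" if "i < n" for i
    proof -
      have "fst \<in> borel_measurable (borel :: ((real^2) \<times> (real^'m)) measure)"
        "snd \<in> borel_measurable (borel :: ((real^2) \<times> (real^'m)) measure)"
        by (auto intro!: borel_measurable_continuous_onI continuous_intros)
      then show ?thesis
        using measurable_compose[OF _ \<psi>_meas[OF that]] measurable_compose[OF _ F(1)[OF that]]
        by (intro borel_measurable_scaleR) auto
    qed
    then show "(\<lambda>z. \<Sum>i<n. \<psi> i (snd z) *\<^sub>R F i (fst z)) \<in> borel_measurable borel"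
      by (intro borel_measurable_sum) auto
    have "\<exists>C. \<forall>x. norm (F i x) \<le> C" if "i < n" for i
      using F(2)[OF that] by (auto simp: bounded_iff)
    then obtain C where C: "\<And>i x. i < n \<Longrightarrow> norm (F i x) \<le> C i" by metis
    have "norm (\<Sum>i<n. \<psi> i (snd z) *\<^sub>R F i (fst z)) \<le> (\<Sum>i<n. B i * C i)" for z
    proof (rule order_trans[OF norm_sum sum_mono])
      fix i assume "i \<in> {..<n}"
      then have i: "i < n" by simp
      have "0 \<le> B i" using B[OF i, of undefined] by linarith
      then show "norm (\<psi> i (snd z) *\<^sub>R F i (fst z)) \<le> B i * C i"
        using B[OF i] C[OF i] by (simp add: mult_mono)
    qed
    then show "bounded (range (\<lambda>z. \<Sum>i<n. \<psi> i (snd z) *\<^sub>R F i (fst z)))"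
      unfolding bounded_iff by blast
  qed
  have "\<phi> i \<in> borel_measurable borel" "bounded (range (\<phi> i))" if i: "i < n" for i
  proof -
    obtain L where L: "L-lipschitz_on UNIV (\<phi> i)" using X_h_lipschitz[OF \<phi>[OF i]] by blast
    have cont: "continuous_on UNIV (\<phi> i)" using lipschitz_on_continuous_on[OF L] .
    then show "\<phi> i \<in> borel_measurable borel" by (rule borel_measurable_continuous_onI)
    have "compact (closure D)" using bounded_D by simp
    then have "bounded (insert 0 (\<phi> i ` closure D))"
      using compact_continuous_image[OF continuous_on_subset[OF cont subset_UNIV]]
      by (simp add: compact_imp_bounded)
    then show "bounded (range (\<phi> i))"
      by (rule bounded_subset) (use \<phi>[OF i] closure_subset[of D] in \<open>auto simp: X_h_def\<close>)
  qed
  from sum_version[of \<phi>, OF this]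
  have "(\<lambda>z. \<Sum>i<n. \<psi> i (snd z) *\<^sub>R \<phi> i (fst z)) \<in> borel_measurable borel
      \<and> bounded (range (\<lambda>z. \<Sum>i<n. \<psi> i (snd z) *\<^sub>R \<phi> i (fst z)))" .
  moreover have "(\<lambda>z. \<Sum>i<n. \<psi> i (snd z) *\<^sub>R \<phi> i (fst z)) = u"
    by (auto simp: u fun_eq_iff mult.commute)
  ultimately have "u \<in> borel_measurable borel \<and> bounded (range u)" by (simp only:)
  then show "bounded_version D u u" by (simp add: bounded_version_def)
  have "\<exists>G. G \<in> borel_measurable borel \<and> bounded (range G) \<and> has_weak_gradient D (\<phi> i) G" if "i < n" for i
    using X_h_weak_gradient[OF \<phi>[OF that]] by blast
  then obtain G where G: "\<And>i. i < n \<Longrightarrow> G i \<in> borel_measurable borel"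
    "\<And>i. i < n \<Longrightarrow> bounded (range (G i))" "\<And>i. i < n \<Longrightarrow> has_weak_gradient D (\<phi> i) (G i)"
    by metis
  define H where "H z = (\<Sum>i<n. \<psi> i (snd z) *\<^sub>R G i (fst z))" for z
  have grad: "has_weak_gradient D (\<lambda>x. \<Sum>i<m. \<psi> i y * \<phi> i x) (\<lambda>x. \<Sum>i<m. \<psi> i y *\<^sub>R G i x)"
    if "m \<le> n" for m y
    using that
  proof (induction m)
    case 0
    then show ?case by (simp add: has_weak_gradient_def locally_integrable_def)
  next
    case (Suc m)
    then show ?case
      using has_weak_gradient_lincomb[OF open_D Suc.IH G(3)[of m], of 1 "\<psi> m y"] by simp
  qed
  have "AE x in lebesgue_on D. x_gradient u (x, y) = H (x, y)" for y
    using weak_gradient_eq[OF W_section_x[OF assms], of y "\<lambda>x. H (x, y)"] grad[of n y]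
    by (simp add: x_gradient_def H_def u mult.commute)
  then have "bounded_version D (x_gradient u) H"
    using sum_version[OF G(1,2)] by (simp add: bounded_version_def H_def[abs_def])
  then show "\<exists>H. bounded_version D (x_gradient u) H" by (rule exI[of _ H])
qed

text \<open>The choice of a weak gradient is not linear; linearity is recovered almost everywhere
  from uniqueness.\<close>

lemma x_gradient_lincomb:
  assumes u: "u \<in> W_hs D \<T> \<Gamma> \<B>" and v: "v \<in> W_hs D \<T> \<Gamma> \<B>"
  shows "AE x in lebesgue_on D.
    x_gradient (\<lambda>z. s * u z + t * v z) (x, y) = s *\<^sub>R x_gradient u (x, y) + t *\<^sub>R x_gradient v (x, y)"
proof -
  note X = W_section_x[OF u, of y] W_section_x[OF v, of y]
  have "has_weak_gradient D (\<lambda>x. s * u (x, y) + t * v (x, y))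
      (\<lambda>x. s *\<^sub>R x_gradient u (x, y) + t *\<^sub>R x_gradient v (x, y))"
    unfolding x_gradient_def prod.case
    by (intro has_weak_gradient_lincomb[OF open_D] weak_gradient_spec X)
  from weak_gradient_eq[OF X_h_lincomb[OF X] this] show ?thesis
    by (simp add: x_gradient_def)
qed

lemma x_gradient_inner_bounded_version:
  assumes "bounded_version D (x_gradient u) H" "bounded_version D (x_gradient v) H'"
  shows "bounded_version D (\<lambda>z. x_gradient u z \<bullet> x_gradient v z) (\<lambda>z. H z \<bullet> H' z)"
proof -
  have H: "H \<in> borel_measurable borel" "H' \<in> borel_measurable borel"
    "bounded (range H)" "bounded (range H')"
    "\<And>y. AE x in lebesgue_on D. x_gradient u (x, y) = H (x, y)"
    "\<And>y. AE x in lebesgue_on D. x_gradient v (x, y) = H' (x, y)"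
    using assms by (auto simp: bounded_version_def)
  obtain B B' where B: "\<And>z. norm (H z) \<le> B" "\<And>z. norm (H' z) \<le> B'"
    using H(3,4) unfolding bounded_iff by (metis rangeI)
  have "\<bar>H z \<bullet> H' z\<bar> \<le> B * B'" for z
  proof -
    have "\<bar>H z \<bullet> H' z\<bar> \<le> norm (H z) * norm (H' z)" by (rule Cauchy_Schwarz_ineq2)
    also have "\<dots> \<le> B * B'"
      using B[of z] order_trans[OF norm_ge_zero B(1)] by (intro mult_mono) auto
    finally show ?thesis .
  qed
  then have "bounded (range (\<lambda>z. H z \<bullet> H' z))" by (auto simp: bounded_iff)
  moreover have "AE x in lebesgue_on D. x_gradient u (x, y) \<bullet> x_gradient v (x, y) = H (x, y) \<bullet> H' (x, y)" for y
    using H(5)[of y] H(6)[of y] by eventually_elim simp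
  ultimately show ?thesis using H(1,2) by (simp add: bounded_version_def)
qed

lemma K_nonempty: "K_hs D \<T> \<Gamma> \<B> g \<noteq> {}"
proof -
  obtain \<phi> where \<phi>: "\<phi> \<in> X_h D \<T>" "\<And>x. x \<in> mesh_vertices \<T> \<inter> D \<Longrightarrow> \<phi> x = 1"
    using X_h_interior_nodes_one by blast
  define N where "N = (mesh_vertices \<T> \<inter> D) \<times> mesh_vertices \<B>"
  have "finite N" unfolding N_def using finite_mesh_vertices finite_grid_vertices by auto
  \<comment> \<open>\<open>g\<close> is an arbitrary function, but only its values at finitely many
    nodes count, and the sum of their absolute values dominates each of them.\<close>
  define M where "M = (\<Sum>z\<in>N. \<bar>g z\<bar>)"
  have M: "g z \<le> M" if "z \<in> N" for z
  proof -
    have "\<bar>g z\<bar> \<le> M" unfolding M_def using \<open>finite N\<close> that by (intro member_le_sum) auto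
    then show ?thesis by linarith
  qed
  define v :: "(real^2) \<times> (real^'m) \<Rightarrow> real" where
    "v = (\<lambda>z. (M * \<phi> (fst z)) * indicator (closure \<Gamma>) (snd z))"
  have "(\<lambda>x. M * \<phi> x) \<in> X_h D \<T>" using X_h_lincomb[OF \<phi>(1) \<phi>(1), of M 0] by simp
  then have "v \<in> W_hs D \<T> \<Gamma> \<B>"
    unfolding W_hs_def mem_tensor_space_iff v_def using Y_s_one
    by (intro exI[of _ "1::nat"] exI[of _ "\<lambda>_ x. M * \<phi> x"] exI[of _ "\<lambda>_. indicator (closure \<Gamma>)"])
      auto
  moreover have "g (x, y) \<le> v (x, y)" if xy: "x \<in> mesh_vertices \<T> \<inter> D" "y \<in> mesh_vertices \<B>" for x y
  proof -
    have "y \<in> closure \<Gamma>"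
      using xy(2) Union_\<B> by (auto simp: mesh_vertices_def extreme_point_of_def)
    then show ?thesis using M[of "(x, y)"] xy \<phi>(2)[OF xy(1)] by (simp add: v_def N_def)
  qed
  ultimately show ?thesis by (auto simp: K_hs_def)
qed

end

section \<open>Existence and uniqueness\<close>

lemma (in product_domain) weighted_integral_of_bounded:
  fixes w :: "'a \<times> 'b \<Rightarrow> real"
  assumes bD: "bounded D" and p_pos: "\<And>y. y \<in> \<Gamma> \<Longrightarrow> 0 < p y" and p: "integrable (lebesgue_on \<Gamma>) p"
    and w: "w \<in> borel_measurable (lebesgue_on (D \<times> \<Gamma>))"
    and bound: "AE z in lebesgue_on (D \<times> \<Gamma>). \<bar>w z\<bar> \<le> B"
  shows "weighted_integral D \<Gamma> p w"
proof
  have p_meas: "p \<in> borel_measurable (lebesgue_on \<Gamma>)" using p by simp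
  have fin: "emeasure lebesgue D < \<infinity>"
    using emeasure_bounded_finite[OF bD] D by simp
  have "(\<integral>\<^sup>+y. ennreal (p y) * (\<integral>\<^sup>+x. ennreal \<bar>w (x, y)\<bar> \<partial>lebesgue_on D) \<partial>lebesgue_on \<Gamma>)
      \<le> (\<integral>\<^sup>+y. ennreal (p y) * (ennreal B * emeasure lebesgue D) \<partial>lebesgue_on \<Gamma>)"
  proof (rule nn_integral_mono_AE)
    show "AE y in lebesgue_on \<Gamma>. ennreal (p y) * (\<integral>\<^sup>+x. ennreal \<bar>w (x, y)\<bar> \<partial>lebesgue_on D)
        \<le> ennreal (p y) * (ennreal B * emeasure lebesgue D)"
      using AE_slices[OF bound]
    proof eventually_elim
      case (elim y)
      have "(\<integral>\<^sup>+x. ennreal \<bar>w (x, y)\<bar> \<partial>lebesgue_on D) \<le> (\<integral>\<^sup>+x. ennreal B \<partial>lebesgue_on D)"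
        using elim by (intro nn_integral_mono_AE) (auto elim!: eventually_mono intro: ennreal_leI)
      also have "\<dots> = ennreal B * emeasure lebesgue D"
        using D_lebesgue by (simp add: emeasure_restrict_space)
      finally show ?case by (rule mult_left_mono) simp
    qed
  qed
  also have "\<dots> = (\<integral>\<^sup>+y. ennreal (p y) \<partial>lebesgue_on \<Gamma>) * (ennreal B * emeasure lebesgue D)"
    using p_meas by (intro nn_integral_multc) auto
  also have "\<dots> < \<infinity>"
  proof -
    have "(\<integral>\<^sup>+y. ennreal (p y) \<partial>lebesgue_on \<Gamma>) \<le> (\<integral>\<^sup>+y. ennreal (norm (p y)) \<partial>lebesgue_on \<Gamma>)"
      by (intro nn_integral_mono) (auto intro: ennreal_leI)
    also have "\<dots> < \<infinity>" using p by (simp add: integrable_iff_bounded)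
    finally show ?thesis using fin by (simp add: ennreal_mult_less_top)
  qed
  finally show "(\<integral>\<^sup>+y. ennreal (p y) * (\<integral>\<^sup>+x. ennreal \<bar>w (x, y)\<bar> \<partial>lebesgue_on D) \<partial>lebesgue_on \<Gamma>) < \<infinity>" .
qed (use p_pos p w in auto)

text \<open>\<open>L2p_L2\<close> embeds into the weighted \<open>L1\<close> space because \<open>\<bar>t\<bar> \<le> 1 + t\<^sup>2\<close> and \<open>D\<close> has finite area.\<close>

lemma weighted_integral_of_L2:
  fixes \<Gamma> :: "(real^'m) set"
  assumes D_borel: "D \<in> sets borel" and bounded_D: "bounded D" and \<Gamma>_borel: "\<Gamma> \<in> sets borel"
    and p_pos: "\<And>y. y \<in> \<Gamma> \<Longrightarrow> 0 < p y" and p: "integrable (lebesgue_on \<Gamma>) p"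
    and f: "f \<in> L2p_L2 D \<Gamma> p"
  shows "weighted_integral D \<Gamma> p f"
proof -
  interpret product_domain D \<Gamma> using D_borel \<Gamma>_borel by unfold_locales
  have mf: "f \<in> borel_measurable (lebesgue_on (D \<times> \<Gamma>))"
    and L2: "(\<integral>\<^sup>+y. ennreal (p y) * (\<integral>\<^sup>+x. ennreal ((f (x, y))\<^sup>2) \<partial>lebesgue_on D) \<partial>lebesgue_on \<Gamma>) < \<infinity>"
    using f by (auto simp: L2p_L2_def)
  \<comment> \<open>The constant weight 1 yields finiteness of the term that comes from the summand
    1 in the elementary inequality.\<close>
  interpret one: weighted_integral D \<Gamma> p "\<lambda>_. 1"
    by (rule weighted_integral_of_bounded[OF bounded_D p_pos p, of _ 1]) auto
  obtain f' where f'[measurable]: "f' \<in> borel_measurable borel"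
    and ae: "AE y in lebesgue_on \<Gamma>. AE x in lebesgue_on D. f (x, y) = f' (x, y)"
    using borel_version[OF mf] by blast
  define A where "A = (\<integral>\<^sup>+x. ennreal \<bar>1::real\<bar> \<partial>lebesgue_on D)"
  define Q where "Q y = (\<integral>\<^sup>+x. ennreal ((f' (x, y))\<^sup>2) \<partial>lebesgue_on D)" for y
  have mQ: "Q \<in> borel_measurable (lebesgue_on \<Gamma>)"
  proof -
    note D[measurable]
    have "Q = (\<lambda>y. \<integral>\<^sup>+x. ennreal ((f' (x, y))\<^sup>2) * indicator D x \<partial>lborel)"
      unfolding Q_def by (intro ext lebesgue_on_D_integral) simp
    also have "\<dots> \<in> borel_measurable borel" by measurable
    finally show ?thesis
      by (intro measurable_restrict_space1 measurable_completion) simp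
  qed
  have mp: "p \<in> borel_measurable (lebesgue_on \<Gamma>)" using p by simp
  have "(\<integral>\<^sup>+y. ennreal (p y) * (\<integral>\<^sup>+x. ennreal \<bar>f (x, y)\<bar> \<partial>lebesgue_on D) \<partial>lebesgue_on \<Gamma>)
      \<le> (\<integral>\<^sup>+y. ennreal (p y) * A + ennreal (p y) * Q y \<partial>lebesgue_on \<Gamma>)"
  proof (rule nn_integral_mono_AE)
    show "AE y in lebesgue_on \<Gamma>. ennreal (p y) * (\<integral>\<^sup>+x. ennreal \<bar>f (x, y)\<bar> \<partial>lebesgue_on D)
        \<le> ennreal (p y) * A + ennreal (p y) * Q y"
      using ae
    proof eventually_elim
      case (elim y)
      have "(\<integral>\<^sup>+x. ennreal \<bar>f (x, y)\<bar> \<partial>lebesgue_on D) \<le> (\<integral>\<^sup>+x. ennreal \<bar>1::real\<bar> + ennreal ((f' (x, y))\<^sup>2) \<partial>lebesgue_on D)"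
      proof (rule nn_integral_mono_AE)
        show "AE x in lebesgue_on D. ennreal \<bar>f (x, y)\<bar> \<le> ennreal \<bar>1::real\<bar> + ennreal ((f' (x, y))\<^sup>2)"
          using elim
        proof eventually_elim
          case (elim x)
          have "\<bar>t\<bar> \<le> 1 + t\<^sup>2" for t :: real
          proof -
            have "0 \<le> (\<bar>t\<bar> - 1)\<^sup>2" by simp
            then have "2 * \<bar>t\<bar> \<le> 1 + t\<^sup>2" by (simp add: power2_diff)
            then show ?thesis by linarith
          qed
          then show ?case
            unfolding elim by (simp flip: ennreal_plus ennreal_1 add: ennreal_leI)
        qed
      qed
      also have "\<dots> = A + Q y"
        unfolding A_def Q_def
      proof (rule nn_integral_add)
        have "(\<lambda>x. ennreal ((f' (x, y))\<^sup>2)) \<in> borel_measurable borel" by measurable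
        then show "(\<lambda>x. ennreal ((f' (x, y))\<^sup>2)) \<in> borel_measurable (lebesgue_on D)"
          by (intro measurable_restrict_space1 measurable_completion) simp
      qed simp
      finally have "ennreal (p y) * (\<integral>\<^sup>+x. ennreal \<bar>f (x, y)\<bar> \<partial>lebesgue_on D) \<le> ennreal (p y) * (A + Q y)"
        by (rule mult_left_mono) simp
      then show ?case by (simp add: distrib_left)
    qed
  qed
  also have "\<dots> = (\<integral>\<^sup>+y. ennreal (p y) * A \<partial>lebesgue_on \<Gamma>) + (\<integral>\<^sup>+y. ennreal (p y) * Q y \<partial>lebesgue_on \<Gamma>)"
    using mp mQ by (intro nn_integral_add) auto
  also have "(\<integral>\<^sup>+y. ennreal (p y) * Q y \<partial>lebesgue_on \<Gamma>)
      = (\<integral>\<^sup>+y. ennreal (p y) * (\<integral>\<^sup>+x. ennreal ((f (x, y))\<^sup>2) \<partial>lebesgue_on D) \<partial>lebesgue_on \<Gamma>)"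
  proof (rule nn_integral_cong_AE)
    show "AE y in lebesgue_on \<Gamma>. ennreal (p y) * Q y =
        ennreal (p y) * (\<integral>\<^sup>+x. ennreal ((f (x, y))\<^sup>2) \<partial>lebesgue_on D)"
      using ae
    proof eventually_elim
      case (elim y)
      have "Q y = (\<integral>\<^sup>+x. ennreal ((f (x, y))\<^sup>2) \<partial>lebesgue_on D)"
        unfolding Q_def using elim by (intro nn_integral_cong_AE) (auto elim: eventually_mono)
      then show ?case by simp
    qed
  qed
  also have "(\<integral>\<^sup>+y. ennreal (p y) * A \<partial>lebesgue_on \<Gamma>) + \<dots> < \<infinity>"
    using one.w_finite L2 by (simp add: A_def)
  finally show ?thesis using p_pos mp mf by unfold_locales auto
qed

theorem theorem4p1:
  fixes D :: "(real^2) set" and \<T> :: "(real^2) set set"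
    and \<Gamma> :: "(real^'m) set" and \<B> :: "(real^'m) set set"
    and p :: "real^'m \<Rightarrow> real"
    and a f g :: "(real^2) \<times> (real^'m) \<Rightarrow> real"
    and a_min a_max :: real
  assumes "polygonal_domain D"
    and "bounded_box \<Gamma>"
    and "positive_density \<Gamma> p"
    and "a \<in> borel_measurable (lebesgue_on (D \<times> \<Gamma>))"
    and "0 < a_min" and "a_min \<le> a_max"
    and "AE z in lebesgue_on (D \<times> \<Gamma>). a_min \<le> a z \<and> a z \<le> a_max"
    and "f \<in> L2p_L2 D \<Gamma> p"
    and "triangulates \<T> D"
    and "tensor_grid \<B> \<Gamma>"
  shows "\<exists>!u. u \<in> K_hs D \<T> \<Gamma> \<B> g \<and>
           (\<forall>v\<in>K_hs D \<T> \<Gamma> \<B> g.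
              b_form D \<Gamma> p a u (\<lambda>z. v z - u z) \<ge> l_form D \<Gamma> p f (\<lambda>z. v z - u z))"
proof -
  interpret fe_space D \<T> \<Gamma> \<B>
    using assms(1,2,9,10) by unfold_locales
  let ?W = "W_hs D \<T> \<Gamma> \<B>" and ?K = "K_hs D \<T> \<Gamma> \<B> g"
  have p_pos: "\<And>y. y \<in> \<Gamma> \<Longrightarrow> 0 < p y" and p_int: "integrable (lebesgue_on \<Gamma>) p"
    using assms(3) by (auto simp: positive_density_def has_bochner_integral_iff)
  have D_borel: "D \<in> sets borel" using open_D by simp
  have \<Gamma>_borel: "\<Gamma> \<in> sets borel" by (rule bounded_box_borel[OF box])
  interpret product_domain D \<Gamma> using D_borel \<Gamma>_borel by unfold_locales
  have a_bound: "AE z in lebesgue_on (D \<times> \<Gamma>). \<bar>a z\<bar> \<le> a_max"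
    using assms(7) by (rule eventually_mono) (use assms(5) in auto)
  have a_pos: "AE z in lebesgue_on (D \<times> \<Gamma>). 0 < a z"
    using assms(7) by (rule eventually_mono) (use assms(5) in auto)
  interpret A: weighted_integral D \<Gamma> p a
    by (rule weighted_integral_of_bounded[OF bounded_D p_pos p_int assms(4) a_bound])
  interpret F: weighted_integral D \<Gamma> p f
    by (rule weighted_integral_of_L2[OF D_borel bounded_D \<Gamma>_borel p_pos p_int assms(8)])
  have b_eq: "b_form D \<Gamma> p a u v = A.weighted (\<lambda>z. x_gradient u z \<bullet> x_gradient v z)" for u v
    by (simp add: b_form_def A.weighted_def x_gradient_def)
  have l_eq: "l_form D \<Gamma> p f v = F.weighted v" for v
    by (simp add: l_form_def F.weighted_def)
  have inner: "function_inner_space ?W (b_form D \<Gamma> p a)"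
  proof
    show "function_subspace ?W" by (rule function_subspace_W)
    show "b_form D \<Gamma> p a u v = b_form D \<Gamma> p a v u" for u v
      by (simp add: b_eq inner_commute)
    show "b_form D \<Gamma> p a (\<lambda>z. s * u z + t * v z) w = s * b_form D \<Gamma> p a u w + t * b_form D \<Gamma> p a v w"
      if u: "u \<in> ?W" and v: "v \<in> ?W" and w: "w \<in> ?W" for u v w s t
    proof -
      obtain U V Y where U: "bounded_version D (x_gradient u) U"
        and V: "bounded_version D (x_gradient v) V" and Y: "bounded_version D (x_gradient w) Y"
        using W_bounded_version(2)[OF u] W_bounded_version(2)[OF v] W_bounded_version(2)[OF w] by blast
      note UY = x_gradient_inner_bounded_version[OF U Y] and VY = x_gradient_inner_bounded_version[OF V Y]
      let ?q = "\<lambda>z. x_gradient (\<lambda>z. s * u z + t * v z) z \<bullet> x_gradient w z"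
      let ?q' = "\<lambda>z. s * (U z \<bullet> Y z) + t * (V z \<bullet> Y z)"
      have "bounded_version D ?q ?q'"
        unfolding bounded_version_def
      proof (intro conjI allI)
        show "?q' \<in> borel_measurable borel"
          using UY VY unfolding bounded_version_def
          by (intro borel_measurable_add borel_measurable_times borel_measurable_const) auto
        have "bounded ((\<lambda>x. s *\<^sub>R x) ` range (\<lambda>z. U z \<bullet> Y z))" "bounded ((\<lambda>x. t *\<^sub>R x) ` range (\<lambda>z. V z \<bullet> Y z))"
          by (intro bounded_scaling, use UY VY in \<open>simp add: bounded_version_def\<close>)+
        from bounded_plus[OF this] show "bounded (range ?q')"
          by (rule bounded_subset) (auto intro!: image_eqI)
        show "AE x in lebesgue_on D. ?q (x, y) = ?q' (x, y)" for y
        proof -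
          have "AE x in lebesgue_on D. x_gradient u (x, y) = U (x, y)"
            "AE x in lebesgue_on D. x_gradient v (x, y) = V (x, y)"
            "AE x in lebesgue_on D. x_gradient w (x, y) = Y (x, y)"
            using U V Y by (auto simp: bounded_version_def)
          with x_gradient_lincomb[OF u v, of s t y] show ?thesis
            by eventually_elim (simp add: inner_add_left)
        qed
      qed
      from A.weighted_lincomb[OF UY VY this] show ?thesis by (simp add: b_eq)
    qed
    fix u assume u: "u \<in> ?W"
    obtain U where "bounded_version D (x_gradient u) U" using W_bounded_version(2)[OF u] by blast
    note UU = x_gradient_inner_bounded_version[OF this this]
    show "0 \<le> b_form D \<Gamma> p a u u"
      unfolding b_eq by (rule A.weighted_nonneg(1)[OF UU _ a_pos]) simp
    assume "b_form D \<Gamma> p a u u = 0"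
    then have "AE y in lebesgue_on \<Gamma>. AE x in lebesgue_on D. x_gradient u (x, y) \<bullet> x_gradient u (x, y) = 0"
      unfolding b_eq by (intro A.weighted_nonneg(2)[OF UU _ a_pos]) auto
    then have ae: "AE y in lebesgue_on \<Gamma>. (\<lambda>x. u (x, y)) = (\<lambda>_. 0)"
    proof eventually_elim
      case (elim y)
      then have "AE x in lebesgue_on D. weak_gradient D (\<lambda>x. u (x, y)) x = 0"
        by (simp add: x_gradient_def)
      then show ?case by (rule X_h_eq_0_of_weak_gradient[OF W_section_x[OF u]])
    qed
    \<comment> \<open>The exceptional null set of parameters found above is the same for all
      \<open>x\<close>, so at each fixed \<open>x\<close> the function of \<open>y\<close> vanishes
      almost everywhere on \<Gamma>.\<close>
    have "(\<lambda>y. u (x, y)) = (\<lambda>_. 0)" for x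
    proof (rule Y_s_eq_0_of_AE[OF W_section_y[OF u] positive_density_interior[OF box assms(3)]])
      show "AE y in lebesgue_on \<Gamma>. u (x, y) = 0"
        using ae by (rule eventually_mono) (meson fun_cong)
    qed
    then have "u (x, y) = 0" for x y by (meson fun_cong)
    then show "u = (\<lambda>_. 0)" by auto
  qed
  obtain Z where Z: "finite Z" "\<And>u. u \<in> ?W \<Longrightarrow> (\<forall>z\<in>Z. u z = 0) \<Longrightarrow> u = (\<lambda>_. 0)"
    using W_determined by blast
  show ?thesis
  proof (rule function_inner_space.variational_inequality_unique_solution[OF inner Z(1)])
    show "u = (\<lambda>_. 0)" if "u \<in> ?W" "\<And>z. z \<in> Z \<Longrightarrow> u z = 0" for u
      using Z(2) that by blast
    show "?K \<subseteq> ?W" by (auto simp: K_hs_def)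
    show "?K \<noteq> {}" by (rule K_nonempty)
    show "l_form D \<Gamma> p f (\<lambda>z. s * u z + t * v z) = s * l_form D \<Gamma> p f u + t * l_form D \<Gamma> p f v"
      if "u \<in> ?W" "v \<in> ?W" for u v s t
      unfolding l_eq using that
      by (intro F.weighted_lincomb[of u u v v] W_bounded_version(1) function_subspaceD(2)[OF function_subspace_W])
    show "(\<lambda>z. (1 - t) * u z + t * v z) \<in> ?K"
      if u: "u \<in> ?K" and v: "v \<in> ?K" and t: "0 \<le> t" "t \<le> 1" for u v t
    proof -
      have "g z \<le> (1 - t) * u z + t * v z" if "g z \<le> u z" "g z \<le> v z" for z
      proof -
        have "(1 - t) * g z + t * g z \<le> (1 - t) * u z + t * v z"
          using that t by (intro add_mono mult_left_mono) auto
        then show ?thesis by (simp add: algebra_simps)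
      qed
      then show ?thesis
        using u v function_subspaceD(2)[OF function_subspace_W, of u v "1 - t" t]
        by (auto simp: K_hs_def)
    qed
    show "u \<in> ?K" if v: "\<And>k. v k \<in> ?K" and u: "u \<in> ?W" and lim: "\<And>z. (\<lambda>k::nat. v k z) \<longlonglongrightarrow> u z" for v u
    proof -
      \<comment> \<open>The constraints are inequalities between values at single points, so they
        survive pointwise limits.\<close>
      have "g (x, y) \<le> u (x, y)" if "x \<in> mesh_vertices \<T> \<inter> D" "y \<in> mesh_vertices \<B>" for x y
        using v that by (intro LIMSEQ_le_const[OF lim]) (auto simp: K_hs_def)
      then show ?thesis using u by (auto simp: K_hs_def)
    qed
  qed
qed

end
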